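(* Let $\Phi$ be a reduced crystallographic root system, $A$ an algebra with elements $\{t_\alpha\}_{\alpha\in\Phi}\subset A$ such that $t_{-\alpha}=t_\alpha$, and $\tau:\mathfrak h\to A$ a linear map. Consider the $A$-valued connection on $H_{\mathrm{reg}}$ $$\nabla=d-\sum_{\alpha\in\Phi_+}\frac{d\alpha}{e^\alpha-1}\,t_\alpha-\sum_i du_i\,\tau(u^i).$$ (1) $\nabla$ is flat if and only if the following relations hold: (tt) for any rank 2 root subsystem $\Psi\subset\Phi$ and $\alpha\in\Psi$, $\big[t_\alpha,\sum_{\beta\in\Psi_+}t_\beta\big]=0$; ($\tau\tau$) for any $u,v\in\mathfrak h$, $[\tau(u),\tau(v)]=0$; ($t\tau$) for any $\alpha\in\Phi_+$, any $w\in W$ such that $w^{-1}\alpha$ is a simple root, and any $u\in\mathfrak h$ such that $\alpha(u)=0$, $[t_\alpha,\tau_w(u)]=0$. (2) Modulo the relations (tt), the relations ($t\tau$) are equivalent to ($t\delta$) $[t_\alpha,\delta(v)]=0$ for any $\alpha\in\Phi$ and $v\in\mathfrak h$ such that $\alpha(v)=0$.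
   Context: $E$ is a Euclidean vector space, $\Phi\subset E^*$ a reduced crystallographic root system with Weyl group $W$, $\Phi_+\subset\Phi$ a chosen system of positive roots, $\Phi_-=-\Phi_+$; "simple" means simple with respect to $\Phi_+$. $Q^\vee\subset E$ is the lattice generated by the coroots, $P\subset E^*$ the dual (weight) lattice, $H=\mathrm{Hom}_{\mathbb Z}(P,\mathbb C^* )$ the torus with Lie algebra $\mathfrak h=\mathrm{Hom}_{\mathbb Z}(P,\mathbb C)$ and coordinate ring $\mathbb CP$; $e^\lambda\in\mathbb C[H]$ is the function corresponding to $\lambda\in P$; $H_{\mathrm{reg}}=H\setminus\bigcup_{\alpha\in\Phi}\{e^\alpha=1\}$. $A$ is an associative algebra over $\mathbb C$. $\{u_i\},\{u^i\}$ are dual bases of $\mathfrak h^*$ and $\mathfrak h$; the differentials $du_i$ are regarded as translation-invariant one-forms on $H$. A root subsystem of $\Phi$ is a subset $\Psi\subset\Phi$ such that $\langle\Psi\rangle_{\mathbb Z}\cap\Phi=\Psi$, where $\langle\Psi\rangle_{\mathbb Z}$ is the $\mathbb Z$-span of $\Psi$ (it need not be complete, i.e. need not be the intersection of $\Phi$ with its real span); its rank is the dimension of its span, and $\Psi_+=\Psi\cap\Phi_+$. For $w\in W$, $\tau_w:\mathfrak h\to A$ is $\tau_w(v)=\tau(v)-\sum_{\alpha\in\Phi_+\cap w\Phi_-}\alpha(v)\,t_\alpha$. The map $\delta:\mathfrak h\to A$ is $\delta(v)=\tau(v)-\frac12\sum_{\alpha\in\Phi_+}\alpha(v)\,t_\alpha$.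 *)

theory Defs
  imports "HOL-Analysis.Analysis" "HOL-Computational_Algebra.Group_Closure"
begin

section \<open>Root systems in the dual of a Euclidean vector space\<close>

text \<open>
  The Euclidean space \<open>E\<close> is a type of class \<open>euclidean_space\<close> and its dual \<open>E\<^sup>*\<close> is the type
  of bounded linear functionals on it (in finite dimension all linear functionals are bounded).
\<close>

type_synonym 'e dual = "'e \<Rightarrow>\<^sub>L real"

text \<open>The vector representing a functional: \<open>\<alpha> v = riesz \<alpha> \<bullet> v\<close>, see \<open>inner_riesz\<close>.\<close>

definition riesz :: "'e::euclidean_space dual \<Rightarrow> 'e" where
  "riesz \<alpha> = (\<Sum>b\<in>Basis. blinfun_apply \<alpha> b *\<^sub>R b)"

lemma inner_riesz: "riesz \<alpha> \<bullet> v = blinfun_apply \<alpha> v"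
proof -
  have "blinfun_apply \<alpha> v = blinfun_apply \<alpha> (\<Sum>b\<in>Basis. (v \<bullet> b) *\<^sub>R b)"
    by (simp add: euclidean_representation)
  also have "\<dots> = (\<Sum>b\<in>Basis. (v \<bullet> b) * blinfun_apply \<alpha> b)"
    by (simp add: blinfun.sum_right blinfun.scaleR_right)
  also have "\<dots> = riesz \<alpha> \<bullet> v"
    unfolding riesz_def inner_sum_left by (simp add: inner_commute[of v] mult.commute)
  finally show ?thesis by simp
qed

definition coroot :: "'e::euclidean_space dual \<Rightarrow> 'e" where
  "coroot \<alpha> = (2 / (riesz \<alpha> \<bullet> riesz \<alpha>)) *\<^sub>R riesz \<alpha>"

text \<open>The orthogonal reflection of \<open>E\<^sup>*\<close> in the hyperplane orthogonal to \<open>\<alpha>\<close>.\<close>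

definition reflection :: "'e::euclidean_space dual \<Rightarrow> 'e dual \<Rightarrow> 'e dual" where
  "reflection \<alpha> \<mu> = \<mu> - blinfun_apply \<mu> (coroot \<alpha>) *\<^sub>R \<alpha>"

definition root_system :: "'e::euclidean_space dual set \<Rightarrow> bool" where
  "root_system \<Phi> \<longleftrightarrow>
     finite \<Phi> \<and> 0 \<notin> \<Phi> \<and> span \<Phi> = UNIV \<and>
     (\<forall>\<alpha>\<in>\<Phi>. \<forall>\<beta>\<in>\<Phi>. reflection \<alpha> \<beta> \<in> \<Phi>)"

definition crystallographic :: "'e::euclidean_space dual set \<Rightarrow> bool" where
  "crystallographic \<Phi> \<longleftrightarrow> (\<forall>\<alpha>\<in>\<Phi>. \<forall>\<beta>\<in>\<Phi>. blinfun_apply \<beta> (coroot \<alpha>) \<in> \<int>)"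

definition reduced_roots :: "'e::euclidean_space dual set \<Rightarrow> bool" where
  "reduced_roots \<Phi> \<longleftrightarrow> (\<forall>\<alpha>\<in>\<Phi>. \<forall>c::real. c *\<^sub>R \<alpha> \<in> \<Phi> \<longrightarrow> c = 1 \<or> c = -1)"

text \<open>The Weyl group, as a group of transformations of \<open>E\<^sup>*\<close>; since reflections are involutions,
  closure under composition suffices.\<close>

inductive_set weyl_group :: "'e::euclidean_space dual set \<Rightarrow> ('e dual \<Rightarrow> 'e dual) set"
  for \<Phi> :: "'e dual set" where
  weyl_id: "id \<in> weyl_group \<Phi>"
| weyl_step: "w \<in> weyl_group \<Phi> \<Longrightarrow> \<alpha> \<in> \<Phi> \<Longrightarrow> reflection \<alpha> \<circ> w \<in> weyl_group \<Phi>"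

text \<open>Systems of positive roots are those cut out by a vector on which no root vanishes,
  i.e. those attached to the Weyl chambers.\<close>

definition positive_system :: "'e::euclidean_space dual set \<Rightarrow> 'e dual set \<Rightarrow> bool" where
  "positive_system \<Phi> \<Phi>p \<longleftrightarrow>
     (\<exists>x. (\<forall>\<alpha>\<in>\<Phi>. blinfun_apply \<alpha> x \<noteq> 0) \<and> \<Phi>p = {\<alpha>\<in>\<Phi>. blinfun_apply \<alpha> x > 0})"

definition simple_roots :: "'e::euclidean_space dual set \<Rightarrow> 'e dual set" where
  "simple_roots \<Phi>p = {\<alpha>\<in>\<Phi>p. \<not> (\<exists>\<beta>\<in>\<Phi>p. \<exists>\<gamma>\<in>\<Phi>p. \<alpha> = \<beta> + \<gamma>)}"

text \<open>\<open>group_closure\<close> is the additive subgroup generated by a set, i.e. its integral span.\<close>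

definition root_subsystem :: "'e::euclidean_space dual set \<Rightarrow> 'e dual set \<Rightarrow> bool" where
  "root_subsystem \<Phi> \<Psi> \<longleftrightarrow> \<Psi> \<subseteq> \<Phi> \<and> group_closure \<Psi> \<inter> \<Phi> = \<Psi>"

definition coroot_lattice :: "'e::euclidean_space dual set \<Rightarrow> 'e set" where
  "coroot_lattice \<Phi> = group_closure (coroot ` \<Phi>)"

definition weight_lattice :: "'e::euclidean_space dual set \<Rightarrow> 'e dual set" where
  "weight_lattice \<Phi> = {\<mu>. \<forall>q\<in>coroot_lattice \<Phi>. blinfun_apply \<mu> q \<in> \<int>}"

section \<open>The torus and its Lie algebra\<close>

text \<open>
  Homomorphisms defined on the weight lattice \<open>P\<close> are encoded as functions on all of \<open>E\<^sup>*\<close> taking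
  the neutral value (\<open>1\<close> resp. \<open>0\<close>) outside \<open>P\<close>, so that each homomorphism is represented exactly
  once and the pointwise operations are the right ones. For \<open>\<mu> \<in> P\<close> the function \<open>e\<^sup>\<mu>\<close> on the torus
  is \<open>z \<mapsto> z \<mu>\<close>, and the value of \<open>\<mu>\<close>, as a linear form on the Lie algebra, at \<open>v\<close> is \<open>v \<mu>\<close>.
\<close>

definition torus :: "'e::euclidean_space dual set \<Rightarrow> ('e dual \<Rightarrow> complex) set" where
  "torus \<Phi> = {z. (\<forall>\<mu>\<in>weight_lattice \<Phi>. z \<mu> \<noteq> 0) \<and>
     (\<forall>\<mu>\<in>weight_lattice \<Phi>. \<forall>\<nu>\<in>weight_lattice \<Phi>. z (\<mu> + \<nu>) = z \<mu> * z \<nu>) \<and>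
     (\<forall>\<mu>. \<mu> \<notin> weight_lattice \<Phi> \<longrightarrow> z \<mu> = 1)}"

definition cartan :: "'e::euclidean_space dual set \<Rightarrow> ('e dual \<Rightarrow> complex) set" where
  "cartan \<Phi> = {v.
     (\<forall>\<mu>\<in>weight_lattice \<Phi>. \<forall>\<nu>\<in>weight_lattice \<Phi>. v (\<mu> + \<nu>) = v \<mu> + v \<nu>) \<and>
     (\<forall>\<mu>. \<mu> \<notin> weight_lattice \<Phi> \<longrightarrow> v \<mu> = 0)}"

definition torus_reg :: "'e::euclidean_space dual set \<Rightarrow> ('e dual \<Rightarrow> complex) set" where
  "torus_reg \<Phi> = torus \<Phi> - (\<Union>\<alpha>\<in>\<Phi>. {z. z \<alpha> = 1})"

text \<open>Translation of a point of the torus by the exponential of a Lie algebra element.\<close>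

definition translate :: "('x \<Rightarrow> complex) \<Rightarrow> ('x \<Rightarrow> complex) \<Rightarrow> ('x \<Rightarrow> complex)" where
  "translate z v = (\<lambda>\<mu>. z \<mu> * exp (v \<mu>))"

definition linear_on_cartan ::
  "'e::euclidean_space dual set \<Rightarrow> (complex \<Rightarrow> 'b \<Rightarrow> 'b::ab_group_add) \<Rightarrow>
     (('e dual \<Rightarrow> complex) \<Rightarrow> 'b) \<Rightarrow> bool" where
  "linear_on_cartan \<Phi> smul f \<longleftrightarrow>
     (\<forall>u\<in>cartan \<Phi>. \<forall>v\<in>cartan \<Phi>. f (\<lambda>\<mu>. u \<mu> + v \<mu>) = f u + f v) \<and>
     (\<forall>c. \<forall>v\<in>cartan \<Phi>. f (\<lambda>\<mu>. c * v \<mu>) = smul c (f v))"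

text \<open>\<open>ul\<close> (lower indices) and \<open>uu\<close> (upper indices) are dual bases of the dual of the Lie algebra
  and of the Lie algebra. Independence of both families follows from the pairing, and the last
  conjunct says that \<open>uu\<close> spans.\<close>

definition dual_bases ::
  "'e::euclidean_space dual set \<Rightarrow> 'i set \<Rightarrow> ('i \<Rightarrow> ('e dual \<Rightarrow> complex) \<Rightarrow> complex) \<Rightarrow>
     ('i \<Rightarrow> 'e dual \<Rightarrow> complex) \<Rightarrow> bool" where
  "dual_bases \<Phi> I ul uu \<longleftrightarrow>
     finite I \<and>
     (\<forall>i\<in>I. linear_on_cartan \<Phi> (*) (ul i)) \<and>
     (\<forall>i\<in>I. uu i \<in> cartan \<Phi>) \<and>
     (\<forall>i\<in>I. \<forall>j\<in>I. ul i (uu j) = (if i = j then 1 else 0)) \<and>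
     (\<forall>v\<in>cartan \<Phi>. \<exists>c. v = (\<lambda>\<mu>. \<Sum>i\<in>I. c i * uu i \<mu>))"

section \<open>Connections with values in an associative algebra\<close>

text \<open>A possibly non-unital, possibly infinite-dimensional associative algebra over the complex
  numbers.\<close>

locale complex_algebra = vector_space smul
  for smul :: "complex \<Rightarrow> 'a::ring \<Rightarrow> 'a" +
  assumes scale_mult_left: "smul c x * y = smul c (x * y)"
    and scale_mult_right: "x * smul c y = smul c (x * y)"

definition commutator :: "'a::ring \<Rightarrow> 'a \<Rightarrow> 'a" where
  "commutator x y = x * y - y * x"

text \<open>
  The derivative at \<open>z\<close> of an algebra-valued function \<open>F\<close> on the torus along the
  translation-invariant vector field \<open>v\<close>. As the algebra carries no topology, derivatives are
  taken after composition with every linear form on it. Linear forms separate points, so this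
  determines the derivative, and on finite sums of terms (scalar function) times (constant
  element of the algebra) it differentiates the scalar factors.
\<close>

definition has_torus_deriv ::
  "(complex \<Rightarrow> 'a::ring \<Rightarrow> 'a) \<Rightarrow> (('x \<Rightarrow> complex) \<Rightarrow> 'a) \<Rightarrow> ('x \<Rightarrow> complex) \<Rightarrow>
     ('x \<Rightarrow> complex) \<Rightarrow> 'a \<Rightarrow> bool" where
  "has_torus_deriv smul F z v D \<longleftrightarrow>
     (\<forall>\<phi>. Vector_Spaces.linear smul (*) \<phi> \<longrightarrow>
        ((\<lambda>s::complex. \<phi> (F (translate z (\<lambda>\<mu>. s * v \<mu>)))) has_field_derivative \<phi> D) (at 0))"

definition torus_deriv ::
  "(complex \<Rightarrow> 'a::ring \<Rightarrow> 'a) \<Rightarrow> (('x \<Rightarrow> complex) \<Rightarrow> 'a) \<Rightarrow> ('x \<Rightarrow> complex) \<Rightarrow>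
     ('x \<Rightarrow> complex) \<Rightarrow> 'a" where
  "torus_deriv smul F z v = (THE D. has_torus_deriv smul F z v D)"

lemma (in complex_algebra) has_torus_deriv_unique:
  assumes "has_torus_deriv smul F z v D" "has_torus_deriv smul F z v D'"
  shows "D = D'"
proof (rule ccontr)
  assume "D \<noteq> D'"
  interpret vp: vector_space_pair smul "(*) :: complex \<Rightarrow> complex \<Rightarrow> complex"
    by unfold_locales (simp_all add: algebra_simps)
  have "independent {D - D'}"
    using \<open>D \<noteq> D'\<close> by simp
  then obtain \<phi> where \<phi>: "Vector_Spaces.linear smul (*) \<phi>" "\<phi> (D - D') = (1::complex)"
    using vp.linear_independent_extend[of "{D - D'}" "\<lambda>_. 1"] by auto
  have "\<phi> D = \<phi> D'"
    using assms \<phi>(1) unfolding has_torus_deriv_def by (blast intro: DERIV_unique)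
  then show False
    using \<phi> vp.linear_diff[OF \<phi>(1), of D D'] by simp
qed

lemma (in complex_algebra) torus_deriv_eqI:
  "has_torus_deriv smul F z v D \<Longrightarrow> torus_deriv smul F z v = D"
  unfolding torus_deriv_def by (blast intro: the_equality has_torus_deriv_unique)

lemma (in complex_algebra) has_torus_deriv_tensor:
  fixes f :: "'j \<Rightarrow> ('x \<Rightarrow> complex) \<Rightarrow> complex"
  assumes "\<And>j. j \<in> J \<Longrightarrow>
    ((\<lambda>s. f j (translate z (\<lambda>\<mu>. s * v \<mu>))) has_field_derivative f' j) (at 0)"
  shows "has_torus_deriv smul (\<lambda>z. \<Sum>j\<in>J. smul (f j z) (a j)) z v (\<Sum>j\<in>J. smul (f' j) (a j))"
  unfolding has_torus_deriv_def
proof (intro allI impI)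
  fix \<phi> assume \<phi>: "Vector_Spaces.linear smul ((*) :: complex \<Rightarrow> complex \<Rightarrow> complex) \<phi>"
  interpret vp: vector_space_pair smul "(*) :: complex \<Rightarrow> complex \<Rightarrow> complex"
    by unfold_locales (simp_all add: algebra_simps)
  show "((\<lambda>s. \<phi> (\<Sum>j\<in>J. smul (f j (translate z (\<lambda>\<mu>. s * v \<mu>))) (a j)))
      has_field_derivative \<phi> (\<Sum>j\<in>J. smul (f' j) (a j))) (at 0)"
    unfolding vp.linear_sum[OF \<phi>] vp.linear_scale[OF \<phi>]
    by (intro DERIV_sum DERIV_cmult_right assms)
qed

text \<open>
  An algebra-valued one-form \<open>\<omega>\<close> on the torus assigns to a point \<open>z\<close> and a Lie algebra element \<open>v\<close>
  (a translation-invariant vector field) the value \<open>\<omega> z v\<close>. The exterior derivative is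
  evaluated on two such vector fields, which commute. The curvature of \<open>d - \<omega>\<close> is
  \<open>- d \<omega> + \<omega> \<and> \<omega>\<close>, where \<open>(\<omega> \<and> \<omega>)(u, v)\<close> is the commutator of \<open>\<omega> u\<close> and \<open>\<omega> v\<close>.
\<close>

definition ext_deriv ::
  "(complex \<Rightarrow> 'a::ring \<Rightarrow> 'a) \<Rightarrow> (('x \<Rightarrow> complex) \<Rightarrow> ('x \<Rightarrow> complex) \<Rightarrow> 'a) \<Rightarrow>
     ('x \<Rightarrow> complex) \<Rightarrow> ('x \<Rightarrow> complex) \<Rightarrow> ('x \<Rightarrow> complex) \<Rightarrow> 'a" where
  "ext_deriv smul \<omega> z u v =
     torus_deriv smul (\<lambda>z'. \<omega> z' v) z u - torus_deriv smul (\<lambda>z'. \<omega> z' u) z v"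

definition curvature ::
  "(complex \<Rightarrow> 'a::ring \<Rightarrow> 'a) \<Rightarrow> (('x \<Rightarrow> complex) \<Rightarrow> ('x \<Rightarrow> complex) \<Rightarrow> 'a) \<Rightarrow>
     ('x \<Rightarrow> complex) \<Rightarrow> ('x \<Rightarrow> complex) \<Rightarrow> ('x \<Rightarrow> complex) \<Rightarrow> 'a" where
  "curvature smul \<omega> z u v = - ext_deriv smul \<omega> z u v + commutator (\<omega> z u) (\<omega> z v)"

definition flat_connection ::
  "'e::euclidean_space dual set \<Rightarrow> (complex \<Rightarrow> 'a::ring \<Rightarrow> 'a) \<Rightarrow>
     (('e dual \<Rightarrow> complex) \<Rightarrow> ('e dual \<Rightarrow> complex) \<Rightarrow> 'a) \<Rightarrow> bool" where
  "flat_connection \<Phi> smul \<omega> \<longleftrightarrow>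
     (\<forall>z\<in>torus_reg \<Phi>. \<forall>u\<in>cartan \<Phi>. \<forall>v\<in>cartan \<Phi>. curvature smul \<omega> z u v = 0)"

section \<open>The trigonometric connection and the relations\<close>

text \<open>The one-form \<open>\<omega>\<close> of the trigonometric connection \<open>d - \<omega>\<close>.\<close>

definition trig_form ::
  "'e::euclidean_space dual set \<Rightarrow> (complex \<Rightarrow> 'a::ring \<Rightarrow> 'a) \<Rightarrow> ('e dual \<Rightarrow> 'a) \<Rightarrow>
     (('e dual \<Rightarrow> complex) \<Rightarrow> 'a) \<Rightarrow> 'i set \<Rightarrow> ('i \<Rightarrow> ('e dual \<Rightarrow> complex) \<Rightarrow> complex) \<Rightarrow>
     ('i \<Rightarrow> 'e dual \<Rightarrow> complex) \<Rightarrow> ('e dual \<Rightarrow> complex) \<Rightarrow> ('e dual \<Rightarrow> complex) \<Rightarrow> 'a" where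
  "trig_form \<Phi>p smul t \<tau> I ul uu z v =
     (\<Sum>\<alpha>\<in>\<Phi>p. smul (v \<alpha> / (z \<alpha> - 1)) (t \<alpha>)) + (\<Sum>i\<in>I. smul (ul i v) (\<tau> (uu i)))"

definition tau_w ::
  "'e::euclidean_space dual set \<Rightarrow> (complex \<Rightarrow> 'a::ring \<Rightarrow> 'a) \<Rightarrow>
     ('e dual \<Rightarrow> 'a) \<Rightarrow> (('e dual \<Rightarrow> complex) \<Rightarrow> 'a) \<Rightarrow> ('e dual \<Rightarrow> 'e dual) \<Rightarrow>
     ('e dual \<Rightarrow> complex) \<Rightarrow> 'a" where
  "tau_w \<Phi>p smul t \<tau> w v = \<tau> v - (\<Sum>\<alpha>\<in>\<Phi>p \<inter> w ` (uminus ` \<Phi>p). smul (v \<alpha>) (t \<alpha>))"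

definition delta ::
  "'e::euclidean_space dual set \<Rightarrow> (complex \<Rightarrow> 'a::ring \<Rightarrow> 'a) \<Rightarrow> ('e dual \<Rightarrow> 'a) \<Rightarrow>
     (('e dual \<Rightarrow> complex) \<Rightarrow> 'a) \<Rightarrow> ('e dual \<Rightarrow> complex) \<Rightarrow> 'a" where
  "delta \<Phi>p smul t \<tau> v = \<tau> v - smul (1/2) (\<Sum>\<alpha>\<in>\<Phi>p. smul (v \<alpha>) (t \<alpha>))"

definition rel_tt ::
  "'e::euclidean_space dual set \<Rightarrow> 'e dual set \<Rightarrow> ('e dual \<Rightarrow> 'a::ring) \<Rightarrow> bool" where
  "rel_tt \<Phi> \<Phi>p t \<longleftrightarrow>
     (\<forall>\<Psi> \<alpha>. root_subsystem \<Phi> \<Psi> \<and> dim \<Psi> = 2 \<and> \<alpha> \<in> \<Psi> \<longrightarrow>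
        commutator (t \<alpha>) (\<Sum>\<beta>\<in>\<Psi> \<inter> \<Phi>p. t \<beta>) = 0)"

definition rel_tautau ::
  "'e::euclidean_space dual set \<Rightarrow> (('e dual \<Rightarrow> complex) \<Rightarrow> 'a::ring) \<Rightarrow> bool" where
  "rel_tautau \<Phi> \<tau> \<longleftrightarrow> (\<forall>u\<in>cartan \<Phi>. \<forall>v\<in>cartan \<Phi>. commutator (\<tau> u) (\<tau> v) = 0)"

definition rel_ttau ::
  "'e::euclidean_space dual set \<Rightarrow> 'e dual set \<Rightarrow> (complex \<Rightarrow> 'a::ring \<Rightarrow> 'a) \<Rightarrow>
     ('e dual \<Rightarrow> 'a) \<Rightarrow> (('e dual \<Rightarrow> complex) \<Rightarrow> 'a) \<Rightarrow> bool" where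
  "rel_ttau \<Phi> \<Phi>p smul t \<tau> \<longleftrightarrow>
     (\<forall>\<alpha>\<in>\<Phi>p. \<forall>w\<in>weyl_group \<Phi>. inv w \<alpha> \<in> simple_roots \<Phi>p \<longrightarrow>
        (\<forall>u\<in>cartan \<Phi>. u \<alpha> = 0 \<longrightarrow> commutator (t \<alpha>) (tau_w \<Phi>p smul t \<tau> w u) = 0))"

definition rel_tdelta ::
  "'e::euclidean_space dual set \<Rightarrow> 'e dual set \<Rightarrow> (complex \<Rightarrow> 'a::ring \<Rightarrow> 'a) \<Rightarrow>
     ('e dual \<Rightarrow> 'a) \<Rightarrow> (('e dual \<Rightarrow> complex) \<Rightarrow> 'a) \<Rightarrow> bool" where
  "rel_tdelta \<Phi> \<Phi>p smul t \<tau> \<longleftrightarrow>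
     (\<forall>\<alpha>\<in>\<Phi>. \<forall>v\<in>cartan \<Phi>. v \<alpha> = 0 \<longrightarrow> commutator (t \<alpha>) (delta \<Phi>p smul t \<tau> v) = 0)"

end

theory Submission
  imports Defs "HOL-Real_Asymp.Real_Asymp"
begin

text \<open>
  Since the connection form \<open>\<omega>\<close> is closed, the curvature at \<open>u\<close>, \<open>v\<close> is the commutator of \<open>\<omega>(u)\<close> and
  \<open>\<omega>(v)\<close>. It is a combination of the commutators of the \<open>t\<^sub>\<alpha>\<close> and \<open>\<tau>(v)\<close> with products of at most two of the
  functions \<open>f\<^sub>\<alpha> = 1 / (e\<^sup>\<alpha> - 1)\<close> as coefficients. Flatness and relations being linear in these
  commutators, linear forms reduce the theorem to numbers \<open>c \<alpha> \<beta>\<close>, \<open>d \<alpha> v\<close>, \<open>e u v\<close> (locale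
  \<open>scalar_curvature\<close>). The argument then reads the relations off the poles of the curvature:

  \<^item> The residue of the curvature along \<open>e\<^sup>\<alpha> = 1\<close> is
    \<open>R\<^sub>\<alpha>(y) = (\<Sum>\<beta>. y(\<beta>) f\<^sub>\<beta> c \<alpha> \<beta>) + d \<alpha> y\<close>, where \<open>y(\<alpha>) = 0\<close> and \<open>\<beta>\<close> runs over the positive roots other
    than \<open>\<alpha>\<close>. The curvature vanishes if and only if all residues vanish and its value \<open>e u v\<close> at
    infinity in the positive chamber does.
  \<^item> The poles of \<open>R\<^sub>\<alpha>\<close> at a point \<open>z\<close> come from the roots \<open>\<beta>\<close> with \<open>z\<^sup>\<beta> = 1\<close>. Such roots in a given plane
    through \<open>\<alpha>\<close> form a root subsystem, and they contribute with equal weights to the residue, as \<open>y\<close>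
    is determined on the plane up to a factor. So (tt) is the absence of poles of \<open>R\<^sub>\<alpha>\<close>.
  \<^item> The value of \<open>R\<^sub>\<alpha>\<close> at infinity in the direction of the wall of \<open>\<alpha>\<close> in the chamber of \<open>w \<Phi>\<^sub>+\<close>
    is \<open>d \<alpha> y\<close> minus the sum of \<open>y(\<beta>) c \<alpha> \<beta>\<close> over the \<open>\<beta>\<close> in \<open>\<Phi>\<^sub>+ \<inter> w \<Phi>\<^sub>-\<close>, which is (t\<open>\<tau>\<close>).

  That a function without poles which vanishes at infinity is zero is not taken from complex analysis
  here. Along a line \<open>z r\<^sup>x\<close> with an integral vector \<open>x\<close>, the functions \<open>f\<^sub>\<beta>\<close> have the partial fractions
  \<open>n / (a q\<^sup>n - 1) = (\<Sum>r | a r\<^sup>n = 1. r / (q - r))\<close>, which are summed explicitly, for \<open>R\<^sub>\<alpha>\<close> in \<open>resid_eq\<close> and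
  for the curvature in \<open>curv_eq_of_generic\<close>. The converse consists of limits along lines, with one
  arithmetic point: each root subsystem \<open>\<Psi>\<close> of rank 2 is the kernel of a point of the torus on the
  roots (\<open>rank_two_subsystem_vector\<close>), because roots are primitive in the root lattice.

  For part (2), the same summation within planes, with numerators 1 and at the unit element of the torus,
  turns (tt) into the equality of the sum over \<open>\<Phi>\<^sub>+ \<inter> w \<Phi>\<^sub>-\<close> in \<open>\<tau>\<^sub>w\<close> with half the sum over \<open>\<Phi>\<^sub>+\<close> in \<open>\<delta>\<close>, after
  taking commutators with \<open>t\<^sub>\<alpha>\<close> (\<open>half_sum_eq_wall_sum\<close>).

  The facts on root systems that enter are that the reflection in a simple root permutes the other
  positive roots, that each positive root is conjugate to a simple one, and that the
  simple roots take the value 1 at half the sum \<open>\<rho>\<^sup>\<or>\<close> of the positive coroots.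
\<close>

section \<open>Roots, reflections and simple roots\<close>

text \<open>The inner product on the dual space that is transported from the Euclidean space.\<close>

definition ip :: "'e::euclidean_space dual \<Rightarrow> 'e dual \<Rightarrow> real" where
  "ip \<alpha> \<beta> = riesz \<alpha> \<bullet> riesz \<beta>"

lemma riesz_add: "riesz (\<alpha> + \<beta>) = riesz \<alpha> + riesz \<beta>"
  and riesz_diff: "riesz (\<alpha> - \<beta>) = riesz \<alpha> - riesz \<beta>"
  and riesz_scaleR: "riesz (c *\<^sub>R \<alpha>) = c *\<^sub>R riesz \<alpha>"
  by (simp_all add: riesz_def plus_blinfun.rep_eq minus_blinfun.rep_eq scaleR_blinfun.rep_eq
      algebra_simps sum.distrib sum_subtractf scaleR_sum_right)

lemma riesz_eq_0_iff [simp]: "riesz \<alpha> = 0 \<longleftrightarrow> \<alpha> = 0"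
  by (metis blinfun_eqI inner_riesz inner_zero_left zero_blinfun.rep_eq
      riesz_scaleR scaleR_zero_left)

lemma ip_commute: "ip \<alpha> \<beta> = ip \<beta> \<alpha>"
  and ip_add_right: "ip \<beta> (\<alpha> + \<alpha>') = ip \<beta> \<alpha> + ip \<beta> \<alpha>'"
  and ip_diff_left: "ip (\<alpha> - \<alpha>') \<beta> = ip \<alpha> \<beta> - ip \<alpha>' \<beta>"
  and ip_diff_right: "ip \<beta> (\<alpha> - \<alpha>') = ip \<beta> \<alpha> - ip \<beta> \<alpha>'"
  and ip_scaleR_left: "ip (r *\<^sub>R \<alpha>) \<beta> = r * ip \<alpha> \<beta>"
  and ip_scaleR_right: "ip \<alpha> (r *\<^sub>R \<beta>) = r * ip \<alpha> \<beta>"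
  by (simp_all add: ip_def inner_commute riesz_add riesz_diff riesz_scaleR algebra_simps)

lemma ip_pos: "\<alpha> \<noteq> 0 \<Longrightarrow> ip \<alpha> \<alpha> > 0"
  by (simp add: ip_def)

lemma apply_coroot: "blinfun_apply \<beta> (coroot \<alpha>) = 2 * ip \<beta> \<alpha> / ip \<alpha> \<alpha>"
  by (simp add: coroot_def ip_def inner_riesz[symmetric])

lemma apply_coroot_self: "\<alpha> \<noteq> 0 \<Longrightarrow> blinfun_apply \<alpha> (coroot \<alpha>) = 2"
  using ip_pos[of \<alpha>] by (simp add: apply_coroot)

lemma reflection_self: "\<alpha> \<noteq> 0 \<Longrightarrow> reflection \<alpha> \<alpha> = - \<alpha>"
  by (simp add: reflection_def apply_coroot_self scaleR_2)

lemma reflection_apply: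
  "blinfun_apply (reflection \<alpha> \<mu>) x = blinfun_apply \<mu> (x - blinfun_apply \<alpha> x *\<^sub>R coroot \<alpha>)"
  by (simp add: reflection_def minus_blinfun.rep_eq scaleR_blinfun.rep_eq blinfun.diff_right
      blinfun.scaleR_right)

lemma reflection_invol: "\<alpha> \<noteq> 0 \<Longrightarrow> reflection \<alpha> (reflection \<alpha> \<mu>) = \<mu>"
  by (simp add: reflection_def minus_blinfun.rep_eq scaleR_blinfun.rep_eq apply_coroot_self
      flip: scaleR_2)

lemma reflection_linear: "linear (reflection \<alpha>)"
  by (rule linearI)
    (simp_all add: reflection_def plus_blinfun.rep_eq scaleR_blinfun.rep_eq algebra_simps)

lemma ip_reflection:
  assumes "\<alpha> \<noteq> 0"
  shows "ip (reflection \<alpha> \<mu>) (reflection \<alpha> \<nu>) = ip \<mu> \<nu>"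
proof -
  have "ip \<alpha> \<alpha> \<noteq> 0" using ip_pos[OF assms] by simp
  then show ?thesis
    by (simp add: reflection_def apply_coroot ip_diff_left ip_diff_right ip_scaleR_left
        ip_scaleR_right ip_commute[of \<alpha> \<mu>] ip_commute[of \<alpha> \<nu>])
qed

lemma apply_coroot_reflection:
  assumes "\<alpha> \<noteq> 0"
  shows "blinfun_apply (reflection \<alpha> \<mu>) (coroot (reflection \<alpha> \<beta>)) = blinfun_apply \<mu> (coroot \<beta>)"
  using assms by (simp add: apply_coroot ip_reflection)

text \<open>The Cauchy-Schwarz inequality, in the form that bounds products of Cartan integers.\<close>

lemma ip_Cauchy_Schwarz_strict:
  assumes "\<alpha> \<noteq> 0" "\<And>c. \<beta> \<noteq> c *\<^sub>R \<alpha>"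
  shows "(ip \<beta> \<alpha>)\<^sup>2 < ip \<alpha> \<alpha> * ip \<beta> \<beta>"
proof -
  define c where "c = ip \<beta> \<alpha> / ip \<alpha> \<alpha>"
  have pos: "ip \<alpha> \<alpha> > 0" using ip_pos assms(1) .
  have "ip (\<beta> - c *\<^sub>R \<alpha>) (\<beta> - c *\<^sub>R \<alpha>) > 0"
    using assms(2)[of c] by (intro ip_pos) simp
  also have "ip (\<beta> - c *\<^sub>R \<alpha>) (\<beta> - c *\<^sub>R \<alpha>) = ip \<beta> \<beta> - (ip \<beta> \<alpha>)\<^sup>2 / ip \<alpha> \<alpha>"
    using pos unfolding c_def
    by (simp add: ip_diff_left ip_diff_right ip_scaleR_left ip_scaleR_right ip_commute[of \<alpha> \<beta>]
        power2_eq_square field_simps)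
  finally show ?thesis using pos by (simp add: field_simps)
qed

text \<open>A reduced crystallographic root system with a system of positive roots. As the results are
  also needed for \<open>w \<Phi>\<^sub>+\<close>, where \<open>w\<close> is in the Weyl group, the positive roots are a parameter.\<close>

locale based_roots =
  fixes \<Phi> \<Phi>p :: "'e::euclidean_space dual set"
  assumes root_system: "root_system \<Phi>"
    and crystallographic: "crystallographic \<Phi>"
    and reduced: "reduced_roots \<Phi>"
    and positive: "positive_system \<Phi> \<Phi>p"
begin

lemma finite_roots: "finite \<Phi>" and zero_not_root: "0 \<notin> \<Phi>"
  and reflection_root: "\<alpha> \<in> \<Phi> \<Longrightarrow> \<beta> \<in> \<Phi> \<Longrightarrow> reflection \<alpha> \<beta> \<in> \<Phi>"
  using root_system by (auto simp: root_system_def)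

lemma root_nonzero: "\<alpha> \<in> \<Phi> \<Longrightarrow> \<alpha> \<noteq> 0"
  using zero_not_root by blast

lemma uminus_root: "\<alpha> \<in> \<Phi> \<Longrightarrow> - \<alpha> \<in> \<Phi>"
  using reflection_root[of \<alpha> \<alpha>] reflection_self root_nonzero by metis

lemma uminus_root_iff: "- \<alpha> \<in> \<Phi> \<longleftrightarrow> \<alpha> \<in> \<Phi>"
  using uminus_root by force

lemma pairing_int: "\<alpha> \<in> \<Phi> \<Longrightarrow> \<beta> \<in> \<Phi> \<Longrightarrow> blinfun_apply \<beta> (coroot \<alpha>) \<in> \<int>"
  using crystallographic by (simp add: crystallographic_def)

lemma reduced_scaleR: "\<alpha> \<in> \<Phi> \<Longrightarrow> c *\<^sub>R \<alpha> \<in> \<Phi> \<Longrightarrow> c *\<^sub>R \<alpha> = \<alpha> \<or> c *\<^sub>R \<alpha> = - \<alpha>"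
  using reduced by (force simp: reduced_roots_def)

text \<open>A vector of the open Weyl chamber on which the positive roots take positive values.\<close>

definition chamber_vector :: 'e where
  "chamber_vector = (SOME x. (\<forall>\<alpha>\<in>\<Phi>. blinfun_apply \<alpha> x \<noteq> 0) \<and> \<Phi>p = {\<alpha>\<in>\<Phi>. blinfun_apply \<alpha> x > 0})"

lemma chamber_vector:
  shows chamber_vector_nz: "\<alpha> \<in> \<Phi> \<Longrightarrow> blinfun_apply \<alpha> chamber_vector \<noteq> 0"
    and positive_iff: "\<alpha> \<in> \<Phi>p \<longleftrightarrow> \<alpha> \<in> \<Phi> \<and> blinfun_apply \<alpha> chamber_vector > 0"
proof -
  have "(\<forall>\<alpha>\<in>\<Phi>. blinfun_apply \<alpha> chamber_vector \<noteq> 0) \<and>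
      \<Phi>p = {\<alpha>\<in>\<Phi>. blinfun_apply \<alpha> chamber_vector > 0}"
    unfolding chamber_vector_def
    using positive[unfolded positive_system_def] by (rule someI_ex)
  then show "\<alpha> \<in> \<Phi> \<Longrightarrow> blinfun_apply \<alpha> chamber_vector \<noteq> 0"
    "\<alpha> \<in> \<Phi>p \<longleftrightarrow> \<alpha> \<in> \<Phi> \<and> blinfun_apply \<alpha> chamber_vector > 0" by auto
qed

lemma positive_root: "\<alpha> \<in> \<Phi>p \<Longrightarrow> \<alpha> \<in> \<Phi>"
  using positive_iff by blast

lemma finite_positive: "finite \<Phi>p"
  using finite_roots positive_root by (meson finite_subset subsetI)

lemma positive_or_uminus: "\<alpha> \<in> \<Phi> \<Longrightarrow> \<alpha> \<in> \<Phi>p \<or> - \<alpha> \<in> \<Phi>p"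
  using chamber_vector_nz[of \<alpha>] uminus_root[of \<alpha>]
  by (auto simp: positive_iff uminus_blinfun.rep_eq)

lemma not_positive_uminus: "\<alpha> \<in> \<Phi>p \<Longrightarrow> - \<alpha> \<notin> \<Phi>p"
  by (auto simp: positive_iff uminus_blinfun.rep_eq)

lemma positive_nonzero: "\<alpha> \<in> \<Phi>p \<Longrightarrow> \<alpha> \<noteq> 0"
  using positive_root root_nonzero by blast

lemma positive_not_proportional: "\<alpha> \<in> \<Phi>p \<Longrightarrow> \<beta> \<in> \<Phi>p \<Longrightarrow> \<beta> \<noteq> \<alpha> \<Longrightarrow> \<beta> \<noteq> c *\<^sub>R \<alpha>"
  using reduced_scaleR positive_root not_positive_uminus by metis

lemma simple_positive: "\<alpha> \<in> simple_roots \<Phi>p \<Longrightarrow> \<alpha> \<in> \<Phi>p"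
  and simple_not_sum: "\<alpha> \<in> simple_roots \<Phi>p \<Longrightarrow> \<beta> \<in> \<Phi>p \<Longrightarrow> \<gamma> \<in> \<Phi>p \<Longrightarrow> \<alpha> \<noteq> \<beta> + \<gamma>"
  by (auto simp: simple_roots_def)

text \<open>Two non-proportional roots at an acute angle have Cartan integers \<open>n, m \<ge> 1\<close> with
  \<open>n m \<le> 3\<close>.\<close>

lemma acute_pairings:
  assumes "\<alpha> \<in> \<Phi>" "\<beta> \<in> \<Phi>" "\<beta> \<noteq> \<alpha>" "\<beta> \<noteq> - \<alpha>" "ip \<beta> \<alpha> > 0"
  obtains n m :: int where "blinfun_apply \<beta> (coroot \<alpha>) = of_int n" "blinfun_apply \<alpha> (coroot \<beta>) = of_int m"
    "n \<ge> 1" "m \<ge> 1" "n * m \<le> 3"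
proof -
  obtain n m :: int where nm: "blinfun_apply \<beta> (coroot \<alpha>) = of_int n" "blinfun_apply \<alpha> (coroot \<beta>) = of_int m"
    using pairing_int[OF assms(1,2)] pairing_int[OF assms(2,1)] by (elim Ints_cases)
  have pos: "ip \<alpha> \<alpha> > 0" "ip \<beta> \<beta> > 0"
    using assms root_nonzero ip_pos by blast+
  have "\<beta> \<noteq> c *\<^sub>R \<alpha>" for c
    using reduced_scaleR[of \<alpha> c] assms by auto
  from ip_Cauchy_Schwarz_strict[OF root_nonzero[OF assms(1)] this]
  have cs: "(ip \<beta> \<alpha>)\<^sup>2 < ip \<alpha> \<alpha> * ip \<beta> \<beta>" .
  have "real_of_int n > 0" "real_of_int m > 0"
    unfolding nm[symmetric] apply_coroot using pos assms(5) by (simp_all add: ip_commute)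
  moreover have "real_of_int (n * m) < 4"
    unfolding of_int_mult nm[symmetric] apply_coroot using pos cs
    by (simp add: ip_commute[of \<alpha> \<beta>] field_simps power2_eq_square)
  ultimately show ?thesis using that[OF nm] by linarith
qed

lemma diff_root:
  assumes "\<alpha> \<in> \<Phi>" "\<beta> \<in> \<Phi>" "\<beta> \<noteq> \<alpha>" "\<beta> \<noteq> - \<alpha>" "ip \<beta> \<alpha> > 0"
  shows "\<beta> - \<alpha> \<in> \<Phi>"
proof -
  obtain n m :: int where nm: "blinfun_apply \<beta> (coroot \<alpha>) = of_int n" "blinfun_apply \<alpha> (coroot \<beta>) = of_int m"
    "n \<ge> 1" "m \<ge> 1" "n * m \<le> 3"
    using acute_pairings[OF assms] .
  have "n = 1 \<or> m = 1"
  proof (rule ccontr)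
    assume "\<not> (n = 1 \<or> m = 1)"
    then have "2 * 2 \<le> n * m" using nm by (intro mult_mono) auto
    then show False using nm by simp
  qed
  then show ?thesis
  proof
    assume "n = 1"
    then have "reflection \<alpha> \<beta> = \<beta> - \<alpha>" by (simp add: reflection_def nm)
    then show ?thesis using reflection_root[OF assms(1,2)] by simp
  next
    assume "m = 1"
    then have "reflection \<beta> \<alpha> = - (\<beta> - \<alpha>)" by (simp add: reflection_def nm)
    then show ?thesis using reflection_root[OF assms(2,1)] uminus_root_iff by metis
  qed
qed

lemma diff_simple_positive:
  assumes "\<alpha> \<in> simple_roots \<Phi>p" "\<beta> \<in> \<Phi>p" "\<beta> \<noteq> \<alpha>" "ip \<beta> \<alpha> > 0"
  shows "\<beta> - \<alpha> \<in> \<Phi>p"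
proof (rule ccontr)
  assume "\<beta> - \<alpha> \<notin> \<Phi>p"
  have \<alpha>: "\<alpha> \<in> \<Phi>p" using assms simple_positive by blast
  have "\<beta> - \<alpha> \<in> \<Phi>"
    using assms \<alpha> not_positive_uminus[OF \<alpha>] by (intro diff_root positive_root) auto
  then have "\<alpha> - \<beta> \<in> \<Phi>p" using positive_or_uminus \<open>\<beta> - \<alpha> \<notin> \<Phi>p\<close> by fastforce
  then show False using simple_not_sum[OF assms(1,2), of "\<alpha> - \<beta>"] by simp
qed

text \<open>A simple root \<open>\<alpha>\<close> is only known to be indecomposable, so that the usual expansion in simple
  roots is not at hand. If \<open>\<gamma> = - s\<^sub>\<alpha> \<beta>\<close> were positive, then so would be \<open>\<beta> - \<alpha>\<close> and \<open>\<gamma> - \<alpha>\<close>.\<close>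

lemma reflection_simple_positive:
  assumes "\<alpha> \<in> simple_roots \<Phi>p" "\<beta> \<in> \<Phi>p" "\<beta> \<noteq> \<alpha>"
  shows "reflection \<alpha> \<beta> \<in> \<Phi>p"
proof (rule ccontr)
  assume np: "reflection \<alpha> \<beta> \<notin> \<Phi>p"
  have \<alpha>: "\<alpha> \<in> \<Phi>p" "\<alpha> \<in> \<Phi>" "\<alpha> \<noteq> 0" using assms simple_positive positive_root root_nonzero by blast+
  have \<beta>: "\<beta> \<in> \<Phi>" "\<beta> \<noteq> - \<alpha>" using assms \<alpha> positive_root not_positive_uminus by blast+
  define \<gamma> where "\<gamma> = - reflection \<alpha> \<beta>"
  have \<gamma>: "\<gamma> \<in> \<Phi>p"
    using np positive_or_uminus[OF reflection_root[OF \<alpha>(2) \<beta>(1)]] by (simp add: \<gamma>_def)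
  have "\<gamma> \<noteq> \<alpha>"
  proof
    assume "\<gamma> = \<alpha>"
    then have "reflection \<alpha> \<beta> = - \<alpha>" unfolding \<gamma>_def by (metis minus_minus)
    then have "reflection \<alpha> (reflection \<alpha> \<beta>) = reflection \<alpha> (- \<alpha>)" by simp
    then show False
      using \<alpha>(3) assms(3) linear_neg[OF reflection_linear, of \<alpha> \<alpha>]
      by (simp add: reflection_invol reflection_self)
  qed
  have pos: "ip \<beta> \<alpha> > 0"
  proof (rule ccontr)
    assume "\<not> ip \<beta> \<alpha> > 0"
    then have "blinfun_apply \<beta> (coroot \<alpha>) \<le> 0"
      using ip_pos[OF \<alpha>(3)] by (simp add: apply_coroot divide_nonpos_pos)
    then have "blinfun_apply (reflection \<alpha> \<beta>) chamber_vector \<ge> blinfun_apply \<beta> chamber_vector"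
      using \<alpha>(1) unfolding positive_iff
      by (simp add: reflection_def minus_blinfun.rep_eq scaleR_blinfun.rep_eq mult_nonpos_nonneg)
    then show False
      using np assms(2) reflection_root[OF \<alpha>(2) \<beta>(1)] unfolding positive_iff by simp
  qed
  have "ip \<gamma> \<alpha> = ip \<beta> \<alpha>"
    using ip_pos[OF \<alpha>(3)]
    by (simp add: \<gamma>_def reflection_def ip_diff_left ip_scaleR_left apply_coroot)
  then have "\<gamma> - \<alpha> \<in> \<Phi>p" "\<beta> - \<alpha> \<in> \<Phi>p"
    using diff_simple_positive[OF assms(1)] \<gamma> \<open>\<gamma> \<noteq> \<alpha>\<close> assms pos by auto
  moreover obtain n m :: int where n: "blinfun_apply \<beta> (coroot \<alpha>) = of_int n" "1 \<le> n" "1 \<le> m" "n * m \<le> 3"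
    using acute_pairings[OF \<alpha>(2) \<beta>(1) assms(3) \<beta>(2) pos] by metis
  \<comment> \<open>The positive roots \<open>\<gamma> - \<alpha>\<close> and \<open>\<beta> - \<alpha>\<close> add up to \<open>(n - 2) \<alpha>\<close>, where \<open>n \<le> 3\<close>.\<close>
  have sum: "(\<gamma> - \<alpha>) + (\<beta> - \<alpha>) = (of_int n - 2) *\<^sub>R \<alpha>"
    by (simp add: \<gamma>_def reflection_def n algebra_simps scaleR_2)
  have "n \<le> 3" using n(2-4) mult_left_mono[of 1 m n] by linarith
  then consider "n \<le> 2" | "n = 3" by linarith
  then show False
  proof cases
    case 1
    have "blinfun_apply ((\<gamma> - \<alpha>) + (\<beta> - \<alpha>)) chamber_vector > 0"
      using calculation unfolding positive_iff by (simp add: plus_blinfun.rep_eq)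
    moreover have "(of_int n - 2) * blinfun_apply \<alpha> chamber_vector \<le> 0"
      using 1 \<alpha>(1) unfolding positive_iff by (simp add: mult_nonpos_nonneg)
    ultimately show False unfolding sum by (simp add: scaleR_blinfun.rep_eq)
  next
    case 2
    then have "\<alpha> = (\<gamma> - \<alpha>) + (\<beta> - \<alpha>)" unfolding sum by simp
    then show False using simple_not_sum[OF assms(1)] calculation by blast
  qed
qed

lemma positive_root_induct [consumes 1, case_names simple add]:
  assumes "\<beta> \<in> \<Phi>p"
    and simple: "\<And>\<alpha>. \<alpha> \<in> simple_roots \<Phi>p \<Longrightarrow> P \<alpha>"
    and add: "\<And>\<beta> \<gamma>. \<beta> \<in> \<Phi>p \<Longrightarrow> \<gamma> \<in> \<Phi>p \<Longrightarrow> P \<beta> \<Longrightarrow> P \<gamma> \<Longrightarrow> P (\<beta> + \<gamma>)"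
  shows "P \<beta>"
  using assms(1)
proof (induction "card {\<gamma>\<in>\<Phi>p. blinfun_apply \<gamma> chamber_vector < blinfun_apply \<beta> chamber_vector}"
    arbitrary: \<beta> rule: less_induct)
  case less
  show ?case
  proof (cases "\<beta> \<in> simple_roots \<Phi>p")
    case False
    then obtain \<gamma> \<delta> where gd: "\<gamma> \<in> \<Phi>p" "\<delta> \<in> \<Phi>p" "\<beta> = \<gamma> + \<delta>"
      using less.prems by (auto simp: simple_roots_def)
    have low: "P \<epsilon>" if "\<epsilon> \<in> \<Phi>p" "blinfun_apply \<epsilon> chamber_vector < blinfun_apply \<beta> chamber_vector" for \<epsilon>
      using that finite_positive by (intro less.hyps psubset_card_mono psubsetI) auto
    have "P \<gamma>" "P \<delta>"
      using gd by (auto intro!: low simp: plus_blinfun.rep_eq positive_iff)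
    then show ?thesis using gd add by simp
  qed (use simple in blast)
qed

text \<open>The sum of the positive coroots, twice the vector usually called \<open>\<rho>\<^sup>\<or>\<close>.\<close>

definition two_rho :: 'e where
  "two_rho = (\<Sum>\<beta>\<in>\<Phi>p. coroot \<beta>)"

text \<open>The reflection in a simple root \<open>\<alpha>\<close> permutes the other positive roots, so that their coroots
  contribute nothing.\<close>

lemma simple_two_rho:
  assumes "\<alpha> \<in> simple_roots \<Phi>p"
  shows "blinfun_apply \<alpha> two_rho = 2"
proof -
  have \<alpha>: "\<alpha> \<in> \<Phi>p" "\<alpha> \<noteq> 0" using assms simple_positive positive_nonzero by blast+
  have "reflection \<alpha> \<beta> \<in> \<Phi>p - {\<alpha>}" if "\<beta> \<in> \<Phi>p - {\<alpha>}" for \<beta>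
    using that reflection_simple_positive[OF assms, of \<beta>] \<alpha> not_positive_uminus[of \<alpha>]
      reflection_invol[OF \<alpha>(2), of \<beta>] reflection_self[OF \<alpha>(2)] by auto
  then have sub: "reflection \<alpha> ` (\<Phi>p - {\<alpha>}) \<subseteq> \<Phi>p - {\<alpha>}"
    by (rule image_subsetI)
  have bij: "bij_betw (reflection \<alpha>) (\<Phi>p - {\<alpha>}) (\<Phi>p - {\<alpha>})"
    by (rule bij_betw_byWitness[where f' = "reflection \<alpha>", OF _ _ sub sub])
      (simp_all add: reflection_invol[OF \<alpha>(2)])
  define S where "S = (\<Sum>\<beta>\<in>\<Phi>p - {\<alpha>}. blinfun_apply \<alpha> (coroot \<beta>))"
  have "S = (\<Sum>\<beta>\<in>\<Phi>p - {\<alpha>}. blinfun_apply \<alpha> (coroot (reflection \<alpha> \<beta>)))"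
    unfolding S_def by (rule sum.reindex_bij_betw[OF bij, symmetric])
  also have "\<dots> = (\<Sum>\<beta>\<in>\<Phi>p - {\<alpha>}. - blinfun_apply \<alpha> (coroot \<beta>))"
  proof (rule sum.cong[OF refl])
    fix \<beta>
    have "blinfun_apply \<alpha> (coroot (reflection \<alpha> \<beta>)) =
        blinfun_apply (reflection \<alpha> (- \<alpha>)) (coroot (reflection \<alpha> \<beta>))"
      using \<alpha>(2) linear_neg[OF reflection_linear, of \<alpha> \<alpha>] by (simp add: reflection_self)
    then show "blinfun_apply \<alpha> (coroot (reflection \<alpha> \<beta>)) = - blinfun_apply \<alpha> (coroot \<beta>)"
      using \<alpha>(2) by (simp add: apply_coroot_reflection uminus_blinfun.rep_eq)
  qed
  finally have "S = 0" by (simp add: sum_negf S_def)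
  have "blinfun_apply \<alpha> two_rho = (\<Sum>\<beta>\<in>\<Phi>p. blinfun_apply \<alpha> (coroot \<beta>))"
    by (simp add: two_rho_def blinfun.sum_right)
  also have "\<dots> = blinfun_apply \<alpha> (coroot \<alpha>) + S"
    unfolding S_def by (rule sum.remove[OF finite_positive \<alpha>(1)])
  finally show ?thesis using \<open>S = 0\<close> \<alpha>(2) by (simp add: apply_coroot_self)
qed

lemma positive_two_rho:
  assumes "\<beta> \<in> \<Phi>p"
  obtains n :: nat where "n > 0" "blinfun_apply \<beta> two_rho = 2 * of_nat n"
proof -
  have "\<exists>n::nat. n > 0 \<and> blinfun_apply \<beta> two_rho = 2 * of_nat n"
    using assms
  proof (induction rule: positive_root_induct)
    case (simple \<alpha>)
    then show ?case using simple_two_rho by (intro exI[of _ 1]) simp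
  next
    case (add \<beta> \<gamma>)
    then obtain n m :: nat where "n > 0" "blinfun_apply \<beta> two_rho = 2 * of_nat n"
      "m > 0" "blinfun_apply \<gamma> two_rho = 2 * of_nat m" by blast
    then show ?case by (intro exI[of _ "n + m"]) (simp add: plus_blinfun.rep_eq)
  qed
  then show ?thesis using that by blast
qed

text \<open>\<open>2\<rho>\<^sup>\<or> - \<alpha>\<^sup>\<or>\<close> lies in the relative interior of the wall of the chamber defined by \<open>\<alpha>\<close>.\<close>

definition wall_vector :: "'e dual \<Rightarrow> 'e" where
  "wall_vector \<alpha> = two_rho - coroot \<alpha>"

lemma wall_vector_self: "\<alpha> \<in> simple_roots \<Phi>p \<Longrightarrow> blinfun_apply \<alpha> (wall_vector \<alpha>) = 0"
  using simple_positive positive_nonzero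
  by (simp add: wall_vector_def blinfun.diff_right simple_two_rho apply_coroot_self)

lemma wall_vector_pos:
  assumes "\<alpha> \<in> simple_roots \<Phi>p" "\<beta> \<in> \<Phi>p" "\<beta> \<noteq> \<alpha>"
  shows "blinfun_apply \<beta> (wall_vector \<alpha>) > 0"
proof -
  \<comment> \<open>The value is the mean of the values of \<open>\<beta>\<close> and of its reflection at \<open>2\<rho>\<^sup>\<or>\<close>.\<close>
  have "blinfun_apply \<beta> two_rho > 0" "blinfun_apply (reflection \<alpha> \<beta>) two_rho > 0"
    using positive_two_rho[OF assms(2)] positive_two_rho[OF reflection_simple_positive[OF assms]]
    by (metis mult_pos_pos of_nat_0_less_iff zero_less_numeral)+
  then show ?thesis
    using simple_two_rho[OF assms(1)]
    by (simp add: wall_vector_def blinfun.diff_right reflection_def minus_blinfun.rep_eq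
        scaleR_blinfun.rep_eq)
qed

lemma wall_vector_int:
  assumes "\<alpha> \<in> \<Phi>" "\<beta> \<in> \<Phi>"
  shows "blinfun_apply \<beta> (wall_vector \<alpha>) \<in> \<int>"
  unfolding wall_vector_def two_rho_def blinfun.diff_right blinfun.sum_right
  using assms positive_root pairing_int by (intro Ints_diff Ints_sum) auto

end

section \<open>The Weyl group\<close>

lemma weyl_bij:
  assumes "w \<in> weyl_group \<Phi>" "0 \<notin> \<Phi>"
  shows "bij w"
  using assms(1)
proof induction
  case (weyl_step w \<alpha>)
  have "bij (reflection \<alpha>)"
    using weyl_step assms(2) reflection_invol by (metis involuntory_imp_bij)
  then show ?case using weyl_step bij_comp by blast
qed (simp add: id_def[symmetric])

context based_roots
begin

lemma weyl_based_roots: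
  assumes "w \<in> weyl_group \<Phi>"
  shows "based_roots \<Phi> (w ` \<Phi>p)" "simple_roots (w ` \<Phi>p) = w ` simple_roots \<Phi>p" "linear w"
  using assms
proof induction
  case weyl_id
  { case 1 show ?case by (simp add: based_roots_axioms)
  next
    case 2 show ?case by simp
  next
    case 3 show ?case by (simp only: linear_id)
  }
next
  case (weyl_step w \<alpha>)
  have \<alpha>: "\<alpha> \<noteq> 0" using weyl_step root_nonzero by blast
  interpret w: based_roots \<Phi> "w ` \<Phi>p" using weyl_step by blast
  have img: "(reflection \<alpha> \<circ> w) ` \<Phi>p = reflection \<alpha> ` w ` \<Phi>p" by (rule image_comp[symmetric])
  have inj: "inj (reflection \<alpha>)" using reflection_invol[OF \<alpha>] by (metis injI)
  { case 1
    have "positive_system \<Phi> (reflection \<alpha> ` w ` \<Phi>p)"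
      unfolding positive_system_def
    proof (intro exI conjI ballI)
      let ?x = "w.chamber_vector - blinfun_apply \<alpha> w.chamber_vector *\<^sub>R coroot \<alpha>"
      show "blinfun_apply \<beta> ?x \<noteq> 0" if "\<beta> \<in> \<Phi>" for \<beta>
        unfolding reflection_apply[symmetric]
        using weyl_step that by (intro w.chamber_vector_nz reflection_root)
      show "reflection \<alpha> ` w ` \<Phi>p = {\<beta> \<in> \<Phi>. blinfun_apply \<beta> ?x > 0}"
        unfolding reflection_apply[symmetric]
      proof (intro equalityI subsetI)
        fix \<beta> assume "\<beta> \<in> reflection \<alpha> ` w ` \<Phi>p"
        then obtain \<gamma> where "\<beta> = reflection \<alpha> \<gamma>" "\<gamma> \<in> w ` \<Phi>p" by blast
        then show "\<beta> \<in> {\<beta> \<in> \<Phi>. blinfun_apply (reflection \<alpha> \<beta>) w.chamber_vector > 0}"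
          using weyl_step by (simp add: w.positive_iff reflection_invol[OF \<alpha>] reflection_root)
      next
        fix \<beta> assume "\<beta> \<in> {\<beta> \<in> \<Phi>. blinfun_apply (reflection \<alpha> \<beta>) w.chamber_vector > 0}"
        then have "reflection \<alpha> \<beta> \<in> w ` \<Phi>p"
          using weyl_step by (simp add: w.positive_iff reflection_root)
        then have "reflection \<alpha> (reflection \<alpha> \<beta>) \<in> reflection \<alpha> ` w ` \<Phi>p" by (rule imageI)
        then show "\<beta> \<in> reflection \<alpha> ` w ` \<Phi>p" by (simp add: reflection_invol[OF \<alpha>])
      qed
    qed
    then show ?case unfolding img
      using root_system crystallographic reduced by unfold_locales
  next
    case 2
    have sum: "(reflection \<alpha> \<beta> = reflection \<alpha> \<gamma> + reflection \<alpha> \<delta>) \<longleftrightarrow> \<beta> = \<gamma> + \<delta>" for \<beta> \<gamma> \<delta>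
      using inj_eq[OF inj] linear_add[OF reflection_linear] by metis
    have "simple_roots (reflection \<alpha> ` w ` \<Phi>p) = reflection \<alpha> ` simple_roots (w ` \<Phi>p)"
      unfolding simple_roots_def by (auto simp del: image_image simp: sum)
    also have "\<dots> = reflection \<alpha> ` w ` simple_roots \<Phi>p"
      using weyl_step by simp
    finally show ?case by (simp only: image_comp)
  next
    case 3
    show ?case using weyl_step reflection_linear linear_compose by blast
  }
qed

lemma inv_weyl_simple_iff:
  assumes "w \<in> weyl_group \<Phi>"
  shows "inv w \<alpha> \<in> simple_roots \<Phi>p \<longleftrightarrow> \<alpha> \<in> simple_roots (w ` \<Phi>p)"
proof -
  have "bij w" using weyl_bij[OF assms zero_not_root] .
  then have "inv w \<alpha> \<in> simple_roots \<Phi>p \<longleftrightarrow> w (inv w \<alpha>) \<in> w ` simple_roots \<Phi>p"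
    by (simp add: inj_image_mem_iff bij_is_inj)
  then show ?thesis
    using \<open>bij w\<close> weyl_based_roots(2)[OF assms] by (simp add: bij_is_surj surj_f_inv_f)
qed

text \<open>Every positive root is conjugate to a simple root: as long as it is not simple, the
  reflection in some simple root lowers it and keeps it positive.\<close>

lemma weyl_to_simple:
  assumes "\<alpha> \<in> \<Phi>p"
  shows "\<exists>w\<in>weyl_group \<Phi>. \<alpha> \<in> simple_roots (w ` \<Phi>p)"
  using assms
proof (induction "card {\<gamma>\<in>\<Phi>p. blinfun_apply \<gamma> chamber_vector < blinfun_apply \<alpha> chamber_vector}"
    arbitrary: \<alpha> rule: less_induct)
  case less
  show ?case
  proof (cases "\<alpha> \<in> simple_roots \<Phi>p")
    case True
    then show ?thesis by (intro bexI[OF _ weyl_id]) simp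
  next
    case False
    have "\<exists>\<delta>\<in>simple_roots \<Phi>p. ip \<alpha> \<delta> > 0"
    proof (rule ccontr)
      assume "\<not> ?thesis"
      then have "\<forall>\<delta>\<in>simple_roots \<Phi>p. ip \<alpha> \<delta> \<le> 0" by (simp add: not_less)
      moreover have "ip \<alpha> \<beta> \<le> 0" if "\<beta> \<in> \<Phi>p" "\<forall>\<delta>\<in>simple_roots \<Phi>p. ip \<alpha> \<delta> \<le> 0" for \<beta>
        using that
        by (induction rule: positive_root_induct) (auto simp: ip_add_right)
      ultimately have "ip \<alpha> \<alpha> \<le> 0" using less.prems by blast
      then show False using ip_pos[OF positive_nonzero[OF less.prems]] by simp
    qed
    then obtain \<delta> where \<delta>: "\<delta> \<in> simple_roots \<Phi>p" "ip \<alpha> \<delta> > 0" by blast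
    have \<delta>p: "\<delta> \<in> \<Phi>p" "\<delta> \<in> \<Phi>" "\<delta> \<noteq> 0"
      using \<delta> simple_positive positive_root root_nonzero by blast+
    let ?\<beta> = "reflection \<delta> \<alpha>"
    have pos: "?\<beta> \<in> \<Phi>p" using \<delta> False less.prems by (intro reflection_simple_positive) auto
    have "blinfun_apply \<alpha> (coroot \<delta>) > 0"
      using \<delta> ip_pos[OF \<delta>p(3)] by (simp add: apply_coroot)
    then have "blinfun_apply ?\<beta> chamber_vector < blinfun_apply \<alpha> chamber_vector"
      using \<delta>p(1)[unfolded positive_iff]
      by (simp add: reflection_def minus_blinfun.rep_eq scaleR_blinfun.rep_eq)
    then have "card {\<gamma>\<in>\<Phi>p. blinfun_apply \<gamma> chamber_vector < blinfun_apply ?\<beta> chamber_vector}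
        < card {\<gamma>\<in>\<Phi>p. blinfun_apply \<gamma> chamber_vector < blinfun_apply \<alpha> chamber_vector}"
      using pos finite_positive by (intro psubset_card_mono psubsetI) auto
    from less.hyps[OF this pos] obtain w
      where w: "w \<in> weyl_group \<Phi>" "?\<beta> \<in> simple_roots (w ` \<Phi>p)" by blast
    have w': "reflection \<delta> \<circ> w \<in> weyl_group \<Phi>" using w(1) \<delta>p(2) by (rule weyl_step)
    obtain \<epsilon> where "\<epsilon> \<in> simple_roots \<Phi>p" "?\<beta> = w \<epsilon>"
      using w(2) weyl_based_roots(2)[OF w(1)] by auto
    moreover have "\<alpha> = reflection \<delta> ?\<beta>" by (simp add: reflection_invol[OF \<delta>p(3)])
    ultimately have "\<alpha> = (reflection \<delta> \<circ> w) \<epsilon>" by (metis comp_apply)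
    then have "\<alpha> \<in> simple_roots ((reflection \<delta> \<circ> w) ` \<Phi>p)"
      using weyl_based_roots(2)[OF w'] \<open>\<epsilon> \<in> simple_roots \<Phi>p\<close> by (metis imageI)
    then show ?thesis using w' by blast
  qed
qed

text \<open>A wall vector for a simple root \<open>\<alpha>\<close> of the positive system \<open>w \<Phi>\<^sub>+\<close>: integral, orthogonal to
  \<open>\<alpha>\<close>, and positive on the other elements of \<open>w \<Phi>\<^sub>+\<close>.\<close>

lemma weyl_wall:
  assumes "w \<in> weyl_group \<Phi>" "\<alpha> \<in> simple_roots (w ` \<Phi>p)" "\<alpha> \<in> \<Phi>"
  obtains x where "blinfun_apply \<alpha> x = 0" "\<And>\<beta>. \<beta> \<in> \<Phi> \<Longrightarrow> blinfun_apply \<beta> x \<in> \<int>"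
    "\<forall>\<beta>\<in>w ` \<Phi>p - {\<alpha>}. blinfun_apply \<beta> x > 0"
proof -
  interpret w: based_roots \<Phi> "w ` \<Phi>p" using assms(1) by (rule weyl_based_roots)
  show ?thesis
    by (rule that[of "w.wall_vector \<alpha>"])
      (use assms in \<open>simp_all add: w.wall_vector_self w.wall_vector_pos w.wall_vector_int\<close>)
qed

text \<open>Roots are primitive in the root lattice, since each of them takes the value 1 at a vector
  which is integral on all roots.\<close>

lemma integral_vector_one:
  assumes "\<alpha> \<in> \<Phi>"
  obtains x where "blinfun_apply \<alpha> x = 1" "\<And>\<beta>. \<beta> \<in> \<Phi> \<Longrightarrow> blinfun_apply \<beta> x \<in> \<int>"
proof -
  have *: "\<exists>x. blinfun_apply \<alpha> x = 1 \<and> (\<forall>\<beta>\<in>\<Phi>. blinfun_apply \<beta> x \<in> \<int>)" if "\<alpha> \<in> \<Phi>p" for \<alpha>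
  proof -
    obtain w where w: "w \<in> weyl_group \<Phi>" "\<alpha> \<in> simple_roots (w ` \<Phi>p)"
      using weyl_to_simple \<open>\<alpha> \<in> \<Phi>p\<close> by blast
    interpret w: based_roots \<Phi> "w ` \<Phi>p" using w(1) by (rule weyl_based_roots)
    let ?x = "(1/2) *\<^sub>R w.two_rho"
    have pos: "blinfun_apply \<beta> ?x \<in> \<int>" if "\<beta> \<in> w ` \<Phi>p" for \<beta>
      using w.positive_two_rho[OF that] by (metis Ints_of_nat blinfun.scaleR_right
          divide_self_if real_scaleR_def mult.assoc mult_1 times_divide_eq_left zero_neq_numeral)
    have "blinfun_apply \<beta> ?x \<in> \<int>" if "\<beta> \<in> \<Phi>" for \<beta>
      using w.positive_or_uminus[OF that]
    proof
      assume "- \<beta> \<in> w ` \<Phi>p"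
      then have "- blinfun_apply \<beta> ?x \<in> \<int>" using pos[of "- \<beta>"] by (simp add: uminus_blinfun.rep_eq)
      then show ?thesis by simp
    qed (rule pos)
    moreover have "blinfun_apply \<alpha> ?x = 1"
      using w.simple_two_rho[OF w(2)] by (simp add: blinfun.scaleR_right)
    ultimately show ?thesis by blast
  qed
  show ?thesis
  proof (cases "\<alpha> \<in> \<Phi>p")
    case True
    then show ?thesis using * that by blast
  next
    case False
    then obtain x where "blinfun_apply (- \<alpha>) x = 1" "\<forall>\<beta>\<in>\<Phi>. blinfun_apply \<beta> x \<in> \<int>"
      using * positive_or_uminus assms by blast
    then show ?thesis using that[of "- x"] by (simp add: uminus_blinfun.rep_eq blinfun.minus_right)
  qed
qed

end

section \<open>Partial fractions\<close>

text \<open>A power sum over the roots of \<open>r\<^sup>n = w\<close> is multiplied by \<open>\<zeta>\<^sup>j \<noteq> 1\<close> under the rotation by a primitive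
  root of unity \<open>\<zeta>\<close>.\<close>

lemma sum_powers_of_roots:
  fixes w :: complex
  assumes "0 < j" "j < n"
  shows "(\<Sum>r | r ^ n = w. r ^ j) = 0"
proof -
  have n: "n > 0" using assms by simp
  define \<zeta> where "\<zeta> = cis (2 * pi / of_nat n)"
  have "\<zeta> ^ n = cis (2 * pi)" unfolding \<zeta>_def Complex.DeMoivre using n by simp
  then have z: "\<zeta> ^ n = 1" "\<zeta> \<noteq> 0" by (simp_all add: \<zeta>_def)
  have zj: "\<zeta> ^ j \<noteq> 1"
  proof
    assume "\<zeta> ^ j = 1"
    then have "cis (2 * pi * of_nat j / of_nat n) = 1"
      unfolding \<zeta>_def Complex.DeMoivre by (simp add: mult_ac)
    moreover have inj: "inj_on (\<lambda>k. cis (2 * pi * real k / real n)) {..<n}"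
      using Complex.bij_betw_roots_unity[OF n] by (rule bij_betw_imp_inj_on)
    ultimately have "j = 0" using inj_onD[OF inj, of j 0] assms n by simp
    then show False using assms by simp
  qed
  have "bij_betw (\<lambda>r. \<zeta> * r) {r. r ^ n = w} {r. r ^ n = w}"
    by (rule bij_betw_byWitness[where f' = "\<lambda>r. r / \<zeta>"])
      (use z in \<open>auto simp: power_mult_distrib power_divide\<close>)
  from sum.reindex_bij_betw[OF this, of "\<lambda>r. r ^ j"]
  have "(\<Sum>r | r ^ n = w. (\<zeta> * r) ^ j) = (\<Sum>r | r ^ n = w. r ^ j)" .
  then have "\<zeta> ^ j * (\<Sum>r | r ^ n = w. r ^ j) = (\<Sum>r | r ^ n = w. r ^ j)"
    by (simp add: power_mult_distrib sum_distrib_left)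
  then show ?thesis using zj by simp
qed

lemma partial_fractions:
  fixes a q :: complex
  assumes "n > 0" "a \<noteq> 0" "a * q ^ n \<noteq> 1"
  shows "of_nat n / (a * q ^ n - 1) = (\<Sum>r | a * r ^ n = 1. r / (q - r))"
proof -
  define w where "w = 1 / a"
  have w: "w \<noteq> 0" "a = 1 / w" using assms by (auto simp: w_def)
  have "a * r ^ n = 1 \<longleftrightarrow> r ^ n = w" for r using w(1) unfolding w(2) by (auto simp: field_simps)
  then have set: "{r. a * r ^ n = 1} = {r. r ^ n = w}" by simp
  have qw: "q ^ n \<noteq> w" using assms w by auto
  have fin: "finite {r. r ^ n = w}" and card: "card {r. r ^ n = w} = n"
    using finite_nth_roots card_nth_roots w assms by auto
  have "(\<Sum>r | r ^ n = w. r / (q - r)) = (\<Sum>r | r ^ n = w. (\<Sum>k<n. q ^ k * r ^ (n - k)) / (q ^ n - w))"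
  proof (rule sum.cong[OF refl])
    fix r assume r: "r \<in> {r. r ^ n = w}"
    have "q - r \<noteq> 0" using r qw by auto
    have "q ^ n - r ^ n = (q - r) * (\<Sum>k<n. r ^ (n - Suc k) * q ^ k)"
      by (rule power_diff_sumr2)
    then have "r * (q ^ n - w) = (q - r) * (r * (\<Sum>k<n. r ^ (n - Suc k) * q ^ k))"
      using r by simp
    also have "r * (\<Sum>k<n. r ^ (n - Suc k) * q ^ k) = (\<Sum>k<n. q ^ k * r ^ (n - k))"
      unfolding sum_distrib_left
      by (intro sum.cong refl) (simp add: Suc_diff_Suc flip: power_Suc mult.assoc)
    finally show "r / (q - r) = (\<Sum>k<n. q ^ k * r ^ (n - k)) / (q ^ n - w)"
      using qw \<open>q - r \<noteq> 0\<close> by (simp add: field_simps)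
  qed
  also have "\<dots> = (\<Sum>k<n. q ^ k * (\<Sum>r | r ^ n = w. r ^ (n - k))) / (q ^ n - w)"
    by (subst sum_divide_distrib[symmetric], subst sum.swap) (simp add: sum_distrib_left)
  also have "(\<Sum>k<n. q ^ k * (\<Sum>r | r ^ n = w. r ^ (n - k))) = (\<Sum>k<n. if k = 0 then of_nat n * w else 0)"
  proof (intro sum.cong refl)
    fix k assume "k \<in> {..<n}"
    then show "q ^ k * (\<Sum>r | r ^ n = w. r ^ (n - k)) = (if k = 0 then of_nat n * w else 0)"
      using sum_powers_of_roots[of "n - k" n w] by (cases "k = 0") (auto simp: card)
  qed
  also have "\<dots> = of_nat n * w" using assms by (simp add: sum.delta)
  finally have sum: "(\<Sum>r | r ^ n = w. r / (q - r)) = of_nat n * w / (q ^ n - w)" .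
  have "of_nat n * w / (q ^ n - w) = of_nat n / (a * q ^ n - 1)"
    using w(1) qw unfolding w(2) by (simp add: divide_simps)
  then show ?thesis unfolding set sum by simp
qed

text \<open>If \<open>a\<close> and \<open>n\<close> are the values of a root at a point of the torus and at an integral vector \<open>x\<close>,
  these are the parameters \<open>r\<close> of the points \<open>z r\<^sup>x\<close> at which the function \<open>e\<^sup>\<beta>\<close> has the value 1. For
  negative \<open>n\<close>, the value \<open>0 powi n = 0\<close> keeps 0 out of the set.\<close>

definition line_roots :: "complex \<Rightarrow> int \<Rightarrow> complex set" where
  "line_roots a n = {r. a * r powi n = 1}"

lemma line_roots_nat: "line_roots a (int n) = {r. a * r ^ n = 1}"
  by (simp add: line_roots_def)

lemma line_roots_minus: "a \<noteq> 0 \<Longrightarrow> line_roots a (- n) = line_roots (1 / a) n"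
  by (auto simp: line_roots_def power_int_minus field_simps)

lemma line_roots_nonzero: "n \<noteq> 0 \<Longrightarrow> r \<in> line_roots a n \<Longrightarrow> r \<noteq> 0"
  by (auto simp: line_roots_def power_int_0_left_if)

lemma finite_card_line_roots:
  assumes "a \<noteq> 0" "n \<noteq> 0"
  shows "finite (line_roots a n)" "card (line_roots a n) = nat \<bar>n\<bar>"
proof -
  have *: "finite (line_roots a (int m)) \<and> card (line_roots a (int m)) = m"
    if "a \<noteq> 0" "m > 0" for a m
  proof -
    have "line_roots a (int m) = {r. r ^ m = 1 / a}"
      unfolding line_roots_nat using that by (auto simp: field_simps)
    then show ?thesis using finite_nth_roots[of m "1/a"] card_nth_roots[of "1/a" m] that by simp
  qed
  have "finite (line_roots a n) \<and> card (line_roots a n) = nat \<bar>n\<bar>"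
  proof (cases "n > 0")
    case True
    then show ?thesis using *[of a "nat n"] assms by simp
  next
    case False
    then show ?thesis using *[of "1/a" "nat (- n)"] assms line_roots_minus[of a "- n"] by simp
  qed
  then show "finite (line_roots a n)" "card (line_roots a n) = nat \<bar>n\<bar>" by auto
qed

text \<open>The summand \<open>- n\<close> for negative \<open>n\<close> comes from \<open>1 / (a - 1) = - 1 - 1 / (1 / a - 1)\<close>. These summands
  are the source of the roots in \<open>\<Phi>\<^sub>+ \<inter> w \<Phi>\<^sub>-\<close> in the relations (t\<open>\<tau>\<close>).\<close>

lemma partial_fractions_int:
  assumes "a \<noteq> 0" "a \<noteq> 1" "n \<noteq> 0"
  shows "of_int n / (a - 1) = (if n < 0 then - of_int n else 0) + (\<Sum>r\<in>line_roots a n. r / (1 - r))"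
proof (cases "n > 0")
  case True
  then show ?thesis
    using partial_fractions[of "nat n" a 1] line_roots_nat[of a "nat n"] assms by simp
next
  case False
  have "of_int (- n) / (1 / a - 1) = (\<Sum>r\<in>line_roots a n. r / (1 - r))"
    using partial_fractions[of "nat (- n)" "1 / a" 1] line_roots_nat[of "1 / a" "nat (- n)"]
      line_roots_minus[of a "- n"] False assms by simp
  then show ?thesis using False assms by (auto simp: field_simps)
qed

text \<open>The product of two such fractions with disjoint sets of poles \<open>A\<close>, \<open>B\<close>: the residue at a
  pole of one factor is the residue of that factor times the value of the other one.\<close>

lemma partial_fractions_product:
  assumes "n > 0" "m > 0" "a \<noteq> 0" "b \<noteq> 0" "a \<noteq> 1" "b \<noteq> 1"
    and disj: "{r. a * r ^ n = 1} \<inter> {r. b * r ^ m = (1::complex)} = {}"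
  shows "1 / (a - 1) * (1 / (b - 1)) =
    (\<Sum>r | a * r ^ n = 1. r / (of_nat n * (1 - r)) * (1 / (b * r ^ m - 1))) +
    (\<Sum>r | b * r ^ m = 1. r / (of_nat m * (1 - r)) * (1 / (a * r ^ n - 1)))"
proof -
  let ?A = "{r. a * r ^ n = 1}" and ?B = "{r. b * r ^ m = 1}"
  have n1: "1 \<notin> ?A" "1 \<notin> ?B" using assms by auto
  have A: "1 / (a * q ^ n - 1) = (\<Sum>r\<in>?A. r / (of_nat n * (q - r)))" if "q \<notin> ?A" for q
    using partial_fractions[of n a q] assms that
    by (simp add: sum_divide_distrib mult.commute[of "of_nat n"] nonzero_eq_divide_eq
        flip: divide_divide_eq_left sum_divide_distrib)
  have B: "1 / (b * q ^ m - 1) = (\<Sum>r\<in>?B. r / (of_nat m * (q - r)))" if "q \<notin> ?B" for q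
    using partial_fractions[of m b q] assms that
    by (simp add: sum_divide_distrib mult.commute[of "of_nat m"] nonzero_eq_divide_eq
        flip: divide_divide_eq_left sum_divide_distrib)
  have "(\<Sum>r\<in>?A. r / (of_nat n * (1 - r)) * (1 / (b * r ^ m - 1))) +
      (\<Sum>s\<in>?B. s / (of_nat m * (1 - s)) * (1 / (a * s ^ n - 1))) =
      (\<Sum>r\<in>?A. \<Sum>s\<in>?B. r / (of_nat n * (1 - r)) * (s / (of_nat m * (r - s)))) +
      (\<Sum>s\<in>?B. \<Sum>r\<in>?A. s / (of_nat m * (1 - s)) * (r / (of_nat n * (s - r))))"
    unfolding sum_distrib_left[symmetric]
    using disj by (intro arg_cong2[of _ _ _ _ "(+)"] sum.cong refl) (subst A B; blast)+
  also have "(\<Sum>s\<in>?B. \<Sum>r\<in>?A. s / (of_nat m * (1 - s)) * (r / (of_nat n * (s - r)))) =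
      (\<Sum>r\<in>?A. \<Sum>s\<in>?B. s / (of_nat m * (1 - s)) * (r / (of_nat n * (s - r))))"
    by (rule sum.swap)
  also have "(\<Sum>r\<in>?A. \<Sum>s\<in>?B. r / (of_nat n * (1 - r)) * (s / (of_nat m * (r - s)))) + \<dots> =
      (\<Sum>r\<in>?A. \<Sum>s\<in>?B. r / (of_nat n * (1 - r)) * (s / (of_nat m * (1 - s))))"
    unfolding sum.distrib[symmetric]
  proof (intro sum.cong refl)
    fix r s assume rs: "r \<in> ?A" "s \<in> ?B"
    have "r - s \<noteq> 0" "1 - r \<noteq> 0" "1 - s \<noteq> 0" using rs disj n1 by auto
    moreover have "s - r = - (r - s)" "1 - s = 1 - r + (r - s)" by simp_all
    moreover have "x / (p * k) * (y / (q * h)) + y / (q * (k + h)) * (x / (p * - h)) =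
       x / (p * k) * (y / (q * (k + h)))"
      if "k \<noteq> 0" "h \<noteq> 0" "k + h \<noteq> 0" "p \<noteq> 0" "q \<noteq> 0" for x y k h p q :: complex
      using that by (simp add: divide_simps) (simp add: algebra_simps)
    ultimately show "r / (of_nat n * (1 - r)) * (s / (of_nat m * (r - s))) +
        s / (of_nat m * (1 - s)) * (r / (of_nat n * (s - r))) =
        r / (of_nat n * (1 - r)) * (s / (of_nat m * (1 - s)))"
      using assms(1,2) by (metis of_nat_eq_0_iff less_irrefl)
  qed
  also have "\<dots> = (\<Sum>r\<in>?A. r / (of_nat n * (1 - r))) * (\<Sum>s\<in>?B. s / (of_nat m * (1 - s)))"
    by (simp add: sum_product)
  also have "\<dots> = 1 / (a - 1) * (1 / (b - 1))" using A[OF n1(1)] B[OF n1(2)] by simp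
  finally show ?thesis by simp
qed

section \<open>Points of the torus\<close>

lemma weight_lattice_add: "\<mu> \<in> weight_lattice \<Phi> \<Longrightarrow> \<nu> \<in> weight_lattice \<Phi> \<Longrightarrow> \<mu> + \<nu> \<in> weight_lattice \<Phi>"
  and weight_lattice_minus: "\<mu> \<in> weight_lattice \<Phi> \<Longrightarrow> - \<mu> \<in> weight_lattice \<Phi>"
  and weight_lattice_zero: "0 \<in> weight_lattice \<Phi>"
  by (auto simp: weight_lattice_def plus_blinfun.rep_eq uminus_blinfun.rep_eq zero_blinfun.rep_eq)

text \<open>The element of the Lie algebra given by a vector of the Euclidean space: the evaluation of
  weights at it, extended by 0 outside the weight lattice.\<close>

definition embed :: "'e::euclidean_space dual set \<Rightarrow> 'e \<Rightarrow> 'e dual \<Rightarrow> complex" where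
  "embed \<Phi> x = (\<lambda>\<mu>. if \<mu> \<in> weight_lattice \<Phi> then of_real (blinfun_apply \<mu> x) else 0)"

lemma embed_cartan: "embed \<Phi> x \<in> cartan \<Phi>"
  by (auto simp: embed_def cartan_def weight_lattice_add plus_blinfun.rep_eq)

lemma cartan_add: "u \<in> cartan \<Phi> \<Longrightarrow> v \<in> cartan \<Phi> \<Longrightarrow> (\<lambda>\<mu>. u \<mu> + v \<mu>) \<in> cartan \<Phi>"
  and cartan_scale: "v \<in> cartan \<Phi> \<Longrightarrow> (\<lambda>\<mu>. a * v \<mu>) \<in> cartan \<Phi>"
  by (auto simp: cartan_def algebra_simps)

lemma translate_torus: "z \<in> torus \<Phi> \<Longrightarrow> v \<in> cartan \<Phi> \<Longrightarrow> translate z v \<in> torus \<Phi>"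
  by (auto simp: torus_def cartan_def translate_def exp_add)

text \<open>The point \<open>z exp(s x)\<close> of the torus.\<close>

definition shift :: "'e::euclidean_space dual set \<Rightarrow> ('e dual \<Rightarrow> complex) \<Rightarrow> complex \<Rightarrow> 'e \<Rightarrow> 'e dual \<Rightarrow> complex" where
  "shift \<Phi> z s x = translate z (\<lambda>\<mu>. s * embed \<Phi> x \<mu>)"

lemma shift_torus: "z \<in> torus \<Phi> \<Longrightarrow> shift \<Phi> z s x \<in> torus \<Phi>"
  unfolding shift_def by (intro translate_torus cartan_scale embed_cartan)

lemma one_torus: "(\<lambda>_. 1) \<in> torus \<Phi>"
  by (auto simp: torus_def)

lemma additive_int:
  fixes v :: "'e::euclidean_space dual \<Rightarrow> complex"
  assumes "v \<in> cartan \<Phi>" "\<mu> \<in> weight_lattice \<Phi>"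
  shows "of_int k *\<^sub>R \<mu> \<in> weight_lattice \<Phi>" "v (of_int k *\<^sub>R \<mu>) = of_int k * v \<mu>"
proof -
  have add: "v (\<mu> + \<nu>) = v \<mu> + v \<nu>" if "\<mu> \<in> weight_lattice \<Phi>" "\<nu> \<in> weight_lattice \<Phi>" for \<mu> \<nu>
    using assms(1) that by (auto simp: cartan_def)
  have zero: "v 0 = 0" using add[OF weight_lattice_zero weight_lattice_zero] by (simp only: add_0_left) simp
  have minus: "v (- \<mu>) = - v \<mu>" if "\<mu> \<in> weight_lattice \<Phi>" for \<mu>
    using add[OF that weight_lattice_minus[OF that]] zero
    by (simp add: eq_neg_iff_add_eq_0 add.commute)
  have nat: "of_nat n *\<^sub>R \<mu> \<in> weight_lattice \<Phi> \<and> v (of_nat n *\<^sub>R \<mu>) = of_nat n * v \<mu>" for n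
    by (induction n)
      (use assms(2) in \<open>simp_all add: weight_lattice_zero zero algebra_simps weight_lattice_add add\<close>)
  have "of_int k *\<^sub>R \<mu> \<in> weight_lattice \<Phi> \<and> v (of_int k *\<^sub>R \<mu>) = of_int k * v \<mu>"
  proof (cases "k \<ge> 0")
    case True
    then show ?thesis using nat[of "nat k"] by simp
  next
    case False
    then show ?thesis
      using nat[of "nat (- k)"] minus[of "of_nat (nat (- k)) *\<^sub>R \<mu>"]
        weight_lattice_minus[of "of_nat (nat (- k)) *\<^sub>R \<mu>"] by simp
  qed
  then show "of_int k *\<^sub>R \<mu> \<in> weight_lattice \<Phi>" "v (of_int k *\<^sub>R \<mu>) = of_int k * v \<mu>" by auto
qed

context based_roots
begin

lemma root_weight: "\<alpha> \<in> \<Phi> \<Longrightarrow> \<alpha> \<in> weight_lattice \<Phi>"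
proof -
  assume \<alpha>: "\<alpha> \<in> \<Phi>"
  have "blinfun_apply \<alpha> q \<in> \<int>" if "q \<in> group_closure (coroot ` \<Phi>)" for q
    using that by induction (auto simp: blinfun.diff_right \<alpha> pairing_int)
  then show ?thesis by (simp add: weight_lattice_def coroot_lattice_def)
qed

lemma embed_root: "\<beta> \<in> \<Phi> \<Longrightarrow> embed \<Phi> x \<beta> = of_real (blinfun_apply \<beta> x)"
  by (simp add: embed_def root_weight)

lemma shift_root: "\<beta> \<in> \<Phi> \<Longrightarrow> shift \<Phi> z s x \<beta> = z \<beta> * exp (s * of_real (blinfun_apply \<beta> x))"
  by (simp add: shift_def translate_def embed_root)

lemma shift_Ln_root:
  assumes "\<beta> \<in> \<Phi>" "blinfun_apply \<beta> x = of_int n" "r \<noteq> 0"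
  shows "shift \<Phi> z (Ln r) x \<beta> = z \<beta> * r powi n"
proof -
  have "exp (Ln r * of_int n) = r powi n"
    using exp_power_int[of "Ln r" n] assms(3) by (simp add: mult.commute)
  then show ?thesis using assms by (simp add: shift_root)
qed

lemma torus_root_nonzero: "z \<in> torus \<Phi> \<Longrightarrow> \<beta> \<in> \<Phi> \<Longrightarrow> z \<beta> \<noteq> 0"
  using root_weight by (auto simp: torus_def)

lemma torus_uminus:
  assumes "z \<in> torus \<Phi>" "\<beta> \<in> \<Phi>"
  shows "z (- \<beta>) = 1 / z \<beta>"
proof -
  have mult: "z (\<mu> + \<nu>) = z \<mu> * z \<nu>" if "\<mu> \<in> weight_lattice \<Phi>" "\<nu> \<in> weight_lattice \<Phi>" for \<mu> \<nu>
    using assms(1) that by (simp add: torus_def)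
  have "z 0 * z 0 = z 0" using mult[OF weight_lattice_zero weight_lattice_zero] by (metis add_0)
  moreover have "z 0 \<noteq> 0" using assms(1) weight_lattice_zero[of \<Phi>] by (auto simp: torus_def)
  moreover have "z \<beta> * z (- \<beta>) = z 0"
    using mult[OF root_weight[OF assms(2)] root_weight[OF uminus_root[OF assms(2)]]]
    by (metis add.right_inverse)
  ultimately show ?thesis
    using torus_root_nonzero[OF assms] by (simp add: nonzero_eq_divide_eq mult.commute)
qed

lemma torus_regI:
  assumes "z \<in> torus \<Phi>" "\<And>\<alpha>. \<alpha> \<in> \<Phi>p \<Longrightarrow> z \<alpha> \<noteq> 1"
  shows "z \<in> torus_reg \<Phi>"
proof -
  have "z \<alpha> \<noteq> 1" if "\<alpha> \<in> \<Phi>" for \<alpha>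
    using positive_or_uminus[OF that] assms torus_uminus[OF assms(1) that]
      torus_root_nonzero[OF assms(1) that] by auto
  then show ?thesis using assms(1) by (auto simp: torus_reg_def)
qed

text \<open>The kernel of a point of the torus on the roots in a subspace is a root subsystem.\<close>

lemma torus_kernel_subsystem:
  assumes "z \<in> torus \<Phi>" "subspace S"
  shows "root_subsystem \<Phi> {\<gamma>\<in>\<Phi>. \<gamma> \<in> S \<and> z \<gamma> = 1}"
proof -
  let ?\<Psi> = "{\<gamma>\<in>\<Phi>. \<gamma> \<in> S \<and> z \<gamma> = 1}"
  have mult: "z (\<mu> + \<nu>) = z \<mu> * z \<nu>" and nz: "z \<mu> \<noteq> 0"
    if "\<mu> \<in> weight_lattice \<Phi>" "\<nu> \<in> weight_lattice \<Phi>" for \<mu> \<nu>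
    using assms(1) that by (auto simp: torus_def)
  have zero: "z 0 = 1" using mult[of 0 0] nz[of 0] weight_lattice_zero by force
  have "\<mu> \<in> weight_lattice \<Phi> \<and> \<mu> \<in> S \<and> z \<mu> = 1" if "\<mu> \<in> group_closure ?\<Psi>" for \<mu>
    using that
  proof induction
    case (base \<mu>)
    then show ?case
      using zero root_weight weight_lattice_zero subspace_0[OF assms(2)] by auto
  next
    case (diff \<mu> \<nu>)
    then have w: "\<mu> - \<nu> \<in> weight_lattice \<Phi>"
      using weight_lattice_add[of \<mu> \<Phi> "- \<nu>"] weight_lattice_minus by force
    moreover have "z (\<mu> - \<nu> + \<nu>) = z (\<mu> - \<nu>) * z \<nu>" using mult[OF w] diff by blast
    ultimately show ?case using diff subspace_diff[OF assms(2)] by simp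
  qed
  then have "group_closure ?\<Psi> \<inter> \<Phi> \<subseteq> ?\<Psi>" by blast
  moreover have "?\<Psi> \<subseteq> group_closure ?\<Psi> \<inter> \<Phi>" by (auto intro: group_closure.base)
  ultimately show ?thesis unfolding root_subsystem_def by blast
qed

text \<open>On the roots of a plane through \<open>\<alpha>\<close>, two linear forms vanishing at \<open>\<alpha>\<close> are proportional.
  As an element of the Lie algebra is only additive on the weight lattice, integral multiples have
  to be used, and the primitivity of \<open>\<alpha>\<close>.\<close>

lemma cartan_proportional:
  assumes "\<alpha> \<in> \<Phi>" "\<beta> \<in> \<Phi>" "\<gamma> \<in> \<Phi>" "y \<in> cartan \<Phi>" "y \<alpha> = 0"
    and x: "blinfun_apply \<alpha> x = 0" "\<And>\<beta>. \<beta> \<in> \<Phi> \<Longrightarrow> blinfun_apply \<beta> x \<in> \<int>"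
    and "\<gamma> = a *\<^sub>R \<alpha> + b *\<^sub>R \<beta>"
  shows "y \<gamma> * of_real (blinfun_apply \<beta> x) = y \<beta> * of_real (blinfun_apply \<gamma> x)"
proof -
  obtain n m :: int where nm: "blinfun_apply \<beta> x = of_int n" "blinfun_apply \<gamma> x = of_int m"
    using x(2) assms(2,3) by (meson Ints_cases)
  have "of_int m = b * of_int n"
    using nm(2) unfolding assms(8) by (simp add: plus_blinfun.rep_eq scaleR_blinfun.rep_eq x(1) nm(1))
  then have eq: "of_int n *\<^sub>R \<gamma> = (of_int n * a) *\<^sub>R \<alpha> + of_int m *\<^sub>R \<beta>"
    by (simp add: assms(8) algebra_simps)
  obtain \<xi> where \<xi>: "blinfun_apply \<alpha> \<xi> = 1" "\<And>\<beta>. \<beta> \<in> \<Phi> \<Longrightarrow> blinfun_apply \<beta> \<xi> \<in> \<int>"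
    using integral_vector_one[OF assms(1)] by metis
  have "of_int n * a = of_int n * blinfun_apply \<gamma> \<xi> - of_int m * blinfun_apply \<beta> \<xi>"
    using arg_cong[OF eq, of "\<lambda>\<mu>. blinfun_apply \<mu> \<xi>"]
    by (simp add: plus_blinfun.rep_eq scaleR_blinfun.rep_eq \<xi>(1))
  also have "\<dots> \<in> \<int>" using \<xi>(2) assms(2,3) by (intro Ints_diff Ints_mult) auto
  finally obtain k :: int where k: "of_int n * a = of_int k" by (elim Ints_cases)
  note ai = additive_int[OF assms(4)]
  have "of_int n * y \<gamma> = y (of_int n *\<^sub>R \<gamma>)" using ai(2) root_weight assms(3) by simp
  also have "\<dots> = y (of_int k *\<^sub>R \<alpha>) + y (of_int m *\<^sub>R \<beta>)"
    using assms(1,2,4) ai(1) root_weight unfolding eq k by (auto simp: cartan_def)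
  also have "\<dots> = of_int m * y \<beta>" using ai(2) root_weight assms(1,2,5) by simp
  finally show ?thesis by (simp add: nm mult.commute)
qed

end

section \<open>Planes of roots\<close>

lemma span_plane:
  fixes \<alpha> \<beta> \<gamma> :: "'b::real_vector"
  shows "\<gamma> \<in> span {\<alpha>, \<beta>} \<longleftrightarrow> (\<exists>a b. \<gamma> = a *\<^sub>R \<alpha> + b *\<^sub>R \<beta>)"
proof
  assume "\<gamma> \<in> span {\<alpha>, \<beta>}"
  then obtain k l where "\<gamma> - k *\<^sub>R \<alpha> = l *\<^sub>R \<beta>"
    unfolding span_insert[of \<alpha>] span_singleton by blast
  then show "\<exists>a b. \<gamma> = a *\<^sub>R \<alpha> + b *\<^sub>R \<beta>" by (metis add.commute diff_add_cancel)
next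
  assume "\<exists>a b. \<gamma> = a *\<^sub>R \<alpha> + b *\<^sub>R \<beta>"
  then show "\<gamma> \<in> span {\<alpha>, \<beta>}" by (elim exE) (simp add: span_add span_scale span_base)
qed

context based_roots
begin

lemma span_plane_eq:
  assumes "\<alpha> \<in> \<Phi>p" "\<beta> \<in> \<Phi>p - {\<alpha>}" "\<gamma> \<in> \<Phi>p - {\<alpha>}" "\<gamma> \<in> span {\<alpha>, \<beta>}"
  shows "span {\<alpha>, \<gamma>} = span {\<alpha>, \<beta>}"
proof -
  obtain a b where ab: "\<gamma> = a *\<^sub>R \<alpha> + b *\<^sub>R \<beta>" using assms(4) span_plane by blast
  have "b \<noteq> 0" using positive_not_proportional[of \<alpha> \<gamma> a] assms ab by auto
  then have "\<beta> = (- a / b) *\<^sub>R \<alpha> + (1 / b) *\<^sub>R \<gamma>"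
    by (simp add: ab algebra_simps flip: scaleR_add_left)
  then have "\<beta> \<in> span {\<alpha>, \<gamma>}" using span_plane by blast
  then show ?thesis using assms(4)
    by (intro equalityI span_minimal subspace_span) (auto simp: span_base)
qed

lemma dim_plane:
  assumes "\<alpha> \<in> \<Phi>p" "\<beta> \<in> \<Phi>p - {\<alpha>}" "{\<alpha>, \<beta>} \<subseteq> V" "V \<subseteq> span {\<alpha>, \<beta>}"
  shows "dim V = 2"
proof (rule dim_unique[OF assms(3,4)])
  have "\<beta> \<notin> span {\<alpha>}"
    using positive_not_proportional[of \<alpha> \<beta>] assms by (auto simp: span_singleton)
  moreover have "independent {\<alpha>}" using positive_nonzero assms by simp
  ultimately have "independent {\<beta>, \<alpha>}" by (simp add: independent_insert)
  then show "independent {\<alpha>, \<beta>}" by (simp add: insert_commute)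
  show "card {\<alpha>, \<beta>} = 2" using assms by auto
qed

end

section \<open>The scalar curvature\<close>

text \<open>
  The values \<open>c \<alpha> \<beta>\<close>, \<open>d \<alpha> v\<close>, \<open>e u v\<close> of a linear form at the commutators \<open>[t\<^sub>\<alpha>, t\<^sub>\<beta>]\<close>, \<open>[t\<^sub>\<alpha>, \<tau>(v)]\<close>,
  \<open>[\<tau>(u), \<tau>(v)]\<close>. The flatness and the relations are linear in these commutators, and the following
  properties are all that is needed.
\<close>

locale scalar_curvature = based_roots \<Phi> \<Phi>p
  for \<Phi> \<Phi>p :: "'e::euclidean_space dual set" +
  fixes c :: "'e dual \<Rightarrow> 'e dual \<Rightarrow> complex"
    and d :: "'e dual \<Rightarrow> ('e dual \<Rightarrow> complex) \<Rightarrow> complex"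
    and e :: "('e dual \<Rightarrow> complex) \<Rightarrow> ('e dual \<Rightarrow> complex) \<Rightarrow> complex"
  assumes c_swap: "c \<beta> \<alpha> = - c \<alpha> \<beta>"
    and c_minus: "\<alpha> \<in> \<Phi> \<Longrightarrow> c (- \<alpha>) \<beta> = c \<alpha> \<beta>"
    and d_minus: "\<alpha> \<in> \<Phi> \<Longrightarrow> d (- \<alpha>) v = d \<alpha> v"
    and d_linear: "u \<in> cartan \<Phi> \<Longrightarrow> v \<in> cartan \<Phi> \<Longrightarrow>
      d \<alpha> (\<lambda>\<mu>. a * u \<mu> - b * v \<mu>) = a * d \<alpha> u - b * d \<alpha> v"
begin

lemma c_self [simp]: "c \<alpha> \<alpha> = 0"
  using c_swap[of \<alpha> \<alpha>] by simp

text \<open>The value of the linear form at the curvature.\<close>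

definition curv where
  "curv z u v = (\<Sum>\<alpha>\<in>\<Phi>p. \<Sum>\<beta>\<in>\<Phi>p. u \<alpha> / (z \<alpha> - 1) * (v \<beta> / (z \<beta> - 1)) * c \<alpha> \<beta>) +
     (\<Sum>\<alpha>\<in>\<Phi>p. 1 / (z \<alpha> - 1) * (u \<alpha> * d \<alpha> v - v \<alpha> * d \<alpha> u)) + e u v"

text \<open>The residue of the curvature along the hypersurface \<open>e\<^sup>\<alpha> = 1\<close>, where \<open>y = u(\<alpha>) v - v(\<alpha>) u\<close>.\<close>

definition resid where
  "resid z \<alpha> y = (\<Sum>\<beta>\<in>\<Phi>p - {\<alpha>}. y \<beta> / (z \<beta> - 1) * c \<alpha> \<beta>) + d \<alpha> y"

text \<open>The vanishing of the curvature on the regular part of the torus, and that of its residues on the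
  part of each hypersurface that meets no other one.\<close>

definition flat where
  "flat \<longleftrightarrow> (\<forall>z\<in>torus_reg \<Phi>. \<forall>u\<in>cartan \<Phi>. \<forall>v\<in>cartan \<Phi>. curv z u v = 0)"

definition flat_resid where
  "flat_resid \<longleftrightarrow> (\<forall>z\<in>torus \<Phi>. \<forall>\<alpha>\<in>\<Phi>p. \<forall>y\<in>cartan \<Phi>. z \<alpha> = 1 \<and> (\<forall>\<beta>\<in>\<Phi>p - {\<alpha>}. z \<beta> \<noteq> 1) \<and> y \<alpha> = 0 \<longrightarrow>
     resid z \<alpha> y = 0)"

text \<open>The images of the relations (tt), (t\<open>\<tau>\<close>) and (t\<open>\<delta>\<close>) under the linear form.\<close>

definition tt where
  "tt \<longleftrightarrow> (\<forall>\<Psi> \<alpha>. root_subsystem \<Phi> \<Psi> \<and> dim \<Psi> = 2 \<and> \<alpha> \<in> \<Psi> \<longrightarrow> (\<Sum>\<beta>\<in>\<Psi> \<inter> \<Phi>p. c \<alpha> \<beta>) = 0)"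

definition ttau where
  "ttau \<longleftrightarrow> (\<forall>\<alpha>\<in>\<Phi>p. \<forall>w\<in>weyl_group \<Phi>. inv w \<alpha> \<in> simple_roots \<Phi>p \<longrightarrow>
     (\<forall>u\<in>cartan \<Phi>. u \<alpha> = 0 \<longrightarrow> d \<alpha> u = (\<Sum>\<beta>\<in>\<Phi>p \<inter> w ` (uminus ` \<Phi>p). u \<beta> * c \<alpha> \<beta>)))"

definition tdelta where
  "tdelta \<longleftrightarrow> (\<forall>\<alpha>\<in>\<Phi>. \<forall>v\<in>cartan \<Phi>. v \<alpha> = 0 \<longrightarrow> d \<alpha> v = 1 / 2 * (\<Sum>\<beta>\<in>\<Phi>p. v \<beta> * c \<alpha> \<beta>))"

section \<open>Sums over the roots of a plane\<close>

text \<open>The relations (tt) apply to the kernel of a point of the torus on the roots of a plane through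
  \<open>\<alpha>\<close>; where this kernel has rank 1, the sum is empty.\<close>

lemma plane_sum_zero:
  assumes "tt" "\<alpha> \<in> \<Phi>p" "z \<in> torus \<Phi>" "z \<alpha> = 1" "\<beta> \<in> \<Phi>p - {\<alpha>}"
  shows "(\<Sum>\<gamma> | \<gamma> \<in> \<Phi>p - {\<alpha>} \<and> \<gamma> \<in> span {\<alpha>, \<beta>} \<and> z \<gamma> = 1. c \<alpha> \<gamma>) = 0"
proof -
  let ?S = "{\<gamma>. \<gamma> \<in> \<Phi>p - {\<alpha>} \<and> \<gamma> \<in> span {\<alpha>, \<beta>} \<and> z \<gamma> = 1}"
  let ?\<Psi> = "{\<gamma>\<in>\<Phi>. \<gamma> \<in> span {\<alpha>, \<beta>} \<and> z \<gamma> = 1}"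
  show ?thesis
  proof (cases "?S = {}")
    case False
    then obtain \<gamma> where \<gamma>: "\<gamma> \<in> \<Phi>p - {\<alpha>}" "\<gamma> \<in> span {\<alpha>, \<beta>}" "z \<gamma> = 1" by blast
    have \<alpha>: "\<alpha> \<in> ?\<Psi>" using assms positive_root by (auto simp: span_base)
    have "dim ?\<Psi> = 2"
    proof (rule dim_plane[OF assms(2) \<gamma>(1)])
      show "{\<alpha>, \<gamma>} \<subseteq> ?\<Psi>" using \<alpha> \<gamma> positive_root by blast
      show "?\<Psi> \<subseteq> span {\<alpha>, \<gamma>}" using span_plane_eq[OF assms(2,5) \<gamma>(1,2)] by blast
    qed
    moreover have "root_subsystem \<Phi> ?\<Psi>" using assms(3) by (intro torus_kernel_subsystem subspace_span)
    ultimately have "(\<Sum>\<gamma>\<in>?\<Psi> \<inter> \<Phi>p. c \<alpha> \<gamma>) = 0" using \<alpha> assms(1) unfolding tt_def by blast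
    moreover have "?\<Psi> \<inter> \<Phi>p = insert \<alpha> ?S" using \<alpha> assms(2) positive_root by blast
    moreover have "finite ?S" using finite_positive by simp
    ultimately show ?thesis by simp
  qed (simp only: sum.empty)
qed

text \<open>The relations (tt), summed along the line \<open>z exp(s x)\<close> in the hypersurface of \<open>\<alpha>\<close>: at
  each point of that line, the roots of a given plane with value 1 form a root subsystem.\<close>

lemma line_roots_sum_zero:
  fixes g :: "complex \<Rightarrow> complex"
  assumes "tt" "\<alpha> \<in> \<Phi>p" "z \<in> torus \<Phi>" "z \<alpha> = 1" "y \<in> cartan \<Phi>" "y \<alpha> = 0"
    and x: "blinfun_apply \<alpha> x = 0" "\<And>\<beta>. \<beta> \<in> \<Phi> \<Longrightarrow> blinfun_apply \<beta> x = of_int (n \<beta>)"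
      "\<And>\<beta>. \<beta> \<in> \<Phi>p - {\<alpha>} \<Longrightarrow> n \<beta> \<noteq> 0"
  shows "(\<Sum>\<beta>\<in>\<Phi>p - {\<alpha>}. y \<beta> / of_int (n \<beta>) * c \<alpha> \<beta> * (\<Sum>r\<in>line_roots (z \<beta>) (n \<beta>). g r)) = 0"
    (is "sum ?h ?S = 0")
proof -
  have fin: "finite ?S" using finite_positive by simp
  have "sum ?h ?S = (\<Sum>P\<in>(\<lambda>\<beta>. span {\<alpha>, \<beta>}) ` ?S. \<Sum>\<beta> | \<beta> \<in> ?S \<and> span {\<alpha>, \<beta>} = P. ?h \<beta>)"
    by (rule sum.image_gen[OF fin])
  also have "\<dots> = 0"
  proof (rule sum.neutral, rule ballI)
    fix P assume "P \<in> (\<lambda>\<beta>. span {\<alpha>, \<beta>}) ` ?S"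
    then obtain \<beta>\<^sub>0 where \<beta>0: "\<beta>\<^sub>0 \<in> ?S" "P = span {\<alpha>, \<beta>\<^sub>0}" by blast
    define T where "T = {\<beta> \<in> ?S. \<beta> \<in> P}"
    have T: "{\<beta> \<in> ?S. span {\<alpha>, \<beta>} = P} = T"
      using span_plane_eq[OF assms(2) \<beta>0(1)] unfolding T_def \<beta>0(2) by (auto simp: span_base)
    have finT: "finite T" using fin by (simp add: T_def)
    define k where "k = y \<beta>\<^sub>0 / of_int (n \<beta>\<^sub>0)"
    have k: "y \<beta> / of_int (n \<beta>) = k" if "\<beta> \<in> T" for \<beta>
    proof -
      have "\<beta> \<in> span {\<alpha>, \<beta>\<^sub>0}" using that unfolding T_def \<beta>0(2) by blast
      then obtain a b where "\<beta> = a *\<^sub>R \<alpha> + b *\<^sub>R \<beta>\<^sub>0" using span_plane by blast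
      then have "y \<beta> * of_real (blinfun_apply \<beta>\<^sub>0 x) = y \<beta>\<^sub>0 * of_real (blinfun_apply \<beta> x)"
        using assms(2,5,6) that \<beta>0(1) x(1,2)
        by (intro cartan_proportional[of \<alpha>]) (auto simp: T_def positive_root)
      then show ?thesis
        using that \<beta>0(1) x(2,3) positive_root by (simp add: k_def T_def field_simps)
    qed
    define U where "U = (\<Union>\<beta>\<in>T. line_roots (z \<beta>) (n \<beta>))"
    have finU: "finite U"
      unfolding U_def using finT assms(3) x(3) positive_root
      by (auto intro!: finite_card_line_roots simp: T_def torus_root_nonzero)
    have "(\<Sum>\<beta>\<in>T. ?h \<beta>) = (\<Sum>\<beta>\<in>T. k * c \<alpha> \<beta> * (\<Sum>r\<in>U. if r \<in> line_roots (z \<beta>) (n \<beta>) then g r else 0))"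
    proof (rule sum.cong[OF refl])
      fix \<beta> assume "\<beta> \<in> T"
      then have "{r \<in> U. r \<in> line_roots (z \<beta>) (n \<beta>)} = line_roots (z \<beta>) (n \<beta>)"
        unfolding U_def by blast
      then show "?h \<beta> = k * c \<alpha> \<beta> * (\<Sum>r\<in>U. if r \<in> line_roots (z \<beta>) (n \<beta>) then g r else 0)"
        using k[OF \<open>\<beta> \<in> T\<close>] sum.inter_filter[OF finU, of g "\<lambda>r. r \<in> line_roots (z \<beta>) (n \<beta>)"] by simp
    qed
    also have "\<dots> = (\<Sum>r\<in>U. k * g r * (\<Sum>\<beta>\<in>T. if r \<in> line_roots (z \<beta>) (n \<beta>) then c \<alpha> \<beta> else 0))"
      unfolding sum_distrib_left by (subst sum.swap) (auto intro!: sum.cong)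
    also have "\<dots> = 0"
    proof (rule sum.neutral, rule ballI)
      fix r assume "r \<in> U"
      then have r: "r \<noteq> 0" unfolding U_def T_def using line_roots_nonzero x(3) by blast
      let ?z = "shift \<Phi> z (Ln r) x"
      have z: "?z \<beta> = z \<beta> * r powi n \<beta>" if "\<beta> \<in> \<Phi>" for \<beta>
        using shift_Ln_root[OF that x(2)[OF that] r] .
      have "?z \<alpha> = 1" using z[of \<alpha>] assms(2,4) x(1) x(2)[of \<alpha>] positive_root by simp
      from plane_sum_zero[OF assms(1,2) shift_torus[OF assms(3)] this \<beta>0(1)]
      have "(\<Sum>\<beta> | \<beta> \<in> ?S \<and> \<beta> \<in> P \<and> ?z \<beta> = 1. c \<alpha> \<beta>) = 0" unfolding \<beta>0(2) .
      also have "{\<beta>. \<beta> \<in> ?S \<and> \<beta> \<in> P \<and> ?z \<beta> = 1} = {\<beta> \<in> T. r \<in> line_roots (z \<beta>) (n \<beta>)}"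
        using z positive_root by (auto simp: T_def line_roots_def)
      finally show "k * g r * (\<Sum>\<beta>\<in>T. if r \<in> line_roots (z \<beta>) (n \<beta>) then c \<alpha> \<beta> else 0) = 0"
        by (simp add: sum.inter_filter[OF finT, symmetric])
    qed
    finally show "(\<Sum>\<beta> | \<beta> \<in> ?S \<and> span {\<alpha>, \<beta>} = P. ?h \<beta>) = 0" unfolding T .
  qed
  finally show ?thesis .
qed

section \<open>From the relations to flatness\<close>

text \<open>With (tt), the residue is constant along the hypersurface: the partial fractions in the
  direction of \<open>x\<close> cancel within each plane of roots through \<open>\<alpha>\<close>, and only the constants remain.\<close>

lemma resid_eq:
  assumes "tt" "\<alpha> \<in> \<Phi>p" "z \<in> torus \<Phi>" "z \<alpha> = 1" "\<And>\<beta>. \<beta> \<in> \<Phi>p - {\<alpha>} \<Longrightarrow> z \<beta> \<noteq> 1"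
    "y \<in> cartan \<Phi>" "y \<alpha> = 0"
    and x: "blinfun_apply \<alpha> x = 0" "\<And>\<beta>. \<beta> \<in> \<Phi> \<Longrightarrow> blinfun_apply \<beta> x \<in> \<int>"
      "\<And>\<beta>. \<beta> \<in> \<Phi>p - {\<alpha>} \<Longrightarrow> blinfun_apply \<beta> x \<noteq> 0"
  shows "resid z \<alpha> y = d \<alpha> y - (\<Sum>\<beta> | \<beta> \<in> \<Phi>p - {\<alpha>} \<and> blinfun_apply \<beta> x < 0. y \<beta> * c \<alpha> \<beta>)"
proof -
  define n where "n \<beta> = \<lfloor>blinfun_apply \<beta> x\<rfloor>" for \<beta> :: "'e dual"
  have n: "blinfun_apply \<beta> x = of_int (n \<beta>)" if "\<beta> \<in> \<Phi>" for \<beta>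
    using x(2)[OF that] by (auto simp: n_def elim: Ints_cases)
  have n0: "n \<beta> \<noteq> 0" if "\<beta> \<in> \<Phi>p - {\<alpha>}" for \<beta>
    using x(3)[OF that] n[of \<beta>] that positive_root by auto
  have "y \<beta> / (z \<beta> - 1) * c \<alpha> \<beta> =
      (if blinfun_apply \<beta> x < 0 then - (y \<beta> * c \<alpha> \<beta>) else 0) +
      y \<beta> / of_int (n \<beta>) * c \<alpha> \<beta> * (\<Sum>r\<in>line_roots (z \<beta>) (n \<beta>). r / (1 - r))"
    if "\<beta> \<in> \<Phi>p - {\<alpha>}" for \<beta>
  proof -
    have \<beta>: "\<beta> \<in> \<Phi>" using that positive_root by blast
    have "y \<beta> / (z \<beta> - 1) * c \<alpha> \<beta> = y \<beta> / of_int (n \<beta>) * c \<alpha> \<beta> * (of_int (n \<beta>) / (z \<beta> - 1))"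
      using n0[OF that] by simp
    also have "\<dots> = y \<beta> / of_int (n \<beta>) * c \<alpha> \<beta> * ((if n \<beta> < 0 then - of_int (n \<beta>) else 0) +
        (\<Sum>r\<in>line_roots (z \<beta>) (n \<beta>). r / (1 - r)))"
      using partial_fractions_int[of "z \<beta>" "n \<beta>"] torus_root_nonzero[OF assms(3) \<beta>] assms(5)[OF that]
        n0[OF that] by simp
    finally show ?thesis using n0[OF that] n[OF \<beta>] by (simp add: distrib_left)
  qed
  then have "(\<Sum>\<beta>\<in>\<Phi>p - {\<alpha>}. y \<beta> / (z \<beta> - 1) * c \<alpha> \<beta>) =
      (\<Sum>\<beta>\<in>\<Phi>p - {\<alpha>}. if blinfun_apply \<beta> x < 0 then - (y \<beta> * c \<alpha> \<beta>) else 0) +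
      (\<Sum>\<beta>\<in>\<Phi>p - {\<alpha>}. y \<beta> / of_int (n \<beta>) * c \<alpha> \<beta> * (\<Sum>r\<in>line_roots (z \<beta>) (n \<beta>). r / (1 - r)))"
    by (simp add: sum.distrib)
  also have "(\<Sum>\<beta>\<in>\<Phi>p - {\<alpha>}. y \<beta> / of_int (n \<beta>) * c \<alpha> \<beta> * (\<Sum>r\<in>line_roots (z \<beta>) (n \<beta>). r / (1 - r))) = 0"
    by (rule line_roots_sum_zero[OF assms(1-4,6,7) x(1) n n0])
  also have "(\<Sum>\<beta>\<in>\<Phi>p - {\<alpha>}. if blinfun_apply \<beta> x < 0 then - (y \<beta> * c \<alpha> \<beta>) else 0) =
      - (\<Sum>\<beta> | \<beta> \<in> \<Phi>p - {\<alpha>} \<and> blinfun_apply \<beta> x < 0. y \<beta> * c \<alpha> \<beta>)"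
    using finite_positive by (simp add: sum.inter_filter[symmetric] sum_negf)
  finally show ?thesis by (simp add: resid_def)
qed

text \<open>For a vector \<open>x\<close> inside the wall of \<open>\<alpha>\<close> in the chamber of \<open>w \<Phi>\<^sub>+\<close>, the sum in \<open>\<tau>\<^sub>w\<close> extends over the
  positive roots with a negative value at \<open>x\<close>, and only \<open>\<alpha>\<close> has the value 0.\<close>

lemma wall_negative_roots:
  assumes "w \<in> weyl_group \<Phi>" "\<alpha> \<in> simple_roots (w ` \<Phi>p)" "blinfun_apply \<alpha> x = 0"
    "\<forall>\<beta>\<in>w ` \<Phi>p - {\<alpha>}. blinfun_apply \<beta> x > 0" "\<alpha> \<in> \<Phi>p"
  shows "\<Phi>p \<inter> w ` (uminus ` \<Phi>p) = {\<beta> \<in> \<Phi>p - {\<alpha>}. blinfun_apply \<beta> x < 0}"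
    "\<beta> \<in> \<Phi>p - {\<alpha>} \<Longrightarrow> blinfun_apply \<beta> x \<noteq> 0"
proof -
  interpret w: based_roots \<Phi> "w ` \<Phi>p" using assms(1) by (rule weyl_based_roots)
  have lin: "linear w" using assms(1) by (rule weyl_based_roots)
  have \<alpha>: "\<alpha> \<in> w ` \<Phi>p" using assms(2) by (rule w.simple_positive)
  have neg: "\<beta> \<in> w ` (uminus ` \<Phi>p) \<longleftrightarrow> - \<beta> \<in> w ` \<Phi>p" for \<beta>
    using linear_neg[OF lin] by (auto simp: image_image) (metis (no_types, lifting) image_iff minus_minus)
  have *: "(- \<beta> \<in> w ` \<Phi>p \<longleftrightarrow> blinfun_apply \<beta> x < 0) \<and> blinfun_apply \<beta> x \<noteq> 0" if "\<beta> \<in> \<Phi>p - {\<alpha>}" for \<beta>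
  proof (cases "- \<beta> \<in> w ` \<Phi>p")
    case True
    moreover have "- \<beta> \<noteq> \<alpha>" using that assms(5) not_positive_uminus by force
    ultimately have "blinfun_apply (- \<beta>) x > 0" using assms(4) by blast
    then show ?thesis using True by (simp add: uminus_blinfun.rep_eq)
  next
    case False
    then have "\<beta> \<in> w ` \<Phi>p" using w.positive_or_uminus[of \<beta>] that positive_root by blast
    then have "blinfun_apply \<beta> x > 0" using assms(4) that by blast
    then show ?thesis using False by simp
  qed
  then show "\<beta> \<in> \<Phi>p - {\<alpha>} \<Longrightarrow> blinfun_apply \<beta> x \<noteq> 0" by blast
  have "\<alpha> \<notin> w ` (uminus ` \<Phi>p)" using neg w.not_positive_uminus \<alpha> by blast
  then show "\<Phi>p \<inter> w ` (uminus ` \<Phi>p) = {\<beta> \<in> \<Phi>p - {\<alpha>}. blinfun_apply \<beta> x < 0}"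
    using * neg by blast
qed

lemma tt_ttau_imp_flat_resid:
  assumes "tt" "ttau"
  shows "flat_resid"
  unfolding flat_resid_def
proof (intro ballI impI)
  fix z \<alpha> y assume z: "z \<in> torus \<Phi>" and \<alpha>: "\<alpha> \<in> \<Phi>p" and y: "y \<in> cartan \<Phi>"
    and *: "z \<alpha> = 1 \<and> (\<forall>\<beta>\<in>\<Phi>p - {\<alpha>}. z \<beta> \<noteq> 1) \<and> y \<alpha> = 0"
  obtain w where w: "w \<in> weyl_group \<Phi>" "\<alpha> \<in> simple_roots (w ` \<Phi>p)"
    using weyl_to_simple[OF \<alpha>] by blast
  obtain x where x: "blinfun_apply \<alpha> x = 0" "\<And>\<beta>. \<beta> \<in> \<Phi> \<Longrightarrow> blinfun_apply \<beta> x \<in> \<int>"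
    "\<forall>\<beta>\<in>w ` \<Phi>p - {\<alpha>}. blinfun_apply \<beta> x > 0"
    using weyl_wall[OF w positive_root[OF \<alpha>]] by metis
  note neg = wall_negative_roots[OF w x(1,3) \<alpha>]
  have "resid z \<alpha> y = d \<alpha> y - (\<Sum>\<beta> | \<beta> \<in> \<Phi>p - {\<alpha>} \<and> blinfun_apply \<beta> x < 0. y \<beta> * c \<alpha> \<beta>)"
    using * by (intro resid_eq assms(1) \<alpha> z y x neg) auto
  also have "\<dots> = d \<alpha> y - (\<Sum>\<beta>\<in>\<Phi>p \<inter> w ` (uminus ` \<Phi>p). y \<beta> * c \<alpha> \<beta>)"
    unfolding neg(1) by simp
  also have "\<dots> = 0"
    using assms(2) w inv_weyl_simple_iff[OF w(1)] \<alpha> y * unfolding ttau_def by simp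
  finally show "resid z \<alpha> y = 0" .
qed

text \<open>The equality behind part (2). For \<open>g = 1\<close> and \<open>z = 1\<close>, the cancellation within planes says that
  the sum of \<open>y \<beta> * c \<alpha> \<beta>\<close>, weighted with the signs of \<open>\<beta> x\<close>, vanishes, as there are \<open>\<bar>\<beta> x\<bar>\<close> roots of
  unity of order dividing \<open>\<beta> x\<close>.\<close>

lemma half_sum_eq_wall_sum:
  assumes "tt" "\<alpha> \<in> \<Phi>p" "y \<in> cartan \<Phi>" "y \<alpha> = 0"
    and w: "w \<in> weyl_group \<Phi>" "\<alpha> \<in> simple_roots (w ` \<Phi>p)"
  shows "1 / 2 * (\<Sum>\<beta>\<in>\<Phi>p. y \<beta> * c \<alpha> \<beta>) = (\<Sum>\<beta>\<in>\<Phi>p \<inter> w ` (uminus ` \<Phi>p). y \<beta> * c \<alpha> \<beta>)"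
proof -
  obtain x where x: "blinfun_apply \<alpha> x = 0" "\<And>\<beta>. \<beta> \<in> \<Phi> \<Longrightarrow> blinfun_apply \<beta> x \<in> \<int>"
    "\<forall>\<beta>\<in>w ` \<Phi>p - {\<alpha>}. blinfun_apply \<beta> x > 0"
    using weyl_wall[OF w positive_root[OF assms(2)]] by metis
  note neg = wall_negative_roots[OF w x(1,3) assms(2)]
  define n where "n \<beta> = \<lfloor>blinfun_apply \<beta> x\<rfloor>" for \<beta> :: "'e dual"
  have n: "blinfun_apply \<beta> x = of_int (n \<beta>)" if "\<beta> \<in> \<Phi>" for \<beta>
    using x(2)[OF that] by (auto simp: n_def elim: Ints_cases)
  have n0: "n \<beta> \<noteq> 0" if "\<beta> \<in> \<Phi>p - {\<alpha>}" for \<beta>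
    using neg(2)[OF that] n[of \<beta>] that positive_root by auto
  have "0 = (\<Sum>\<beta>\<in>\<Phi>p - {\<alpha>}. y \<beta> / of_int (n \<beta>) * c \<alpha> \<beta> * (\<Sum>r\<in>line_roots 1 (n \<beta>). 1))"
    using line_roots_sum_zero[OF assms(1,2) one_torus refl assms(3,4) x(1) n n0, of "\<lambda>_. 1"] by simp
  also have "\<dots> = (\<Sum>\<beta>\<in>\<Phi>p - {\<alpha>}. y \<beta> * c \<alpha> \<beta> - 2 * (if blinfun_apply \<beta> x < 0 then y \<beta> * c \<alpha> \<beta> else 0))"
  proof (rule sum.cong[OF refl])
    fix \<beta> assume \<beta>: "\<beta> \<in> \<Phi>p - {\<alpha>}"
    have "(\<Sum>r\<in>line_roots 1 (n \<beta>). 1) = (of_int \<bar>n \<beta>\<bar> :: complex)"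
      using finite_card_line_roots(2)[OF _ n0[OF \<beta>], of 1] by simp
    then show "y \<beta> / of_int (n \<beta>) * c \<alpha> \<beta> * (\<Sum>r\<in>line_roots 1 (n \<beta>). 1) =
        y \<beta> * c \<alpha> \<beta> - 2 * (if blinfun_apply \<beta> x < 0 then y \<beta> * c \<alpha> \<beta> else 0)"
      using n0[OF \<beta>] n[of \<beta>] \<beta> positive_root by (auto simp: abs_if)
  qed
  also have "\<dots> = (\<Sum>\<beta>\<in>\<Phi>p - {\<alpha>}. y \<beta> * c \<alpha> \<beta>) - 2 * (\<Sum>\<beta>\<in>\<Phi>p \<inter> w ` (uminus ` \<Phi>p). y \<beta> * c \<alpha> \<beta>)"
    unfolding neg(1) sum.inter_filter[OF finite_Diff[OF finite_positive]]
    by (simp add: sum_subtractf sum_distrib_left)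
  also have "(\<Sum>\<beta>\<in>\<Phi>p - {\<alpha>}. y \<beta> * c \<alpha> \<beta>) = (\<Sum>\<beta>\<in>\<Phi>p. y \<beta> * c \<alpha> \<beta>)"
    by (simp add: sum.remove[OF finite_positive assms(2)])
  finally show ?thesis by simp
qed

theorem ttau_iff_tdelta:
  assumes "tt"
  shows "ttau \<longleftrightarrow> tdelta"
proof
  assume "ttau"
  have pos: "d \<alpha> v = 1 / 2 * (\<Sum>\<beta>\<in>\<Phi>p. v \<beta> * c \<alpha> \<beta>)" if av: "\<alpha> \<in> \<Phi>p" "v \<in> cartan \<Phi>" "v \<alpha> = 0" for \<alpha> v
  proof -
    obtain w where w: "w \<in> weyl_group \<Phi>" "\<alpha> \<in> simple_roots (w ` \<Phi>p)"
      using weyl_to_simple[OF av(1)] by blast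
    then show ?thesis
      using \<open>ttau\<close> av half_sum_eq_wall_sum[OF assms av w] inv_weyl_simple_iff[OF w(1)]
      unfolding ttau_def by simp
  qed
  show "tdelta" unfolding tdelta_def
  proof (intro ballI impI)
    fix \<alpha> v assume \<alpha>: "\<alpha> \<in> \<Phi>" and v: "v \<in> cartan \<Phi>" "v \<alpha> = 0"
    show "d \<alpha> v = 1 / 2 * (\<Sum>\<beta>\<in>\<Phi>p. v \<beta> * c \<alpha> \<beta>)"
    proof (cases "\<alpha> \<in> \<Phi>p")
      case False
      then have "- \<alpha> \<in> \<Phi>p" using positive_or_uminus \<alpha> by blast
      moreover have "v (- \<alpha>) = 0"
        using additive_int(2)[OF v(1) root_weight[OF \<alpha>], of "-1"] v(2) by simp
      ultimately show ?thesis using pos[of "- \<alpha>" v] v(1) d_minus[OF \<alpha>] c_minus[OF \<alpha>] by simp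
    qed (use pos v in blast)
  qed
next
  assume td: "tdelta"
  show "ttau" unfolding ttau_def
  proof (intro ballI impI)
    fix \<alpha> w u assume *: "\<alpha> \<in> \<Phi>p" "w \<in> weyl_group \<Phi>" "inv w \<alpha> \<in> simple_roots \<Phi>p" "u \<in> cartan \<Phi>" "u \<alpha> = 0"
    have "\<alpha> \<in> simple_roots (w ` \<Phi>p)" using * inv_weyl_simple_iff by blast
    from half_sum_eq_wall_sum[OF assms *(1,4,5,2) this]
    moreover have "d \<alpha> u = 1 / 2 * (\<Sum>\<beta>\<in>\<Phi>p. u \<beta> * c \<alpha> \<beta>)"
      using td * positive_root unfolding tdelta_def by blast
    ultimately show "d \<alpha> u = (\<Sum>\<beta>\<in>\<Phi>p \<inter> w ` (uminus ` \<Phi>p). u \<beta> * c \<alpha> \<beta>)" by simp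
  qed
qed

end

text \<open>A subspace is not covered by the kernels of finitely many linear forms that are nonzero on
  it.\<close>

lemma generic_vector:
  fixes F :: "'e::euclidean_space dual set"
  assumes "finite F" "subspace S" "\<And>\<gamma>. \<gamma> \<in> F \<Longrightarrow> \<exists>x\<in>S. blinfun_apply \<gamma> x \<noteq> 0"
  shows "\<exists>x\<in>S. \<forall>\<gamma>\<in>F. blinfun_apply \<gamma> x \<noteq> 0"
  using assms(1,3)
proof (induction F)
  case empty
  then show ?case using subspace_0[OF assms(2)] by blast
next
  case (insert \<gamma> F)
  then obtain x y where x: "x \<in> S" "\<forall>\<delta>\<in>F. blinfun_apply \<delta> x \<noteq> 0" and y: "y \<in> S" "blinfun_apply \<gamma> y \<noteq> 0"
    by (metis insertCI)
  obtain k where k: "k \<notin> (\<lambda>\<delta>. - blinfun_apply \<delta> x / blinfun_apply \<delta> y) ` insert \<gamma> F"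
    using ex_new_if_finite[OF infinite_UNIV_char_0, of "(\<lambda>\<delta>. - blinfun_apply \<delta> x / blinfun_apply \<delta> y) ` insert \<gamma> F"]
      insert.hyps(1) by blast
  have "blinfun_apply \<delta> (x + k *\<^sub>R y) \<noteq> 0" if "\<delta> \<in> insert \<gamma> F" for \<delta>
  proof (cases "blinfun_apply \<delta> y = 0")
    case True
    then have "\<delta> \<in> F" using y(2) that by auto
    then show ?thesis using x(2) True by (simp add: blinfun.add_right blinfun.scaleR_right)
  next
    case False
    have "k \<noteq> - blinfun_apply \<delta> x / blinfun_apply \<delta> y" using k that by blast
    then show ?thesis
      using False by (simp add: blinfun.add_right blinfun.scaleR_right field_simps)
  qed
  then show ?case
    using x(1) y(1) subspace_add[OF assms(2)] subspace_scale[OF assms(2)] by blast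
qed

context scalar_curvature
begin

text \<open>The curvature is the sum of its partial fractions along the line \<open>z r\<^sup>x\<close> with \<open>x = 2\<rho>\<^sup>\<or>\<close>. The
  genericity assumption says that this line meets no two of the hypersurfaces in the same point,
  hence all poles are simple.\<close>

lemma curv_eq_of_generic:
  fixes n :: "'e dual \<Rightarrow> nat"
  assumes "flat_resid" "z \<in> torus \<Phi>" "u \<in> cartan \<Phi>" "v \<in> cartan \<Phi>"
    and n: "\<And>\<beta>. \<beta> \<in> \<Phi>p \<Longrightarrow> n \<beta> > 0 \<and> blinfun_apply \<beta> two_rho = of_nat (n \<beta>)"
    and reg: "\<And>\<beta>. \<beta> \<in> \<Phi>p \<Longrightarrow> z \<beta> \<noteq> 1"
    and generic: "\<And>\<alpha> \<beta>. \<alpha> \<in> \<Phi>p \<Longrightarrow> \<beta> \<in> \<Phi>p \<Longrightarrow> \<alpha> \<noteq> \<beta> \<Longrightarrow> z \<alpha> ^ n \<beta> \<noteq> z \<beta> ^ n \<alpha>"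
  shows "curv z u v = e u v"
proof -
  define A where "A \<alpha> = {r. z \<alpha> * r ^ n \<alpha> = 1}" for \<alpha>
  define f where "f \<alpha> r = 1 / (z \<alpha> * r ^ n \<alpha> - 1)" for \<alpha> r
  define g where "g \<alpha> r = r / (of_nat (n \<alpha>) * (1 - r))" for \<alpha> and r :: complex
  define T where "T \<alpha> \<beta> = (\<Sum>r\<in>A \<alpha>. g \<alpha> r * f \<beta> r)" for \<alpha> \<beta>
  define Y where "Y \<alpha> = (\<lambda>\<mu>. u \<alpha> * v \<mu> - v \<alpha> * u \<mu>)" for \<alpha>
  have nz: "z \<beta> \<noteq> 0" if "\<beta> \<in> \<Phi>p" for \<beta>
    using that assms(2) positive_root torus_root_nonzero by blast
  have disj: "A \<alpha> \<inter> A \<beta> = {}" if "\<alpha> \<in> \<Phi>p" "\<beta> \<in> \<Phi>p" "\<alpha> \<noteq> \<beta>" for \<alpha> \<beta>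
  proof (rule ccontr)
    assume "A \<alpha> \<inter> A \<beta> \<noteq> {}"
    then obtain r where r: "z \<alpha> * r ^ n \<alpha> = 1" "z \<beta> * r ^ n \<beta> = 1" unfolding A_def by blast
    have "r \<noteq> 0" using r n[OF that(1)] by (auto simp: zero_power)
    have "(z \<alpha> * r ^ n \<alpha>) ^ n \<beta> = (z \<beta> * r ^ n \<beta>) ^ n \<alpha>" using r by simp
    then have "z \<alpha> ^ n \<beta> * r ^ (n \<alpha> * n \<beta>) = z \<beta> ^ n \<alpha> * r ^ (n \<alpha> * n \<beta>)"
      by (simp add: power_mult_distrib mult.commute[of "n \<beta>"] flip: power_mult)
    then show False using generic[OF that] \<open>r \<noteq> 0\<close> by simp
  qed
  have single: "1 / (z \<alpha> - 1) = (\<Sum>r\<in>A \<alpha>. g \<alpha> r)" if "\<alpha> \<in> \<Phi>p" for \<alpha>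
  proof -
    have "of_nat (n \<alpha>) / (z \<alpha> - 1) = (\<Sum>r\<in>A \<alpha>. r / (1 - r))"
      using partial_fractions[of "n \<alpha>" "z \<alpha>" 1] n[OF that] nz[OF that] reg[OF that] by (simp add: A_def)
    also have "\<dots> = of_nat (n \<alpha>) * (\<Sum>r\<in>A \<alpha>. g \<alpha> r)"
      using n[OF that] by (simp add: g_def sum_distrib_left)
    finally have "of_nat (n \<alpha>) * (1 / (z \<alpha> - 1)) = of_nat (n \<alpha>) * (\<Sum>r\<in>A \<alpha>. g \<alpha> r)" by simp
    then show ?thesis unfolding mult_cancel_left using n[OF that] by simp
  qed
  have prod: "1 / (z \<alpha> - 1) * (1 / (z \<beta> - 1)) = T \<alpha> \<beta> + T \<beta> \<alpha>"
    if "\<alpha> \<in> \<Phi>p" "\<beta> \<in> \<Phi>p" "\<alpha> \<noteq> \<beta>" for \<alpha> \<beta>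
    using partial_fractions_product[of "n \<alpha>" "n \<beta>" "z \<alpha>" "z \<beta>"] n nz reg disj[OF that] that
    by (simp add: T_def A_def f_def g_def)
  have "(\<Sum>\<alpha>\<in>\<Phi>p. \<Sum>\<beta>\<in>\<Phi>p. u \<alpha> / (z \<alpha> - 1) * (v \<beta> / (z \<beta> - 1)) * c \<alpha> \<beta>) =
      (\<Sum>\<alpha>\<in>\<Phi>p. \<Sum>\<beta>\<in>\<Phi>p. u \<alpha> * v \<beta> * c \<alpha> \<beta> * T \<alpha> \<beta> + u \<alpha> * v \<beta> * c \<alpha> \<beta> * T \<beta> \<alpha>)"
  proof (intro sum.cong refl)
    fix \<alpha> \<beta> assume ab: "\<alpha> \<in> \<Phi>p" "\<beta> \<in> \<Phi>p"
    show "u \<alpha> / (z \<alpha> - 1) * (v \<beta> / (z \<beta> - 1)) * c \<alpha> \<beta> =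
        u \<alpha> * v \<beta> * c \<alpha> \<beta> * T \<alpha> \<beta> + u \<alpha> * v \<beta> * c \<alpha> \<beta> * T \<beta> \<alpha>"
    proof (cases "\<alpha> = \<beta>")
      case False
      have "u \<alpha> / (z \<alpha> - 1) * (v \<beta> / (z \<beta> - 1)) * c \<alpha> \<beta> =
          u \<alpha> * v \<beta> * c \<alpha> \<beta> * (1 / (z \<alpha> - 1) * (1 / (z \<beta> - 1)))" by simp
      then show ?thesis unfolding prod[OF ab False] by (simp add: distrib_left)
    qed simp
  qed
  also have "\<dots> = (\<Sum>\<alpha>\<in>\<Phi>p. \<Sum>\<beta>\<in>\<Phi>p. u \<alpha> * v \<beta> * c \<alpha> \<beta> * T \<alpha> \<beta>) +
      (\<Sum>\<beta>\<in>\<Phi>p. \<Sum>\<alpha>\<in>\<Phi>p. u \<alpha> * v \<beta> * c \<alpha> \<beta> * T \<beta> \<alpha>)"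
    unfolding sum.distrib by (subst (3) sum.swap) (rule refl)
  also have "\<dots> = (\<Sum>\<alpha>\<in>\<Phi>p. \<Sum>\<beta>\<in>\<Phi>p. Y \<alpha> \<beta> * c \<alpha> \<beta> * T \<alpha> \<beta>)"
    unfolding sum.distrib[symmetric]
  proof (intro sum.cong refl)
    fix \<alpha> \<beta>
    show "u \<alpha> * v \<beta> * c \<alpha> \<beta> * T \<alpha> \<beta> + u \<beta> * v \<alpha> * c \<beta> \<alpha> * T \<alpha> \<beta> = Y \<alpha> \<beta> * c \<alpha> \<beta> * T \<alpha> \<beta>"
      by (simp add: Y_def c_swap[of \<beta> \<alpha>] algebra_simps)
  qed
  also have "\<dots> = (\<Sum>\<alpha>\<in>\<Phi>p. \<Sum>r\<in>A \<alpha>. g \<alpha> r * (\<Sum>\<beta>\<in>\<Phi>p. Y \<alpha> \<beta> * f \<beta> r * c \<alpha> \<beta>))"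
    unfolding T_def sum_distrib_left by (subst (2) sum.swap) (simp add: mult_ac)
  finally have quad: "(\<Sum>\<alpha>\<in>\<Phi>p. \<Sum>\<beta>\<in>\<Phi>p. u \<alpha> / (z \<alpha> - 1) * (v \<beta> / (z \<beta> - 1)) * c \<alpha> \<beta>) =
    (\<Sum>\<alpha>\<in>\<Phi>p. \<Sum>r\<in>A \<alpha>. g \<alpha> r * (\<Sum>\<beta>\<in>\<Phi>p. Y \<alpha> \<beta> * f \<beta> r * c \<alpha> \<beta>))" .
  have lin: "(\<Sum>\<alpha>\<in>\<Phi>p. 1 / (z \<alpha> - 1) * (u \<alpha> * d \<alpha> v - v \<alpha> * d \<alpha> u)) =
      (\<Sum>\<alpha>\<in>\<Phi>p. \<Sum>r\<in>A \<alpha>. g \<alpha> r * d \<alpha> (Y \<alpha>))"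
    using assms(3,4)
    by (intro sum.cong refl) (simp only: single Y_def d_linear sum_distrib_right)
  have "g \<alpha> r * (\<Sum>\<beta>\<in>\<Phi>p. Y \<alpha> \<beta> * f \<beta> r * c \<alpha> \<beta>) + g \<alpha> r * d \<alpha> (Y \<alpha>) = 0"
    if \<alpha>: "\<alpha> \<in> \<Phi>p" and r: "r \<in> A \<alpha>" for \<alpha> r
  proof -
    \<comment> \<open>The bracket is the residue along the hypersurface of \<open>\<alpha>\<close> at the point \<open>z r\<^sup>x\<close>, \<open>x = 2\<rho>\<^sup>\<or>\<close>.\<close>
    have "r \<noteq> 0" using r n[OF \<alpha>] by (auto simp: A_def zero_power)
    let ?z = "shift \<Phi> z (Ln r) two_rho"
    have z: "?z \<beta> = z \<beta> * r ^ n \<beta>" if "\<beta> \<in> \<Phi>p" for \<beta>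
      using shift_Ln_root[of \<beta> two_rho "int (n \<beta>)" r z] n[OF that] positive_root[OF that] \<open>r \<noteq> 0\<close> by simp
    have "?z \<alpha> = 1" using r z[OF \<alpha>] by (simp add: A_def)
    moreover have "?z \<beta> \<noteq> 1" if "\<beta> \<in> \<Phi>p - {\<alpha>}" for \<beta>
      using disj[of \<alpha> \<beta>] that \<alpha> r z[of \<beta>] by (auto simp: A_def)
    moreover have "Y \<alpha> \<in> cartan \<Phi>"
      using cartan_add[OF cartan_scale[OF assms(4), of "u \<alpha>"] cartan_scale[OF assms(3), of "- v \<alpha>"]]
      by (simp add: Y_def)
    moreover have "Y \<alpha> \<alpha> = 0" by (simp add: Y_def)
    ultimately have "resid ?z \<alpha> (Y \<alpha>) = 0"
      using assms(1) \<alpha> shift_torus[OF assms(2)] unfolding flat_resid_def by blast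
    also have "resid ?z \<alpha> (Y \<alpha>) = (\<Sum>\<beta>\<in>\<Phi>p - {\<alpha>}. Y \<alpha> \<beta> * f \<beta> r * c \<alpha> \<beta>) + d \<alpha> (Y \<alpha>)"
      unfolding resid_def by (intro arg_cong2[of _ _ _ _ "(+)"] sum.cong refl) (simp add: f_def z)
    also have "(\<Sum>\<beta>\<in>\<Phi>p - {\<alpha>}. Y \<alpha> \<beta> * f \<beta> r * c \<alpha> \<beta>) = (\<Sum>\<beta>\<in>\<Phi>p. Y \<alpha> \<beta> * f \<beta> r * c \<alpha> \<beta>)"
      by (simp add: sum.remove[OF finite_positive \<alpha>])
    finally show ?thesis by (simp add: distrib_left[symmetric])
  qed
  then show ?thesis
    unfolding curv_def quad lin by (simp add: sum.distrib[symmetric])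
qed

lemma shift_tendsto:
  assumes "\<beta> \<in> \<Phi>"
  shows "((\<lambda>s::real. shift \<Phi> z (of_real s) x \<beta>) \<longlongrightarrow> z \<beta>) (at 0)"
proof -
  have "((\<lambda>s::real. z \<beta> * exp (of_real s * of_real (blinfun_apply \<beta> x))) \<longlongrightarrow> z \<beta> * exp (of_real 0 * of_real (blinfun_apply \<beta> x))) (at 0)"
    by (intro tendsto_intros)
  then show ?thesis by (simp add: shift_root[OF assms])
qed

text \<open>An arbitrary regular point is the limit of generic ones.\<close>

lemma flat_resid_imp_flat:
  assumes "flat_resid" and e: "\<And>u v. u \<in> cartan \<Phi> \<Longrightarrow> v \<in> cartan \<Phi> \<Longrightarrow> e u v = 0"
  shows "flat"
  unfolding flat_def
proof (intro ballI)
  fix z u v assume z: "z \<in> torus_reg \<Phi>" and u: "u \<in> cartan \<Phi>" and v: "v \<in> cartan \<Phi>"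
  have zt: "z \<in> torus \<Phi>" and z1: "\<And>\<beta>. \<beta> \<in> \<Phi> \<Longrightarrow> z \<beta> \<noteq> 1" using z by (auto simp: torus_reg_def)
  have "\<forall>\<beta>\<in>\<Phi>p. \<exists>m::nat. m > 0 \<and> blinfun_apply \<beta> two_rho = of_nat m"
    using positive_two_rho by (metis mult_pos_pos of_nat_mult of_nat_numeral zero_less_numeral)
  then obtain n :: "'e dual \<Rightarrow> nat" where n: "\<And>\<beta>. \<beta> \<in> \<Phi>p \<Longrightarrow> n \<beta> > 0 \<and> blinfun_apply \<beta> two_rho = of_nat (n \<beta>)"
    by metis
  define m where "m \<alpha> \<beta> = of_nat (n \<beta>) *\<^sub>R \<alpha> - of_nat (n \<alpha>) *\<^sub>R \<beta>" for \<alpha> \<beta> :: "'e dual"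
  let ?I = "{(\<alpha>, \<beta>) \<in> \<Phi>p \<times> \<Phi>p. \<alpha> \<noteq> \<beta>}"
  have "\<exists>x\<in>UNIV. \<forall>\<gamma>\<in>case_prod m ` ?I. blinfun_apply \<gamma> x \<noteq> 0"
  proof (rule generic_vector)
    have "finite ?I" by (rule finite_subset[of _ "\<Phi>p \<times> \<Phi>p"]) (auto simp: finite_positive)
    then show "finite (case_prod m ` ?I)" by (rule finite_imageI)
  next
    fix \<gamma> assume "\<gamma> \<in> case_prod m ` ?I"
    then obtain \<alpha> \<beta> where ab: "\<alpha> \<in> \<Phi>p" "\<beta> \<in> \<Phi>p" "\<alpha> \<noteq> \<beta>" "\<gamma> = m \<alpha> \<beta>" by auto
    have "\<gamma> \<noteq> 0"
    proof
      assume "\<gamma> = 0"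
      then have "of_nat (n \<alpha>) *\<^sub>R \<beta> = of_nat (n \<beta>) *\<^sub>R \<alpha>" by (simp add: ab m_def)
      then have "\<beta> = (of_nat (n \<beta>) / of_nat (n \<alpha>)) *\<^sub>R \<alpha>"
        using n[OF ab(1)] by (simp add: vector_fraction_eq_iff eq_vector_fraction_iff)
      then show False using positive_not_proportional[OF ab(1,2)] ab(3) by blast
    qed
    then show "\<exists>x\<in>UNIV. blinfun_apply \<gamma> x \<noteq> 0"
      by (metis UNIV_I blinfun_eqI zero_blinfun.rep_eq)
  qed simp
  then obtain x where x: "\<And>\<alpha> \<beta>. \<alpha> \<in> \<Phi>p \<Longrightarrow> \<beta> \<in> \<Phi>p \<Longrightarrow> \<alpha> \<noteq> \<beta> \<Longrightarrow> blinfun_apply (m \<alpha> \<beta>) x \<noteq> 0" by force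
  define Z where "Z s = shift \<Phi> z (of_real s) x" for s :: real
  have lim: "((\<lambda>s. Z s \<beta>) \<longlongrightarrow> z \<beta>) (at 0)" if "\<beta> \<in> \<Phi>p" for \<beta>
    unfolding Z_def using that by (intro shift_tendsto positive_root)
  have ev1: "\<forall>\<^sub>F s in at 0. \<forall>\<beta>\<in>\<Phi>p. Z s \<beta> \<noteq> 1"
    using lim z1 positive_root
    by (intro eventually_ball_finite finite_positive ballI tendsto_imp_eventually_ne[OF lim]) auto
  have ev2: "\<forall>\<^sub>F s in at 0. \<forall>\<alpha>\<in>\<Phi>p. \<forall>\<beta>\<in>\<Phi>p. \<alpha> \<noteq> \<beta> \<longrightarrow> Z s \<alpha> ^ n \<beta> \<noteq> Z s \<beta> ^ n \<alpha>"
  proof (intro eventually_ball_finite finite_positive ballI)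
    fix \<alpha> \<beta> assume ab: "\<alpha> \<in> \<Phi>p" "\<beta> \<in> \<Phi>p"
    let ?k = "blinfun_apply (m \<alpha> \<beta>) x"
    define p where "p = cmod (z \<alpha>) ^ n \<beta>"
    define q where "q = cmod (z \<beta>) ^ n \<alpha>"
    have pq: "p > 0" "q > 0" using ab zt torus_root_nonzero positive_root by (auto simp: p_def q_def)
    \<comment> \<open>Equality of the moduli determines the parameter.\<close>
    have *: "s = (ln q - ln p) / ?k" if "\<alpha> \<noteq> \<beta>" "Z s \<alpha> ^ n \<beta> = Z s \<beta> ^ n \<alpha>" for s
    proof -
      have norm: "cmod (Z s \<gamma>) = cmod (z \<gamma>) * exp (s * blinfun_apply \<gamma> x)" if "\<gamma> \<in> \<Phi>p" for \<gamma>
        using that positive_root by (simp add: Z_def shift_root norm_mult)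
      have "cmod (Z s \<alpha>) ^ n \<beta> = cmod (Z s \<beta>) ^ n \<alpha>" using that(2) by (metis norm_power)
      then have "p * exp (of_nat (n \<beta>) * (s * blinfun_apply \<alpha> x)) = q * exp (of_nat (n \<alpha>) * (s * blinfun_apply \<beta> x))"
        using ab by (simp add: norm power_mult_distrib p_def q_def exp_of_nat_mult)
      then have "ln p + of_nat (n \<beta>) * (s * blinfun_apply \<alpha> x) = ln q + of_nat (n \<alpha>) * (s * blinfun_apply \<beta> x)"
        using pq by (metis exp_gt_zero ln_exp ln_mult_pos)
      then have "s * ?k = ln q - ln p"
        by (simp add: m_def minus_blinfun.rep_eq scaleR_blinfun.rep_eq algebra_simps)
      then show ?thesis using x[OF ab that(1)] by (simp add: field_simps)
    qed
    have "\<forall>\<^sub>F s in at 0. s \<noteq> (ln q - ln p) / ?k" by (rule eventually_neq_at_within)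
    then show "\<forall>\<^sub>F s in at 0. \<alpha> \<noteq> \<beta> \<longrightarrow> Z s \<alpha> ^ n \<beta> \<noteq> Z s \<beta> ^ n \<alpha>"
      by (rule eventually_mono) (use * in blast)
  qed
  have "\<forall>\<^sub>F s in at 0. curv (Z s) u v = 0"
    using ev1 ev2
  proof eventually_elim
    case (elim s)
    have "curv (Z s) u v = e u v"
      unfolding Z_def
      by (rule curv_eq_of_generic[OF assms(1) shift_torus[OF zt] u v n])
        (use elim in \<open>auto simp: Z_def\<close>)
    then show ?case using e u v by simp
  qed
  then have "((\<lambda>s. curv (Z s) u v) \<longlongrightarrow> 0) (at 0)" by (rule tendsto_eventually)
  moreover have "((\<lambda>s. curv (Z s) u v) \<longlongrightarrow> curv z u v) (at 0)"
    unfolding curv_def using z1 positive_root by (intro tendsto_intros lim) auto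
  ultimately show "curv z u v = 0" using tendsto_unique[OF trivial_limit_at] by blast
qed

end

section \<open>From flatness to the relations\<close>

lemma exp_limits:
  fixes k :: real
  shows inverse_exp_limit: "k \<noteq> 0 \<Longrightarrow> ((\<lambda>s::real. 1 / (exp (of_real s * of_real k) - 1 :: complex)) \<longlongrightarrow> (if k < 0 then - 1 else 0)) at_top"
    and exp_ratio_limit: "k \<noteq> 0 \<Longrightarrow> ((\<lambda>s::real. of_real (s * k) / (exp (of_real s * of_real k) - 1 :: complex)) \<longlongrightarrow> 1) (at_right 0)"
proof -
  have eq: "exp (of_real s * of_real k) = (of_real (exp (s * k)) :: complex)" for s
    by (simp flip: of_real_mult exp_of_real)
  assume k: "k \<noteq> 0"
  have "((\<lambda>s::real. 1 / (exp (s * k) - 1)) \<longlongrightarrow> (if k < 0 then - 1 else 0)) at_top"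
  proof (cases "k < 0")
    case True
    then have "((\<lambda>s::real. 1 / (exp (s * k) - 1)) \<longlongrightarrow> - 1) at_top" by real_asymp
    then show ?thesis using True by simp
  next
    case False
    then have "k > 0" using k by simp
    then have "((\<lambda>s::real. 1 / (exp (s * k) - 1)) \<longlongrightarrow> 0) at_top" by real_asymp
    then show ?thesis using False by simp
  qed
  from tendsto_of_real[OF this, where 'a = complex]
  show "((\<lambda>s::real. 1 / (exp (of_real s * of_real k) - 1 :: complex)) \<longlongrightarrow> (if k < 0 then - 1 else 0)) at_top"
    by (simp add: eq if_distrib cong: if_cong)
  have "((\<lambda>s::real. (s * k) / (exp (s * k) - 1)) \<longlongrightarrow> 1) (at_right 0)"
    using k by real_asymp
  from tendsto_of_real[OF this, where 'a = complex]
  show "((\<lambda>s::real. of_real (s * k) / (exp (of_real s * of_real k) - 1 :: complex)) \<longlongrightarrow> 1) (at_right 0)"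
    by (simp add: eq)
qed

lemma exp_real_mult_neq_1: "s \<noteq> 0 \<Longrightarrow> k \<noteq> 0 \<Longrightarrow> exp (of_real s * of_real k :: complex) \<noteq> 1"
proof -
  have "exp (of_real s * of_real k) = (of_real (exp (s * k)) :: complex)"
    by (simp flip: of_real_mult exp_of_real)
  then show "s \<noteq> 0 \<Longrightarrow> k \<noteq> 0 \<Longrightarrow> exp (of_real s * of_real k :: complex) \<noteq> 1"
    by (metis exp_eq_one_iff mult_eq_0_iff of_real_eq_1_iff)
qed

context scalar_curvature
begin

text \<open>At infinity in the direction of the positive chamber, only the constant term survives.\<close>

lemma flat_imp_tautau:
  assumes "flat" "u \<in> cartan \<Phi>" "v \<in> cartan \<Phi>"
  shows "e u v = 0"
proof -
  define Z where "Z s = shift \<Phi> (\<lambda>_. 1) (of_real s) two_rho" for s :: real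
  have pos: "blinfun_apply \<beta> two_rho > 0" if "\<beta> \<in> \<Phi>p" for \<beta>
    using positive_two_rho[OF that] by (metis mult_pos_pos of_nat_0_less_iff zero_less_numeral)
  have Z: "Z s \<beta> = exp (of_real s * of_real (blinfun_apply \<beta> two_rho))" if "\<beta> \<in> \<Phi>p" for s \<beta>
    using that positive_root by (simp add: Z_def shift_root)
  have lim: "((\<lambda>s. 1 / (Z s \<beta> - 1)) \<longlongrightarrow> 0) at_top" if "\<beta> \<in> \<Phi>p" for \<beta>
    using inverse_exp_limit[of "blinfun_apply \<beta> two_rho"] pos[OF that] by (simp add: Z[OF that])
  have lim': "((\<lambda>s. a / (Z s \<beta> - 1)) \<longlongrightarrow> 0) at_top" if "\<beta> \<in> \<Phi>p" for \<beta> a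
    using tendsto_mult_right_zero[OF lim[OF that], of a] by simp
  have "((\<lambda>s. curv (Z s) u v) \<longlongrightarrow> (\<Sum>\<alpha>\<in>\<Phi>p. \<Sum>\<beta>\<in>\<Phi>p. 0 * 0 * c \<alpha> \<beta>) +
     (\<Sum>\<alpha>\<in>\<Phi>p. 0 * (u \<alpha> * d \<alpha> v - v \<alpha> * d \<alpha> u)) + e u v) at_top"
    unfolding curv_def by (intro tendsto_add tendsto_sum tendsto_mult tendsto_const lim lim')
  then have "((\<lambda>s. curv (Z s) u v) \<longlongrightarrow> e u v) at_top" by simp
  moreover have "\<forall>\<^sub>F s in at_top. curv (Z s) u v = 0"
    using eventually_gt_at_top[of 0]
  proof eventually_elim
    case (elim s)
    have "Z s \<in> torus_reg \<Phi>"
    proof (rule torus_regI)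
      show "Z s \<in> torus \<Phi>" unfolding Z_def by (intro shift_torus one_torus)
      show "Z s \<alpha> \<noteq> 1" if "\<alpha> \<in> \<Phi>p" for \<alpha>
        unfolding Z[OF that] using elim pos[OF that] by (intro exp_real_mult_neq_1) auto
    qed
    then show ?case using assms unfolding flat_def by blast
  qed
  then have "((\<lambda>s. curv (Z s) u v) \<longlongrightarrow> 0) at_top" by (rule tendsto_eventually)
  ultimately show ?thesis by (meson tendsto_unique trivial_limit_at_top_linorder)
qed

text \<open>The residue as a limit transversal to the hypersurface, along a vector \<open>x\<close> with \<open>\<alpha>(x) = 1\<close>.\<close>

lemma flat_imp_flat_resid:
  assumes "flat"
  shows "flat_resid"
  unfolding flat_resid_def
proof (intro ballI impI)
  fix z \<alpha> y assume z: "z \<in> torus \<Phi>" and \<alpha>: "\<alpha> \<in> \<Phi>p" and y: "y \<in> cartan \<Phi>"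
    and *: "z \<alpha> = 1 \<and> (\<forall>\<beta>\<in>\<Phi>p - {\<alpha>}. z \<beta> \<noteq> 1) \<and> y \<alpha> = 0"
  define x where "x = (1/2) *\<^sub>R coroot \<alpha>"
  have \<alpha>x: "blinfun_apply \<alpha> x = 1"
    using positive_nonzero[OF \<alpha>] by (simp add: x_def blinfun.scaleR_right apply_coroot_self)
  define u where "u = embed \<Phi> x"
  have u: "u \<in> cartan \<Phi>" "u \<alpha> = 1"
    using \<alpha>x positive_root[OF \<alpha>] by (simp_all add: u_def embed_cartan embed_root)
  define Z where "Z s = shift \<Phi> z (of_real s) x" for s :: real
  define h where "h s = (exp (of_real s) - 1 :: complex)" for s :: real
  have Z\<alpha>: "Z s \<alpha> = exp (of_real s)" for s
    using * \<alpha>x positive_root[OF \<alpha>] by (simp add: Z_def shift_root)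
  have lim: "((\<lambda>s. Z s \<beta>) \<longlongrightarrow> z \<beta>) (at 0)" if "\<beta> \<in> \<Phi>p" for \<beta>
    unfolding Z_def using that by (intro shift_tendsto positive_root)
  have h0: "(h \<longlongrightarrow> 0) (at 0)"
  proof -
    have "(h \<longlongrightarrow> exp (of_real 0) - 1) (at 0)" unfolding h_def by (intro tendsto_intros)
    then show ?thesis by simp
  qed
  have hnz: "h s \<noteq> 0" if "s \<noteq> 0" for s
    using exp_real_mult_neq_1[OF that, of 1] by (simp add: h_def)
  have hlim: "((\<lambda>s. h s / (Z s \<beta> - 1)) \<longlongrightarrow> (if \<beta> = \<alpha> then 1 else 0)) (at 0)" if "\<beta> \<in> \<Phi>p" for \<beta>
  proof (cases "\<beta> = \<alpha>")
    case True
    have "\<forall>\<^sub>F s in at 0. h s / (Z s \<alpha> - 1) = 1"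
      using eventually_neq_at_within[of 0 0 UNIV] by (rule eventually_mono) (simp add: Z\<alpha> hnz flip: h_def)
    then show ?thesis using True by (auto intro: tendsto_eventually)
  next
    case False
    then have "z \<beta> - 1 \<noteq> 0" using * that by auto
    then have "((\<lambda>s. h s / (Z s \<beta> - 1)) \<longlongrightarrow> 0 / (z \<beta> - 1)) (at 0)"
      by (intro tendsto_divide tendsto_diff h0 lim that tendsto_const)
    then show ?thesis using False by simp
  qed
  define Y where "Y \<beta> = (if \<beta> = \<alpha> then 0 else y \<beta> / (z \<beta> - 1))" for \<beta>
  have ylim: "((\<lambda>s. y \<beta> / (Z s \<beta> - 1)) \<longlongrightarrow> Y \<beta>) (at 0)" if "\<beta> \<in> \<Phi>p" for \<beta>
  proof (cases "\<beta> = \<alpha>")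
    case True
    then show ?thesis using * by (simp add: Y_def)
  next
    case False
    then have "z \<beta> - 1 \<noteq> 0" using * that by auto
    then have "((\<lambda>s. y \<beta> / (Z s \<beta> - 1)) \<longlongrightarrow> y \<beta> / (z \<beta> - 1)) (at 0)"
      by (intro tendsto_divide tendsto_diff lim that tendsto_const)
    then show ?thesis using False by (simp add: Y_def)
  qed
  let ?K = "\<lambda>s. (\<Sum>\<gamma>\<in>\<Phi>p. \<Sum>\<beta>\<in>\<Phi>p. u \<gamma> * (h s / (Z s \<gamma> - 1)) * (y \<beta> / (Z s \<beta> - 1)) * c \<gamma> \<beta>) +
     (\<Sum>\<gamma>\<in>\<Phi>p. h s / (Z s \<gamma> - 1) * (u \<gamma> * d \<gamma> y - y \<gamma> * d \<gamma> u)) + h s * e u y"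
  have K: "h s * curv (Z s) u y = ?K s" for s
    unfolding curv_def distrib_left sum_distrib_left by (simp add: mult_ac)
  have "(?K \<longlongrightarrow> (\<Sum>\<gamma>\<in>\<Phi>p. \<Sum>\<beta>\<in>\<Phi>p. u \<gamma> * (if \<gamma> = \<alpha> then 1 else 0) * Y \<beta> * c \<gamma> \<beta>) +
     (\<Sum>\<gamma>\<in>\<Phi>p. (if \<gamma> = \<alpha> then 1 else 0) * (u \<gamma> * d \<gamma> y - y \<gamma> * d \<gamma> u)) + 0 * e u y) (at 0)"
    by (intro tendsto_add tendsto_sum tendsto_mult tendsto_const hlim ylim h0)
  also have "(\<Sum>\<gamma>\<in>\<Phi>p. \<Sum>\<beta>\<in>\<Phi>p. u \<gamma> * (if \<gamma> = \<alpha> then 1 else 0) * Y \<beta> * c \<gamma> \<beta>) =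
      (\<Sum>\<gamma>\<in>\<Phi>p. if \<gamma> = \<alpha> then \<Sum>\<beta>\<in>\<Phi>p. u \<alpha> * Y \<beta> * c \<alpha> \<beta> else 0)"
    by (intro sum.cong refl) simp
  also have "\<dots> = (\<Sum>\<beta>\<in>\<Phi>p. Y \<beta> * c \<alpha> \<beta>)"
    using finite_positive \<alpha> u by simp
  also have "\<dots> = (\<Sum>\<beta>\<in>\<Phi>p - {\<alpha>}. y \<beta> / (z \<beta> - 1) * c \<alpha> \<beta>)"
    unfolding sum.remove[OF finite_positive \<alpha>] by (simp add: Y_def)
  also have "(\<Sum>\<gamma>\<in>\<Phi>p. (if \<gamma> = \<alpha> then 1 else 0) * (u \<gamma> * d \<gamma> y - y \<gamma> * d \<gamma> u)) =
      (\<Sum>\<gamma>\<in>\<Phi>p. if \<gamma> = \<alpha> then u \<alpha> * d \<alpha> y - y \<alpha> * d \<alpha> u else 0)"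
    by (intro sum.cong refl) simp
  also have "\<dots> = d \<alpha> y" using finite_positive \<alpha> u * by simp
  finally have "((\<lambda>s. h s * curv (Z s) u y) \<longlongrightarrow> resid z \<alpha> y) (at 0)"
    by (simp add: K resid_def)
  moreover have "\<forall>\<^sub>F s in at 0. h s * curv (Z s) u y = 0"
  proof -
    have "\<forall>\<^sub>F s in at 0. \<forall>\<beta>\<in>\<Phi>p - {\<alpha>}. Z s \<beta> \<noteq> 1"
      using * finite_positive
      by (intro eventually_ball_finite finite_Diff ballI tendsto_imp_eventually_ne[OF lim]) auto
    with eventually_neq_at_within[of 0 0 UNIV] show ?thesis
    proof eventually_elim
      case (elim s)
      have "Z s \<alpha> \<noteq> 1" using hnz[OF elim(1)] by (simp add: Z\<alpha> h_def)
      then have "Z s \<in> torus_reg \<Phi>"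
        using elim by (intro torus_regI) (auto simp: Z_def shift_torus z)
      then show ?case using assms u(1) y unfolding flat_def by simp
    qed
  qed
  then have "((\<lambda>s. h s * curv (Z s) u y) \<longlongrightarrow> 0) (at 0)" by (rule tendsto_eventually)
  ultimately show "resid z \<alpha> y = 0" using tendsto_unique[OF trivial_limit_at] by blast
qed

text \<open>The relation (t\<open>\<tau>\<close>) is the limit of the residue at infinity in the direction of the wall of
  \<open>\<alpha>\<close> in the chamber of \<open>w \<Phi>\<^sub>+\<close>.\<close>

lemma flat_resid_imp_ttau:
  assumes "flat_resid"
  shows "ttau"
  unfolding ttau_def
proof (intro ballI impI)
  fix \<alpha> w u assume \<alpha>: "\<alpha> \<in> \<Phi>p" and w: "w \<in> weyl_group \<Phi>" "inv w \<alpha> \<in> simple_roots \<Phi>p"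
    and u: "u \<in> cartan \<Phi>" "u \<alpha> = 0"
  have w': "\<alpha> \<in> simple_roots (w ` \<Phi>p)" using w inv_weyl_simple_iff by blast
  obtain x where x: "blinfun_apply \<alpha> x = 0" "\<forall>\<beta>\<in>w ` \<Phi>p - {\<alpha>}. blinfun_apply \<beta> x > 0"
    using weyl_wall[OF w(1) w' positive_root[OF \<alpha>]] by metis
  note neg = wall_negative_roots[OF w(1) w' x \<alpha>]
  define Z where "Z s = shift \<Phi> (\<lambda>_. 1) (of_real s) x" for s :: real
  have Z: "Z s \<beta> = exp (of_real s * of_real (blinfun_apply \<beta> x))" if "\<beta> \<in> \<Phi>p" for s \<beta>
    using that positive_root by (simp add: Z_def shift_root)
  have "((\<lambda>s. resid (Z s) \<alpha> u) \<longlongrightarrow> (\<Sum>\<beta>\<in>\<Phi>p - {\<alpha>}. u \<beta> * (if blinfun_apply \<beta> x < 0 then - 1 else 0) * c \<alpha> \<beta>) + d \<alpha> u) at_top"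
    unfolding resid_def
  proof (intro tendsto_add tendsto_sum tendsto_mult tendsto_const)
    fix \<beta> assume "\<beta> \<in> \<Phi>p - {\<alpha>}"
    then have "((\<lambda>s. u \<beta> * (1 / (Z s \<beta> - 1))) \<longlongrightarrow> u \<beta> * (if blinfun_apply \<beta> x < 0 then - 1 else 0)) at_top"
      using inverse_exp_limit[OF neg(2)[of \<beta>]]
      by (intro tendsto_mult tendsto_const) (simp add: Z)
    then show "((\<lambda>s. u \<beta> / (Z s \<beta> - 1)) \<longlongrightarrow> u \<beta> * (if blinfun_apply \<beta> x < 0 then - 1 else 0)) at_top"
      by simp
  qed
  also have "(\<Sum>\<beta>\<in>\<Phi>p - {\<alpha>}. u \<beta> * (if blinfun_apply \<beta> x < 0 then - 1 else 0) * c \<alpha> \<beta>) =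
      (\<Sum>\<beta>\<in>\<Phi>p - {\<alpha>}. if blinfun_apply \<beta> x < 0 then - (u \<beta> * c \<alpha> \<beta>) else 0)"
    by (intro sum.cong refl) simp
  also have "\<dots> = - (\<Sum>\<beta>\<in>\<Phi>p \<inter> w ` (uminus ` \<Phi>p). u \<beta> * c \<alpha> \<beta>)"
    unfolding neg(1) using finite_positive by (simp only: sum.inter_filter[symmetric] finite_Diff sum_negf)
  finally have "((\<lambda>s. resid (Z s) \<alpha> u) \<longlongrightarrow>
      - (\<Sum>\<beta>\<in>\<Phi>p \<inter> w ` (uminus ` \<Phi>p). u \<beta> * c \<alpha> \<beta>) + d \<alpha> u) at_top" .
  moreover have "\<forall>\<^sub>F s in at_top. resid (Z s) \<alpha> u = 0"
    using eventually_gt_at_top[of 0]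
  proof eventually_elim
    case (elim s)
    have "Z s \<alpha> = 1" by (simp add: Z[OF \<alpha>] x)
    moreover have "Z s \<beta> \<noteq> 1" if "\<beta> \<in> \<Phi>p - {\<alpha>}" for \<beta>
      using that elim exp_real_mult_neq_1[OF _ neg(2)[OF that], of s] by (simp add: Z)
    moreover have "Z s \<in> torus \<Phi>" unfolding Z_def by (intro shift_torus one_torus)
    ultimately show ?case using assms \<alpha> u unfolding flat_resid_def by blast
  qed
  then have "((\<lambda>s. resid (Z s) \<alpha> u) \<longlongrightarrow> 0) at_top" by (rule tendsto_eventually)
  ultimately have "- (\<Sum>\<beta>\<in>\<Phi>p \<inter> w ` (uminus ` \<Phi>p). u \<beta> * c \<alpha> \<beta>) + d \<alpha> u = 0"
    by (meson tendsto_unique trivial_limit_at_top_linorder)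
  then show "d \<alpha> u = (\<Sum>\<beta>\<in>\<Phi>p \<inter> w ` (uminus ` \<Phi>p). u \<beta> * c \<alpha> \<beta>)" by simp
qed

end

text \<open>A vector on which a plane vanishes, but no root outside of that plane.\<close>

lemma (in based_roots) annihilator_vector:
  obtains x where "\<And>\<gamma>. \<gamma> \<in> span {\<alpha>, \<beta>} \<Longrightarrow> blinfun_apply \<gamma> x = 0"
    "\<And>\<gamma>. \<gamma> \<in> \<Phi> \<Longrightarrow> \<gamma> \<notin> span {\<alpha>, \<beta>} \<Longrightarrow> blinfun_apply \<gamma> x \<noteq> 0"
proof -
  let ?S = "{x. blinfun_apply \<alpha> x = 0 \<and> blinfun_apply \<beta> x = 0}"
  have "subspace ?S" by (auto simp: subspace_def blinfun.add_right blinfun.scaleR_right)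
  moreover have "\<exists>x\<in>?S. blinfun_apply \<gamma> x \<noteq> 0" if \<gamma>: "\<gamma> \<in> \<Phi> - span {\<alpha>, \<beta>}" for \<gamma>
  proof -
    obtain p q where pq: "p \<in> span {riesz \<alpha>, riesz \<beta>}" "\<And>w. w \<in> span {riesz \<alpha>, riesz \<beta>} \<Longrightarrow> orthogonal q w"
      "riesz \<gamma> = p + q"
      using orthogonal_subspace_decomp_exists[of "{riesz \<alpha>, riesz \<beta>}" "riesz \<gamma>"] by metis
    have q: "q \<bullet> riesz \<alpha> = 0" "q \<bullet> riesz \<beta> = 0" "q \<bullet> p = 0"
      using pq by (auto simp: orthogonal_def span_base)
    have "q \<noteq> 0"
    proof
      assume "q = 0"
      then obtain a b where "riesz \<gamma> = a *\<^sub>R riesz \<alpha> + b *\<^sub>R riesz \<beta>"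
        using pq(1,3) span_plane[of p] by auto
      then have "riesz (\<gamma> - (a *\<^sub>R \<alpha> + b *\<^sub>R \<beta>)) = 0"
        by (simp add: riesz_diff riesz_add riesz_scaleR)
      then have "\<gamma> = a *\<^sub>R \<alpha> + b *\<^sub>R \<beta>" unfolding riesz_eq_0_iff by simp
      then show False using \<gamma> span_plane by blast
    qed
    moreover have "blinfun_apply \<gamma> q = q \<bullet> q"
      using q(3) by (metis add_0 inner_add_left inner_commute inner_riesz pq(3))
    ultimately show ?thesis
      using q by (intro bexI[of _ q]) (auto simp: inner_riesz[symmetric] inner_commute)
  qed
  ultimately have "\<exists>x\<in>?S. \<forall>\<gamma>\<in>\<Phi> - span {\<alpha>, \<beta>}. blinfun_apply \<gamma> x \<noteq> 0"
    using finite_roots by (intro generic_vector finite_Diff)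
  then obtain x where x: "x \<in> ?S" "\<forall>\<gamma>\<in>\<Phi> - span {\<alpha>, \<beta>}. blinfun_apply \<gamma> x \<noteq> 0"
    by (elim bexE)
  have "blinfun_apply \<gamma> x = 0" if "\<gamma> \<in> span {\<alpha>, \<beta>}" for \<gamma>
    using that x(1) unfolding span_plane
    by (auto simp: plus_blinfun.rep_eq scaleR_blinfun.rep_eq)
  then show ?thesis using that x(2) by blast
qed

text \<open>A root subsystem \<open>\<Psi>\<close> of rank 2 containing \<open>\<alpha>\<close> is cut out of its plane by a congruence: there
  is a vector \<open>x\<close> orthogonal to \<open>\<alpha>\<close> for which the roots of \<open>\<Psi>\<close> are those with integral values. Indeed
  the root lattice of the plane modulo \<open>\<alpha>\<close> is torsion free of rank 1, as \<open>\<alpha>\<close> is primitive.\<close>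

lemma (in based_roots) rank_two_subsystem_vector:
  assumes \<Psi>: "root_subsystem \<Phi> \<Psi>" "dim \<Psi> = 2" "\<alpha> \<in> \<Psi>"
  obtains x \<beta> where "\<beta> \<in> \<Psi>" "\<Psi> \<subseteq> span {\<alpha>, \<beta>}" "blinfun_apply \<alpha> x = 0" "blinfun_apply \<beta> x \<noteq> 0"
    "\<And>\<gamma>. \<gamma> \<in> \<Phi> \<Longrightarrow> \<gamma> \<in> span {\<alpha>, \<beta>} \<Longrightarrow> \<gamma> \<in> \<Psi> \<longleftrightarrow> blinfun_apply \<gamma> x \<in> \<int>"
proof -
  have sub: "\<Psi> \<subseteq> \<Phi>" and closed: "\<And>\<gamma>. \<gamma> \<in> \<Phi> \<Longrightarrow> \<gamma> \<in> group_closure \<Psi> \<Longrightarrow> \<gamma> \<in> \<Psi>"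
    using \<Psi>(1) by (auto simp: root_subsystem_def)
  have \<alpha>: "\<alpha> \<in> \<Phi>" "\<alpha> \<noteq> 0" using sub \<Psi>(3) root_nonzero by blast+
  have ind\<alpha>: "independent {\<alpha>}" using \<alpha>(2) by simp
  obtain B where B: "{\<alpha>} \<subseteq> B" "B \<subseteq> \<Psi>" "independent B" "\<Psi> \<subseteq> span B"
    using maximal_independent_subset_extend[of "{\<alpha>}" \<Psi>] \<Psi>(3) ind\<alpha> by auto
  have "card B = 2" using dim_unique[OF B(2,4,3)] \<Psi>(2) basis_card_eq_dim[OF B(2,4,3)] by simp
  then obtain \<beta> where \<beta>: "B = {\<alpha>, \<beta>}" "\<beta> \<noteq> \<alpha>"
    using B(1) by (auto simp: card_2_iff)
  have \<beta>\<Psi>: "\<beta> \<in> \<Psi>" "\<beta> \<in> \<Phi>" using B(2) \<beta>(1) sub by auto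
  have np: "\<beta> \<noteq> k *\<^sub>R \<alpha>" for k
  proof
    assume "\<beta> = k *\<^sub>R \<alpha>"
    then have "\<beta> \<in> span (B - {\<beta>})" using \<beta> by (auto simp: span_base span_scale insert_Diff_if)
    then show False using B(3) \<beta>(1) unfolding dependent_def by blast
  qed
  \<comment> \<open>An integral vector orthogonal to \<open>\<alpha>\<close>, in the plane of the coroots.\<close>
  define x where "x = 2 *\<^sub>R coroot \<beta> - blinfun_apply \<alpha> (coroot \<beta>) *\<^sub>R coroot \<alpha>"
  have x\<alpha>: "blinfun_apply \<alpha> x = 0"
    using \<alpha>(2) by (simp add: x_def blinfun.diff_right blinfun.scaleR_right apply_coroot_self)
  have x\<beta>: "blinfun_apply \<beta> x \<noteq> 0"
  proof -
    have "(ip \<beta> \<alpha>)\<^sup>2 < ip \<alpha> \<alpha> * ip \<beta> \<beta>" using \<alpha>(2) np by (rule ip_Cauchy_Schwarz_strict)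
    moreover have "ip \<alpha> \<alpha> > 0" "ip \<beta> \<beta> > 0" using \<alpha>(2) \<beta>\<Psi> root_nonzero ip_pos by blast+
    ultimately show ?thesis
      using root_nonzero[OF \<beta>\<Psi>(2)]
      by (simp add: x_def blinfun.diff_right blinfun.scaleR_right apply_coroot_self apply_coroot
          ip_commute[of \<alpha> \<beta>] field_simps power2_eq_square)
  qed
  have xint: "blinfun_apply \<gamma> x \<in> \<int>" if "\<gamma> \<in> \<Phi>" for \<gamma>
    using that \<alpha>(1) \<beta>\<Psi>(2) by (simp add: x_def blinfun.diff_right blinfun.scaleR_right pairing_int)
  define V where "V = {n::int. \<exists>\<gamma>\<in>\<Psi>. blinfun_apply \<gamma> x = of_int n}"
  define h where "h = Gcd V"
  \<comment> \<open>The values at \<open>x\<close> of the lattice spanned by \<open>\<Psi>\<close> are the multiples of \<open>h\<close>.\<close>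
  have lattice: "\<exists>\<mu>\<in>group_closure \<Psi>. blinfun_apply \<mu> x = of_int n" if "n \<in> group_closure V" for n
    using that
  proof induction
    case (base n)
    then show ?case
      by (auto simp: V_def intro: group_closure.base bexI[of _ 0])
  next
    case (diff n m)
    then obtain \<mu> \<nu> where "\<mu> \<in> group_closure \<Psi>" "blinfun_apply \<mu> x = of_int n"
      "\<nu> \<in> group_closure \<Psi>" "blinfun_apply \<nu> x = of_int m" by blast
    then show ?case by (intro bexI[of _ "\<mu> - \<nu>"]) (auto simp: minus_blinfun.rep_eq intro: group_closure.diff)
  qed
  have hV: "h \<in> group_closure V"
    unfolding h_def using Gcd_group_closure_in_group_closure[of V] by (simp add: Gcd_group_closure_eq_Gcd)
  have h0: "h \<noteq> 0"
  proof
    assume "h = 0"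
    then have "V \<subseteq> {0}" by (auto simp: h_def)
    moreover obtain n where "blinfun_apply \<beta> x = of_int n" using xint[OF \<beta>\<Psi>(2)] by (elim Ints_cases)
    ultimately show False using x\<beta> \<beta>\<Psi>(1) by (auto simp: V_def)
  qed
  have "\<gamma> \<in> \<Psi> \<longleftrightarrow> blinfun_apply \<gamma> ((1 / of_int h) *\<^sub>R x) \<in> \<int>"
    if \<gamma>: "\<gamma> \<in> \<Phi>" "\<gamma> \<in> span {\<alpha>, \<beta>}" for \<gamma>
  proof
    assume "\<gamma> \<in> \<Psi>"
    obtain n where n: "blinfun_apply \<gamma> x = of_int n" using xint[OF \<gamma>(1)] by (elim Ints_cases)
    then have "h dvd n" unfolding h_def using \<open>\<gamma> \<in> \<Psi>\<close> by (intro Gcd_dvd) (auto simp: V_def)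
    then show "blinfun_apply \<gamma> ((1 / of_int h) *\<^sub>R x) \<in> \<int>"
      using h0 n by (auto simp: blinfun.scaleR_right elim!: dvdE)
  next
    assume "blinfun_apply \<gamma> ((1 / of_int h) *\<^sub>R x) \<in> \<int>"
    then obtain k where "blinfun_apply \<gamma> ((1 / of_int h) *\<^sub>R x) = of_int k" by (elim Ints_cases)
    then have k: "blinfun_apply \<gamma> x = of_int (h * k)"
      using h0 by (simp add: blinfun.scaleR_right field_simps)
    obtain \<mu> where \<mu>: "\<mu> \<in> group_closure \<Psi>" "blinfun_apply \<mu> x = of_int (h * k)"
      using lattice[OF group_closure_mult_left[OF hV, of k]] by blast
    have \<mu>_span: "\<mu> \<in> span {\<alpha>, \<beta>}"
      using \<mu>(1) by induction (use B(4) \<beta>(1) in \<open>auto intro: span_diff span_zero\<close>)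
    obtain a b where ab: "\<gamma> - \<mu> = a *\<^sub>R \<alpha> + b *\<^sub>R \<beta>"
      using span_diff[OF \<gamma>(2) \<mu>_span] span_plane by blast
    have "blinfun_apply (\<gamma> - \<mu>) x = 0" using k \<mu>(2) by (simp add: minus_blinfun.rep_eq)
    then have "b = 0" unfolding ab using x\<alpha> x\<beta> by (simp add: plus_blinfun.rep_eq scaleR_blinfun.rep_eq)
    obtain \<xi> where \<xi>: "blinfun_apply \<alpha> \<xi> = 1" "\<And>\<beta>. \<beta> \<in> \<Phi> \<Longrightarrow> blinfun_apply \<beta> \<xi> \<in> \<int>"
      using integral_vector_one[OF \<alpha>(1)] by metis
    have "blinfun_apply \<mu> \<xi> \<in> \<int>"
      using \<mu>(1) by induction (use \<xi>(2) sub in \<open>auto simp: minus_blinfun.rep_eq zero_blinfun.rep_eq\<close>)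
    then have "blinfun_apply (\<gamma> - \<mu>) \<xi> \<in> \<int>" using \<xi>(2)[OF \<gamma>(1)] by (simp add: minus_blinfun.rep_eq)
    then have "a \<in> \<int>" unfolding ab using \<open>b = 0\<close> \<xi>(1) by (simp add: scaleR_blinfun.rep_eq)
    then obtain l :: int where l: "a = of_int l" by (elim Ints_cases)
    have nat: "of_nat m *\<^sub>R \<alpha> \<in> group_closure \<Psi>" for m
      by (induction m) (use \<Psi>(3) in \<open>auto simp: algebra_simps intro: group_closure_add group_closure.base\<close>)
    have "a *\<^sub>R \<alpha> \<in> group_closure \<Psi>"
      using nat[of "nat l"] group_closure_minus_iff[of "of_nat (nat (- l)) *\<^sub>R \<alpha>" \<Psi>] nat[of "nat (- l)"] l
      by (cases "l \<ge> 0") auto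
    moreover have "\<gamma> = \<mu> + a *\<^sub>R \<alpha>" using ab \<open>b = 0\<close> by (simp add: algebra_simps)
    ultimately have "\<gamma> \<in> group_closure \<Psi>" using \<mu>(1) group_closure_add by blast
    then show "\<gamma> \<in> \<Psi>" using closed \<gamma>(1) by blast
  qed
  moreover have "blinfun_apply \<beta> ((1 / of_int h) *\<^sub>R x) \<noteq> 0" "blinfun_apply \<alpha> ((1 / of_int h) *\<^sub>R x) = 0"
    using x\<alpha> x\<beta> h0 by (simp_all add: blinfun.scaleR_right)
  ultimately show ?thesis using that \<beta>\<Psi>(1) B(4) \<beta>(1) by blast
qed

context scalar_curvature
begin

text \<open>The relation (tt) is the residue of \<open>resid\<close> at a point of the hypersurface whose kernel on the
  roots is \<open>\<Psi>\<close>.\<close>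

lemma flat_resid_imp_tt:
  assumes "flat_resid"
  shows "tt"
proof -
  have pos: "(\<Sum>\<beta>\<in>\<Psi> \<inter> \<Phi>p. c \<alpha> \<beta>) = 0"
    if \<Psi>: "root_subsystem \<Phi> \<Psi>" "dim \<Psi> = 2" "\<alpha> \<in> \<Psi>" and \<alpha>: "\<alpha> \<in> \<Phi>p" for \<Psi> \<alpha>
  proof -
    obtain x \<beta>\<^sub>0 where \<beta>0: "\<beta>\<^sub>0 \<in> \<Psi>" "\<Psi> \<subseteq> span {\<alpha>, \<beta>\<^sub>0}" and x: "blinfun_apply \<alpha> x = 0" "blinfun_apply \<beta>\<^sub>0 x \<noteq> 0"
      "\<And>\<gamma>. \<gamma> \<in> \<Phi> \<Longrightarrow> \<gamma> \<in> span {\<alpha>, \<beta>\<^sub>0} \<Longrightarrow> \<gamma> \<in> \<Psi> \<longleftrightarrow> blinfun_apply \<gamma> x \<in> \<int>"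
      by (rule rank_two_subsystem_vector[OF \<Psi>]) blast
    obtain x' where x': "\<And>\<gamma>. \<gamma> \<in> span {\<alpha>, \<beta>\<^sub>0} \<Longrightarrow> blinfun_apply \<gamma> x' = 0"
      "\<And>\<gamma>. \<gamma> \<in> \<Phi> \<Longrightarrow> \<gamma> \<notin> span {\<alpha>, \<beta>\<^sub>0} \<Longrightarrow> blinfun_apply \<gamma> x' \<noteq> 0"
      using annihilator_vector[of \<alpha> \<beta>\<^sub>0] by metis
    have sub: "\<Psi> \<subseteq> \<Phi>" using \<Psi>(1) by (simp add: root_subsystem_def)
    have x0: "blinfun_apply \<beta> x \<noteq> 0" if "\<beta> \<in> \<Psi> \<inter> \<Phi>p - {\<alpha>}" for \<beta>
    proof
      assume 0: "blinfun_apply \<beta> x = 0"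
      have "\<beta> \<in> span {\<alpha>, \<beta>\<^sub>0}" using that \<beta>0(2) by blast
      then obtain a b where ab: "\<beta> = a *\<^sub>R \<alpha> + b *\<^sub>R \<beta>\<^sub>0" using span_plane by blast
      then have "b = 0" using 0 x by (simp add: plus_blinfun.rep_eq scaleR_blinfun.rep_eq)
      then show False using ab positive_not_proportional[of \<alpha> \<beta> a] that \<alpha> by auto
    qed
    \<comment> \<open>The roots with value 1 at this point of the torus are exactly those of \<open>\<Psi>\<close>.\<close>
    define z where "z = shift \<Phi> (shift \<Phi> (\<lambda>_. 1) 1 x') (2 * of_real pi * \<i>) x"
    have zt: "z \<in> torus \<Phi>" unfolding z_def by (intro shift_torus one_torus)
    have z: "z \<beta> = exp (of_real (blinfun_apply \<beta> x')) * exp (2 * of_real pi * \<i> * of_real (blinfun_apply \<beta> x))"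
      if "\<beta> \<in> \<Phi>" for \<beta>
      using that by (simp add: z_def shift_root)
    have z1: "z \<beta> = 1" if "\<beta> \<in> \<Psi>" for \<beta>
    proof -
      have "\<beta> \<in> \<Phi>" "\<beta> \<in> span {\<alpha>, \<beta>\<^sub>0}" using that sub \<beta>0(2) by blast+
      then have "blinfun_apply \<beta> x \<in> \<int>" using x(3) that by blast
      then obtain k where "blinfun_apply \<beta> x = of_int k" by (elim Ints_cases)
      then show ?thesis
        using \<open>\<beta> \<in> \<Phi>\<close> \<open>\<beta> \<in> span {\<alpha>, \<beta>\<^sub>0}\<close> x'(1)[of \<beta>] by (simp add: z exp_eq_1)
    qed
    have z2: "z \<beta> \<noteq> 1" if \<beta>: "\<beta> \<in> \<Phi>" "\<beta> \<notin> \<Psi>" for \<beta>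
    proof
      assume "z \<beta> = 1"
      then have "cmod (z \<beta>) = 1" by simp
      then have "blinfun_apply \<beta> x' = 0" by (simp add: z[OF \<beta>(1)] norm_mult)
      then have in_span: "\<beta> \<in> span {\<alpha>, \<beta>\<^sub>0}" using x'(2) \<beta>(1) by blast
      obtain k :: int where "blinfun_apply \<beta> x = of_int k"
        using \<open>z \<beta> = 1\<close> \<open>blinfun_apply \<beta> x' = 0\<close> by (auto simp: z[OF \<beta>(1)] exp_eq_1)
      then show False using x(3)[OF \<beta>(1) in_span] \<beta>(2) by simp
    qed
    define Z where "Z s = shift \<Phi> z (of_real s) x" for s :: real
    have Z: "Z s \<beta> = z \<beta> * exp (of_real s * of_real (blinfun_apply \<beta> x))" if "\<beta> \<in> \<Phi>" for s \<beta>
      using that by (simp add: Z_def shift_root)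
    define y where "y = embed \<Phi> x"
    have y: "y \<in> cartan \<Phi>" "y \<alpha> = 0"
      using x(1) positive_root[OF \<alpha>] by (simp_all add: y_def embed_cartan embed_root)
    have lim: "((\<lambda>s. Z s \<beta>) \<longlongrightarrow> z \<beta>) (at_right 0)" if "\<beta> \<in> \<Phi>" for \<beta>
      unfolding Z_def using shift_tendsto[OF that] by (rule filterlim_mono) (simp_all add: at_within_le_at)
    have slim: "((\<lambda>s::real. complex_of_real s) \<longlongrightarrow> 0) (at_right 0)"
      using tendsto_of_real[OF tendsto_ident_at, of 0] by simp
    have "((\<lambda>s. of_real s * y \<beta> / (Z s \<beta> - 1)) \<longlongrightarrow> (if \<beta> \<in> \<Psi> then 1 else 0)) (at_right 0)"
      if "\<beta> \<in> \<Phi>p - {\<alpha>}" for \<beta>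
    proof (cases "\<beta> \<in> \<Psi>")
      case True
      then show ?thesis
        using exp_ratio_limit[OF x0[of \<beta>]] that z1 sub
        by (simp add: Z y_def embed_root positive_root)
    next
      case False
      have \<beta>: "\<beta> \<in> \<Phi>" using that positive_root by blast
      have "((\<lambda>s. of_real s * y \<beta> / (Z s \<beta> - 1)) \<longlongrightarrow> 0 * y \<beta> / (z \<beta> - 1)) (at_right 0)"
        using z2[OF \<beta> False] by (intro tendsto_intros slim lim \<beta>) auto
      then show ?thesis using False by simp
    qed
    then have "((\<lambda>s. (\<Sum>\<beta>\<in>\<Phi>p - {\<alpha>}. of_real s * y \<beta> / (Z s \<beta> - 1) * c \<alpha> \<beta>) + of_real s * d \<alpha> y) \<longlongrightarrow>
        (\<Sum>\<beta>\<in>\<Phi>p - {\<alpha>}. (if \<beta> \<in> \<Psi> then 1 else 0) * c \<alpha> \<beta>) + 0 * d \<alpha> y) (at_right 0)"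
      by (intro tendsto_add tendsto_sum tendsto_mult tendsto_const slim)
    moreover have "\<forall>\<^sub>F s in at_right 0.
        (\<Sum>\<beta>\<in>\<Phi>p - {\<alpha>}. of_real s * y \<beta> / (Z s \<beta> - 1) * c \<alpha> \<beta>) + of_real s * d \<alpha> y = 0"
    proof -
      have "\<forall>\<^sub>F s in at_right 0. \<forall>\<beta>\<in>\<Phi>p - \<Psi>. Z s \<beta> \<noteq> 1"
        using z2 positive_root finite_positive
        by (intro eventually_ball_finite finite_Diff ballI tendsto_imp_eventually_ne[OF lim]) auto
      with eventually_at_right_less[of 0] show ?thesis
      proof eventually_elim
        case (elim s)
        have "Z s \<alpha> = 1" using Z[of \<alpha>] z1 \<Psi>(3) sub x(1) by auto
        moreover have "Z s \<beta> \<noteq> 1" if "\<beta> \<in> \<Phi>p - {\<alpha>}" for \<beta>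
        proof (cases "\<beta> \<in> \<Psi>")
          case True
          then show ?thesis
            using that x0[of \<beta>] elim(1) z1 sub exp_real_mult_neq_1[of s "blinfun_apply \<beta> x"] by (auto simp: Z)
        next
          case False
          then show ?thesis using elim(2) that by blast
        qed
        moreover have "Z s \<in> torus \<Phi>" unfolding Z_def by (intro shift_torus zt)
        ultimately have "resid (Z s) \<alpha> y = 0"
          using assms \<alpha> y unfolding flat_resid_def by blast
        then have "of_real s * resid (Z s) \<alpha> y = 0" by simp
        then show ?case by (simp add: resid_def distrib_left sum_distrib_left mult.assoc)
      qed
    qed
    then have "((\<lambda>s. (\<Sum>\<beta>\<in>\<Phi>p - {\<alpha>}. of_real s * y \<beta> / (Z s \<beta> - 1) * c \<alpha> \<beta>) + of_real s * d \<alpha> y) \<longlongrightarrow> 0) (at_right 0)"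
      by (rule tendsto_eventually)
    ultimately have "(\<Sum>\<beta>\<in>\<Phi>p - {\<alpha>}. (if \<beta> \<in> \<Psi> then 1 else 0) * c \<alpha> \<beta>) + 0 * d \<alpha> y = 0"
      by (rule tendsto_unique[OF trivial_limit_at_right_real])
    then have "(\<Sum>\<beta>\<in>\<Phi>p - {\<alpha>}. (if \<beta> \<in> \<Psi> then 1 else 0) * c \<alpha> \<beta>) = 0" by simp
    also have "(\<Sum>\<beta>\<in>\<Phi>p - {\<alpha>}. (if \<beta> \<in> \<Psi> then 1 else 0) * c \<alpha> \<beta>) =
        (\<Sum>\<beta>\<in>\<Phi>p. if \<beta> \<in> \<Psi> then c \<alpha> \<beta> else 0)"
      unfolding sum.remove[OF finite_positive \<alpha>] by (simp add: if_distribR if_distrib[of "\<lambda>k. k * _"] cong: if_cong)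
    also have "\<dots> = (\<Sum>\<beta>\<in>\<Psi> \<inter> \<Phi>p. c \<alpha> \<beta>)"
      by (simp add: sum.inter_restrict[OF finite_positive, symmetric] Int_commute)
    finally show ?thesis .
  qed
  show ?thesis unfolding tt_def
  proof (intro allI impI)
    fix \<Psi> \<alpha> assume *: "root_subsystem \<Phi> \<Psi> \<and> dim \<Psi> = 2 \<and> \<alpha> \<in> \<Psi>"
    then have \<alpha>: "\<alpha> \<in> \<Phi>" by (auto simp: root_subsystem_def)
    show "(\<Sum>\<beta>\<in>\<Psi> \<inter> \<Phi>p. c \<alpha> \<beta>) = 0"
    proof (cases "\<alpha> \<in> \<Phi>p")
      case False
      have "- \<alpha> \<in> group_closure \<Psi>" using * by (simp add: group_closure.base)
      then have "- \<alpha> \<in> \<Psi>" using * uminus_root[OF \<alpha>] unfolding root_subsystem_def by blast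
      moreover have "- \<alpha> \<in> \<Phi>p" using False positive_or_uminus \<alpha> by blast
      ultimately show ?thesis using pos[of \<Psi> "- \<alpha>"] * c_minus[OF \<alpha>] by simp
    qed (use pos * in blast)
  qed
qed

theorem flat_iff: "flat \<longleftrightarrow> tt \<and> (\<forall>u\<in>cartan \<Phi>. \<forall>v\<in>cartan \<Phi>. e u v = 0) \<and> ttau"
  using flat_imp_tautau flat_imp_flat_resid flat_resid_imp_tt flat_resid_imp_ttau
    tt_ttau_imp_flat_resid flat_resid_imp_flat by metis

end

section \<open>The curvature of the trigonometric connection\<close>

context complex_algebra
begin

sublocale forms: vector_space_pair smul "(*) :: complex \<Rightarrow> complex \<Rightarrow> complex"
  by unfold_locales (simp_all add: algebra_simps)

text \<open>Linear forms are not required to be continuous, the algebra having no topology. They separate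
  the points.\<close>

abbreviation linear_form :: "('a \<Rightarrow> complex) \<Rightarrow> bool" where
  "linear_form \<equiv> Vector_Spaces.linear smul (*)"

lemma eq_0_iff_linear_forms: "x = 0 \<longleftrightarrow> (\<forall>\<phi>. linear_form \<phi> \<longrightarrow> \<phi> x = 0)"
proof
  assume *: "\<forall>\<phi>. linear_form \<phi> \<longrightarrow> \<phi> x = 0"
  show "x = 0"
  proof (rule ccontr)
    assume "x \<noteq> 0"
    then have "independent {x}" by simp
    then obtain \<phi> where "linear_form \<phi>" "\<phi> x = 1"
      using forms.linear_independent_extend[of "{x}" "\<lambda>_. 1"] by auto
    moreover from this(1) have "\<phi> x = 0" using * by blast
    ultimately show False by simp
  qed
qed (use forms.linear_0 in auto)

lemma commutator_add_left: "commutator (x + y) w = commutator x w + commutator y w"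
  and commutator_add_right: "commutator w (x + y) = commutator w x + commutator w y"
  and commutator_diff_right: "commutator w (x - y) = commutator w x - commutator w y"
  and commutator_smul_left: "commutator (smul a x) w = smul a (commutator x w)"
  and commutator_smul_right: "commutator w (smul a x) = smul a (commutator w x)"
  and commutator_swap: "commutator y x = - commutator x y"
  by (simp_all add: commutator_def algebra_simps scale_mult_left scale_mult_right scale_right_diff_distrib)

lemma commutator_sum_right: "commutator w (\<Sum>i\<in>J. f i) = (\<Sum>i\<in>J. commutator w (f i))"
  and commutator_sum_left: "commutator (\<Sum>i\<in>J. f i) w = (\<Sum>i\<in>J. commutator (f i) w)"
  by (simp_all add: commutator_def sum_distrib_left sum_distrib_right sum_subtractf)

lemma linear_on_cartan_sum:
  assumes \<tau>: "linear_on_cartan \<Phi> smul \<tau>" and "finite J" "\<And>i. i \<in> J \<Longrightarrow> x i \<in> cartan \<Phi>"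
  shows "(\<lambda>\<mu>. \<Sum>i\<in>J. a i * x i \<mu>) \<in> cartan \<Phi> \<and>
    \<tau> (\<lambda>\<mu>. \<Sum>i\<in>J. a i * x i \<mu>) = (\<Sum>i\<in>J. smul (a i) (\<tau> (x i)))"
  using assms(2,3)
proof (induction J)
  case empty
  have zero: "(\<lambda>_. 0) \<in> cartan \<Phi>" by (simp add: cartan_def)
  have "\<tau> (\<lambda>\<mu>. 0 * v \<mu>) = smul 0 (\<tau> v)" if "v \<in> cartan \<Phi>" for v
    using \<tau> that unfolding linear_on_cartan_def by blast
  from this[OF zero] show ?case using zero by simp
next
  case (insert i J)
  then have IH: "(\<lambda>\<mu>. \<Sum>i\<in>J. a i * x i \<mu>) \<in> cartan \<Phi>"
    "\<tau> (\<lambda>\<mu>. \<Sum>i\<in>J. a i * x i \<mu>) = (\<Sum>i\<in>J. smul (a i) (\<tau> (x i)))" by auto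
  have i: "(\<lambda>\<mu>. a i * x i \<mu>) \<in> cartan \<Phi>" "\<tau> (\<lambda>\<mu>. a i * x i \<mu>) = smul (a i) (\<tau> (x i))"
    using insert.prems \<tau> cartan_scale unfolding linear_on_cartan_def by blast+
  have "\<tau> (\<lambda>\<mu>. a i * x i \<mu> + (\<Sum>i\<in>J. a i * x i \<mu>)) = \<tau> (\<lambda>\<mu>. a i * x i \<mu>) + \<tau> (\<lambda>\<mu>. \<Sum>i\<in>J. a i * x i \<mu>)"
    using conjunct1[OF \<tau>[unfolded linear_on_cartan_def], rule_format, OF i(1) IH(1)] .
  then show ?case using insert.hyps IH i cartan_add[OF i(1) IH(1)] by simp
qed

text \<open>The constant part of the connection form does not depend on the choice of dual bases.\<close>

lemma sum_dual_bases:
  assumes \<tau>: "linear_on_cartan \<Phi> smul \<tau>" and bases: "dual_bases \<Phi> I ul uu" and v: "v \<in> cartan \<Phi>"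
  shows "(\<Sum>i\<in>I. smul (ul i v) (\<tau> (uu i))) = \<tau> v"
proof -
  interpret scalars: complex_algebra "(*) :: complex \<Rightarrow> complex \<Rightarrow> complex"
    by unfold_locales (simp_all add: algebra_simps)
  have fin: "finite I" and uu: "\<And>i. i \<in> I \<Longrightarrow> uu i \<in> cartan \<Phi>"
    and pair: "\<And>i j. i \<in> I \<Longrightarrow> j \<in> I \<Longrightarrow> ul i (uu j) = (if i = j then 1 else 0)"
    and ul: "\<And>i. i \<in> I \<Longrightarrow> linear_on_cartan \<Phi> (*) (ul i)"
    using bases by (auto simp: dual_bases_def)
  obtain a where a: "v = (\<lambda>\<mu>. \<Sum>i\<in>I. a i * uu i \<mu>)"
    using bases v unfolding dual_bases_def by blast
  have "ul j v = a j" if "j \<in> I" for j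
  proof -
    have "ul j v = (\<Sum>i\<in>I. a i * ul j (uu i))"
      unfolding a using scalars.linear_on_cartan_sum[OF ul[OF that] fin, of uu a] uu by blast
    also have "\<dots> = (\<Sum>i\<in>I. if i = j then a i else 0)"
      by (intro sum.cong refl) (simp add: pair that)
    finally show ?thesis using fin that by simp
  qed
  then have "(\<Sum>i\<in>I. smul (ul i v) (\<tau> (uu i))) = (\<Sum>i\<in>I. smul (a i) (\<tau> (uu i)))" by simp
  also have "\<dots> = \<tau> v" unfolding a using linear_on_cartan_sum[OF \<tau> fin, of uu a] uu by simp
  finally show ?thesis .
qed

lemma has_torus_deriv_add_const:
  assumes "has_torus_deriv smul F z v D"
  shows "has_torus_deriv smul (\<lambda>z. F z + a) z v D"
  unfolding has_torus_deriv_def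
proof (intro allI impI)
  fix \<phi> assume \<phi>: "linear_form \<phi>"
  have "((\<lambda>s. \<phi> (F (translate z (\<lambda>\<mu>. s * v \<mu>))) + \<phi> a) has_field_derivative \<phi> D + 0) (at 0)"
    using assms \<phi> unfolding has_torus_deriv_def by (intro DERIV_add DERIV_const) blast
  then show "((\<lambda>s. \<phi> (F (translate z (\<lambda>\<mu>. s * v \<mu>)) + a)) has_field_derivative \<phi> D) (at 0)"
    by (simp add: forms.linear_add[OF \<phi>])
qed

text \<open>The connection form is closed, so that only the commutator is left in the curvature.\<close>

lemma torus_deriv_trig_form:
  assumes "\<And>\<alpha>. \<alpha> \<in> \<Phi>p \<Longrightarrow> z \<alpha> \<noteq> 1"
  shows "torus_deriv smul (\<lambda>z. trig_form \<Phi>p smul t \<tau> I ul uu z v) z u =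
    (\<Sum>\<alpha>\<in>\<Phi>p. smul (- (u \<alpha> * v \<alpha> * z \<alpha>) / (z \<alpha> - 1)\<^sup>2) (t \<alpha>))"
  unfolding trig_form_def
proof (intro torus_deriv_eqI has_torus_deriv_add_const has_torus_deriv_tensor)
  fix \<alpha> assume "\<alpha> \<in> \<Phi>p"
  then have "z \<alpha> - 1 \<noteq> 0" using assms by simp
  then show "((\<lambda>s. v \<alpha> / (translate z (\<lambda>\<mu>. s * u \<mu>) \<alpha> - 1)) has_field_derivative
      - (u \<alpha> * v \<alpha> * z \<alpha>) / (z \<alpha> - 1)\<^sup>2) (at 0)"
    unfolding translate_def by (auto intro!: derivative_eq_intros simp: power2_eq_square)
qed

lemma curvature_trig_form:
  assumes "\<And>\<alpha>. \<alpha> \<in> \<Phi>p \<Longrightarrow> z \<alpha> \<noteq> 1"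
  shows "curvature smul (trig_form \<Phi>p smul t \<tau> I ul uu) z u v =
    commutator (trig_form \<Phi>p smul t \<tau> I ul uu z u) (trig_form \<Phi>p smul t \<tau> I ul uu z v)"
  unfolding curvature_def ext_deriv_def
  by (simp add: torus_deriv_trig_form[OF assms] mult.commute[of "u _"])

end

theorem theorem2p5:
  fixes \<Phi> \<Phi>p :: "('e::euclidean_space \<Rightarrow>\<^sub>L real) set"
    and smul :: "complex \<Rightarrow> 'a::ring \<Rightarrow> 'a"
    and t :: "('e \<Rightarrow>\<^sub>L real) \<Rightarrow> 'a"
    and \<tau> :: "(('e \<Rightarrow>\<^sub>L real) \<Rightarrow> complex) \<Rightarrow> 'a"
    and I :: "'i set"
    and ul :: "'i \<Rightarrow> (('e \<Rightarrow>\<^sub>L real) \<Rightarrow> complex) \<Rightarrow> complex"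
    and uu :: "'i \<Rightarrow> ('e \<Rightarrow>\<^sub>L real) \<Rightarrow> complex"
  assumes "root_system \<Phi>" and "crystallographic \<Phi>" and "reduced_roots \<Phi>"
    and "positive_system \<Phi> \<Phi>p"
    and "complex_algebra smul"
    and "\<forall>\<alpha>\<in>\<Phi>. t (- \<alpha>) = t \<alpha>"
    and "linear_on_cartan \<Phi> smul \<tau>"
    and "dual_bases \<Phi> I ul uu"
  shows "(flat_connection \<Phi> smul (trig_form \<Phi>p smul t \<tau> I ul uu) \<longleftrightarrow>
            rel_tt \<Phi> \<Phi>p t \<and> rel_tautau \<Phi> \<tau> \<and> rel_ttau \<Phi> \<Phi>p smul t \<tau>) \<and>
         (rel_tt \<Phi> \<Phi>p t \<longrightarrow> (rel_ttau \<Phi> \<Phi>p smul t \<tau> \<longleftrightarrow> rel_tdelta \<Phi> \<Phi>p smul t \<tau>))"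
proof -
  interpret A: complex_algebra smul by fact
  interpret roots: based_roots \<Phi> \<Phi>p using assms(1-4) by unfold_locales
  let ?\<omega> = "trig_form \<Phi>p smul t \<tau> I ul uu"
  define c where "c \<phi> \<alpha> \<beta> = \<phi> (commutator (t \<alpha>) (t \<beta>))" for \<phi> :: "'a \<Rightarrow> complex" and \<alpha> \<beta>
  define d where "d \<phi> \<alpha> v = \<phi> (commutator (t \<alpha>) (\<tau> v))" for \<phi> :: "'a \<Rightarrow> complex" and \<alpha> v
  define e where "e \<phi> u v = \<phi> (commutator (\<tau> u) (\<tau> v))" for \<phi> :: "'a \<Rightarrow> complex" and u v
  have S: "scalar_curvature \<Phi> \<Phi>p (c \<phi>) (d \<phi>)" if \<phi>: "A.linear_form \<phi>" for \<phi>
  proof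
    show "c \<phi> \<beta> \<alpha> = - c \<phi> \<alpha> \<beta>" for \<alpha> \<beta>
      unfolding c_def A.commutator_swap[of "t \<beta>"] by (rule A.forms.linear_neg[OF \<phi>])
    show "c \<phi> (- \<alpha>) \<beta> = c \<phi> \<alpha> \<beta>" "d \<phi> (- \<alpha>) v = d \<phi> \<alpha> v" if "\<alpha> \<in> \<Phi>" for \<alpha> \<beta> v
      using assms(6) that by (simp_all add: c_def d_def)
    show "d \<phi> \<alpha> (\<lambda>\<mu>. a * u \<mu> - b * v \<mu>) = a * d \<phi> \<alpha> u - b * d \<phi> \<alpha> v"
      if uv: "u \<in> cartan \<Phi>" "v \<in> cartan \<Phi>" for \<alpha> a u b v
    proof -
      have add: "\<tau> (\<lambda>\<mu>. p \<mu> + q \<mu>) = \<tau> p + \<tau> q" and scale: "\<tau> (\<lambda>\<mu>. k * p \<mu>) = smul k (\<tau> p)"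
        if "p \<in> cartan \<Phi>" "q \<in> cartan \<Phi>" for p q k
        using assms(7) that unfolding linear_on_cartan_def by blast+
      have "\<tau> (\<lambda>\<mu>. a * u \<mu> + (- b) * v \<mu>) = smul a (\<tau> u) + smul (- b) (\<tau> v)"
        using add[OF cartan_scale[OF uv(1), of a] cartan_scale[OF uv(2), of "- b"]]
          scale[OF uv, of a] scale[OF uv(2,1), of "- b"] by simp
      then have "\<tau> (\<lambda>\<mu>. a * u \<mu> - b * v \<mu>) = smul a (\<tau> u) + smul (- b) (\<tau> v)" by simp
      then show ?thesis
        by (simp only: d_def A.commutator_add_right A.commutator_smul_right
            A.forms.linear_add[OF \<phi>] A.forms.linear_scale[OF \<phi>]) simp
    qed
  qed
  have \<omega>: "?\<omega> z v = (\<Sum>\<alpha>\<in>\<Phi>p. smul (v \<alpha> / (z \<alpha> - 1)) (t \<alpha>)) + \<tau> v" if "v \<in> cartan \<Phi>" for z v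
    unfolding trig_form_def A.sum_dual_bases[OF assms(7,8) that] ..
  have curv: "\<phi> (curvature smul ?\<omega> z u v) = scalar_curvature.curv \<Phi>p (c \<phi>) (d \<phi>) (e \<phi>) z u v"
    if \<phi>: "A.linear_form \<phi>" and z: "z \<in> torus_reg \<Phi>" and uv: "u \<in> cartan \<Phi>" "v \<in> cartan \<Phi>" for \<phi> z u v
  proof -
    interpret scalar_curvature \<Phi> \<Phi>p "c \<phi>" "d \<phi>" "e \<phi>" using S[OF \<phi>] .
    have "curvature smul ?\<omega> z u v = commutator (?\<omega> z u) (?\<omega> z v)"
      using z roots.positive_root by (intro A.curvature_trig_form) (auto simp: torus_reg_def)
    moreover have "\<phi> (commutator (\<tau> u) (t \<beta>)) = - d \<phi> \<beta> u" for \<beta>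
      unfolding d_def A.commutator_swap[of "\<tau> u"] by (rule A.forms.linear_neg[OF \<phi>])
    moreover have "\<phi> (commutator (\<Sum>\<alpha>\<in>\<Phi>p. smul (u \<alpha> / (z \<alpha> - 1)) (t \<alpha>)) x) =
        (\<Sum>\<alpha>\<in>\<Phi>p. u \<alpha> / (z \<alpha> - 1) * \<phi> (commutator (t \<alpha>) x))"
      "\<phi> (commutator x (\<Sum>\<beta>\<in>\<Phi>p. smul (v \<beta> / (z \<beta> - 1)) (t \<beta>))) =
        (\<Sum>\<beta>\<in>\<Phi>p. v \<beta> / (z \<beta> - 1) * \<phi> (commutator x (t \<beta>)))" for x
      by (simp_all only: A.commutator_sum_left A.commutator_sum_right A.commutator_smul_left
          A.commutator_smul_right A.forms.linear_sum[OF \<phi>] A.forms.linear_scale[OF \<phi>])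
    ultimately have "\<phi> (curvature smul ?\<omega> z u v) =
        (\<Sum>\<beta>\<in>\<Phi>p. v \<beta> / (z \<beta> - 1) * (\<Sum>\<alpha>\<in>\<Phi>p. u \<alpha> / (z \<alpha> - 1) * c \<phi> \<alpha> \<beta>)) +
        (\<Sum>\<alpha>\<in>\<Phi>p. u \<alpha> / (z \<alpha> - 1) * d \<phi> \<alpha> v) + (\<Sum>\<beta>\<in>\<Phi>p. v \<beta> / (z \<beta> - 1) * - d \<phi> \<beta> u) + e \<phi> u v"
      by (simp only: \<omega>[OF uv(1)] \<omega>[OF uv(2)] A.commutator_add_left A.commutator_add_right
          A.forms.linear_add[OF \<phi>] c_def d_def e_def add_ac)
    moreover have "(\<Sum>\<alpha>\<in>\<Phi>p. 1 / (z \<alpha> - 1) * (u \<alpha> * d \<phi> \<alpha> v - v \<alpha> * d \<phi> \<alpha> u)) =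
        (\<Sum>\<alpha>\<in>\<Phi>p. u \<alpha> / (z \<alpha> - 1) * d \<phi> \<alpha> v) + (\<Sum>\<beta>\<in>\<Phi>p. v \<beta> / (z \<beta> - 1) * - d \<phi> \<beta> u)"
      unfolding sum.distrib[symmetric] by (intro sum.cong refl) (simp add: diff_divide_distrib)
    moreover have "(\<Sum>\<beta>\<in>\<Phi>p. v \<beta> / (z \<beta> - 1) * (\<Sum>\<alpha>\<in>\<Phi>p. u \<alpha> / (z \<alpha> - 1) * c \<phi> \<alpha> \<beta>)) =
        (\<Sum>\<alpha>\<in>\<Phi>p. \<Sum>\<beta>\<in>\<Phi>p. u \<alpha> / (z \<alpha> - 1) * (v \<beta> / (z \<beta> - 1)) * c \<phi> \<alpha> \<beta>)"
      unfolding sum_distrib_left by (subst sum.swap) (simp only: mult_ac)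
    ultimately show ?thesis
      unfolding curv_def by simp
  qed
  have flat: "flat_connection \<Phi> smul ?\<omega> \<longleftrightarrow>
      (\<forall>\<phi>. A.linear_form \<phi> \<longrightarrow> scalar_curvature.flat \<Phi> \<Phi>p (c \<phi>) (d \<phi>) (e \<phi>))"
    unfolding flat_connection_def A.eq_0_iff_linear_forms
    using curv scalar_curvature.flat_def[OF S] by auto
  have tt: "rel_tt \<Phi> \<Phi>p t \<longleftrightarrow> (\<forall>\<phi>. A.linear_form \<phi> \<longrightarrow> scalar_curvature.tt \<Phi> \<Phi>p (c \<phi>))"
  proof -
    have "\<phi> (commutator (t \<alpha>) (\<Sum>\<beta>\<in>\<Psi> \<inter> \<Phi>p. t \<beta>)) = (\<Sum>\<beta>\<in>\<Psi> \<inter> \<Phi>p. c \<phi> \<alpha> \<beta>)"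
      if "A.linear_form \<phi>" for \<phi> \<alpha> \<Psi>
      by (simp add: A.commutator_sum_right A.forms.linear_sum[OF that] c_def)
    then show ?thesis
      unfolding rel_tt_def A.eq_0_iff_linear_forms using scalar_curvature.tt_def[OF S] by auto
  qed
  have tautau: "rel_tautau \<Phi> \<tau> \<longleftrightarrow>
      (\<forall>\<phi>. A.linear_form \<phi> \<longrightarrow> (\<forall>u\<in>cartan \<Phi>. \<forall>v\<in>cartan \<Phi>. e \<phi> u v = 0))"
    unfolding rel_tautau_def A.eq_0_iff_linear_forms e_def by auto
  have ttau: "rel_ttau \<Phi> \<Phi>p smul t \<tau> \<longleftrightarrow>
      (\<forall>\<phi>. A.linear_form \<phi> \<longrightarrow> scalar_curvature.ttau \<Phi> \<Phi>p (c \<phi>) (d \<phi>))"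
  proof -
    have *: "\<phi> (commutator (t \<alpha>) (tau_w \<Phi>p smul t \<tau> w u)) =
        d \<phi> \<alpha> u - (\<Sum>\<beta>\<in>\<Phi>p \<inter> w ` (uminus ` \<Phi>p). u \<beta> * c \<phi> \<alpha> \<beta>)"
      if "A.linear_form \<phi>" for \<phi> \<alpha> w u
      by (simp only: tau_w_def A.commutator_diff_right A.commutator_sum_right A.commutator_smul_right
          A.forms.linear_diff[OF that] A.forms.linear_sum[OF that] A.forms.linear_scale[OF that] c_def d_def)
    have "commutator (t \<alpha>) (tau_w \<Phi>p smul t \<tau> w u) = 0 \<longleftrightarrow>
        (\<forall>\<phi>. A.linear_form \<phi> \<longrightarrow> d \<phi> \<alpha> u = (\<Sum>\<beta>\<in>\<Phi>p \<inter> w ` (uminus ` \<Phi>p). u \<beta> * c \<phi> \<alpha> \<beta>))"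
      for \<alpha> w u
      unfolding A.eq_0_iff_linear_forms
      by (intro all_cong1 imp_cong refl) (simp only: * right_minus_eq)
    then show ?thesis
      unfolding rel_ttau_def using scalar_curvature.ttau_def[OF S] by auto
  qed
  have tdelta: "rel_tdelta \<Phi> \<Phi>p smul t \<tau> \<longleftrightarrow>
      (\<forall>\<phi>. A.linear_form \<phi> \<longrightarrow> scalar_curvature.tdelta \<Phi> \<Phi>p (c \<phi>) (d \<phi>))"
  proof -
    have *: "\<phi> (commutator (t \<alpha>) (delta \<Phi>p smul t \<tau> v)) = d \<phi> \<alpha> v - 1 / 2 * (\<Sum>\<beta>\<in>\<Phi>p. v \<beta> * c \<phi> \<alpha> \<beta>)"
      if "A.linear_form \<phi>" for \<phi> \<alpha> v
      by (simp only: delta_def A.commutator_diff_right A.commutator_sum_right A.commutator_smul_right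
          A.forms.linear_diff[OF that] A.forms.linear_sum[OF that] A.forms.linear_scale[OF that] c_def d_def)
    have "commutator (t \<alpha>) (delta \<Phi>p smul t \<tau> v) = 0 \<longleftrightarrow>
        (\<forall>\<phi>. A.linear_form \<phi> \<longrightarrow> d \<phi> \<alpha> v = 1 / 2 * (\<Sum>\<beta>\<in>\<Phi>p. v \<beta> * c \<phi> \<alpha> \<beta>))" for \<alpha> v
      unfolding A.eq_0_iff_linear_forms
      by (intro all_cong1 imp_cong refl) (simp only: * right_minus_eq)
    then have "rel_tdelta \<Phi> \<Phi>p smul t \<tau> \<longleftrightarrow> (\<forall>\<phi>. A.linear_form \<phi> \<longrightarrow>
        (\<forall>\<alpha>\<in>\<Phi>. \<forall>v\<in>cartan \<Phi>. v \<alpha> = 0 \<longrightarrow> d \<phi> \<alpha> v = 1 / 2 * (\<Sum>\<beta>\<in>\<Phi>p. v \<beta> * c \<phi> \<alpha> \<beta>)))"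
      unfolding rel_tdelta_def by blast
    also have "\<dots> \<longleftrightarrow> (\<forall>\<phi>. A.linear_form \<phi> \<longrightarrow> scalar_curvature.tdelta \<Phi> \<Phi>p (c \<phi>) (d \<phi>))"
      by (intro all_cong1 imp_cong refl) (simp only: scalar_curvature.tdelta_def[OF S])
    finally show ?thesis .
  qed
  show ?thesis
    unfolding flat tt tautau ttau tdelta
    using scalar_curvature.flat_iff[OF S] scalar_curvature.ttau_iff_tdelta[OF S] by blast
qed

end
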